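(* Consider a quantum communication protocol $\mathcal{R}$ whose goal is to compute a joint function $f(x,y)\in\{0,1\}$ (where $x$ is known only to Alice and $y$ only to Bob). Suppose that $\mathcal{R}$ uses an arbitrary bipartite entangled state $|\psi\rangle^{AB}$ (of unbounded dimension) as shared entanglement, as well as $Q$ qubits of communication in total, in either direction, where $Q\ge 15$. Then, for every $\epsilon>0$, there exists a quantum communication protocol $\mathcal{R}'$ which simulates $\mathcal{R}$ with error $\epsilon$, while using only a maximally entangled state as an entangled resource (rather than $|\psi\rangle^{AB}$ or any other state), and using $O\big(Q/\epsilon+\log(1/\epsilon)/\epsilon\big)$ qubits of communication, where the constant in $O(\cdot)$ is universal. Thus, if $\mathcal{R}$ computes $f$ with error $\epsilon'$, then $\mathcal{R}'$ computes $f$ with error $\epsilon+\epsilon'$.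
   Context: A (two-party, entanglement-assisted) quantum communication protocol: Alice holds input $x$, Bob holds input $y$, and they share a bipartite entangled state that does not depend on the inputs, Alice holding the $A$ part and Bob the $B$ part. They may append local ancillas, apply local unitaries (depending on their own inputs) and send qubits to one another; the communication cost is the total number of qubits sent in either direction. The output bit is obtained by a final measurement. The function $f$ may be total or partial (defined only on a promised set of input pairs). A protocol computes $f$ with error $\epsilon'$ if, for every (promised) input pair $(x,y)$, it outputs $f(x,y)$ with probability at least $1-\epsilon'$. A protocol $\mathcal{R}'$ simulates $\mathcal{R}$ with error $\epsilon$ if, for every input pair $(x,y)$, the probability of each output value under $\mathcal{R}'$ differs by at most $\epsilon$ from its probability under $\mathcal{R}$. A maximally entangled state is one whose nonzero Schmidt coefficients are all equal (e.g. a collection of EPR pairs); its dimension is not restricted. *)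

theory Defs
  imports Complex_Main "Jordan_Normal_Form.Schur_Decomposition"
begin

text \<open>
  A pure state of two registers of dimensions a (Alice) and b (Bob) is given by its amplitude
  matrix: the entry at (i, j) is the amplitude of |i> tensor |j>. All spaces are
  finite-dimensional, of arbitrary dimension; dimensions are values rather than types, since they
  change in the course of a protocol and one constant has to serve for all of them.
\<close>

type_synonym bipartite = "complex mat"

definition braket :: "bipartite \<Rightarrow> bipartite \<Rightarrow> complex" where
  "braket \<Phi> \<Psi> = (\<Sum>i<dim_row \<Phi>. \<Sum>j<dim_col \<Phi>. cnj (\<Phi> $$ (i, j)) * \<Psi> $$ (i, j))"

definition normalized :: "bipartite \<Rightarrow> bool" where
  "normalized \<Psi> \<longleftrightarrow> (\<Sum>i<dim_row \<Psi>. \<Sum>j<dim_col \<Psi>. (cmod (\<Psi> $$ (i, j)))\<^sup>2) = 1"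

text \<open>On amplitude matrices, M tensor identity is left multiplication by M, and identity tensor M
  is right multiplication by the transpose (not the adjoint) of M.\<close>

definition on_alice :: "complex mat \<Rightarrow> bipartite \<Rightarrow> bipartite" where
  "on_alice M \<Psi> = M * \<Psi>"

definition on_bob :: "complex mat \<Rightarrow> bipartite \<Rightarrow> bipartite" where
  "on_bob M \<Psi> = \<Psi> * transpose_mat M"

definition unitary :: "nat \<Rightarrow> complex mat \<Rightarrow> bool" where
  "unitary n U \<longleftrightarrow> U \<in> carrier_mat n n \<and> mat_adjoint U * U = 1\<^sub>m n \<and> U * mat_adjoint U = 1\<^sub>m n"

text \<open>The order on complex numbers used here makes 0 \<le> z mean that z is real and nonnegative.\<close>

definition positive_semidefinite :: "nat \<Rightarrow> complex mat \<Rightarrow> bool" where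
  "positive_semidefinite n M \<longleftrightarrow> M \<in> carrier_mat n n \<and>
     (\<forall>v \<in> carrier_vec n. 0 \<le> (M *\<^sub>v v) \<bullet>c v)"

definition orthonormal_family :: "nat \<Rightarrow> nat \<Rightarrow> (nat \<Rightarrow> complex vec) \<Rightarrow> bool" where
  "orthonormal_family n r u \<longleftrightarrow> (\<forall>k<r. u k \<in> carrier_vec n) \<and>
     (\<forall>k<r. \<forall>l<r. u k \<bullet>c u l = (if k = l then 1 else 0))"

definition schmidt_decomposition ::
    "bipartite \<Rightarrow> nat \<Rightarrow> (nat \<Rightarrow> real) \<Rightarrow> (nat \<Rightarrow> complex vec) \<Rightarrow> (nat \<Rightarrow> complex vec) \<Rightarrow> bool" where
  "schmidt_decomposition \<Psi> r \<sigma> u v \<longleftrightarrow>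
     orthonormal_family (dim_row \<Psi>) r u \<and> orthonormal_family (dim_col \<Psi>) r v \<and>
     (\<forall>k<r. 0 \<le> \<sigma> k) \<and>
     (\<forall>i<dim_row \<Psi>. \<forall>j<dim_col \<Psi>.
        \<Psi> $$ (i, j) = (\<Sum>k<r. complex_of_real (\<sigma> k) * u k $ i * v k $ j))"

definition maximally_entangled :: "bipartite \<Rightarrow> bool" where
  "maximally_entangled \<Psi> \<longleftrightarrow> normalized \<Psi> \<and>
     (\<exists>r \<sigma> u v. schmidt_decomposition \<Psi> r \<sigma> u v \<and>
        (\<forall>k<r. \<forall>l<r. \<sigma> k \<noteq> 0 \<longrightarrow> \<sigma> l \<noteq> 0 \<longrightarrow> \<sigma> k = \<sigma> l))"


text \<open>Inputs are bit strings. This is a fixed type on purpose: a constant quantified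
  existentially in a theorem about protocols with inputs of type 'x and 'y would be allowed
  to depend on 'x and 'y.\<close>

type_synonym input = "bool list"

datatype step =
    AliceAncilla nat
  | BobAncilla nat
  | AliceUnitary "input \<Rightarrow> complex mat"
  | BobUnitary "input \<Rightarrow> complex mat"
  | AliceSends
  | BobSends

text \<open>
  Composite indices put the last tensor factor in the least significant position. An ancilla of
  dimension m, in the state |0>, becomes the last factor of its owner's register. Sending a qubit
  makes the last tensor factor (of dimension 2) of the sender's register the last factor of the
  receiver's.
\<close>

fun apply_step :: "input \<Rightarrow> input \<Rightarrow> step \<Rightarrow> bipartite \<Rightarrow> bipartite" where
  "apply_step x y (AliceAncilla m) \<Psi> =
     mat (dim_row \<Psi> * m) (dim_col \<Psi>)
       (\<lambda>(i, j). if i mod m = 0 then \<Psi> $$ (i div m, j) else 0)"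
| "apply_step x y (BobAncilla m) \<Psi> =
     mat (dim_row \<Psi>) (dim_col \<Psi> * m)
       (\<lambda>(i, j). if j mod m = 0 then \<Psi> $$ (i, j div m) else 0)"
| "apply_step x y (AliceUnitary U) \<Psi> = on_alice (U x) \<Psi>"
| "apply_step x y (BobUnitary V) \<Psi> = on_bob (V y) \<Psi>"
| "apply_step x y AliceSends \<Psi> =
     mat (dim_row \<Psi> div 2) (dim_col \<Psi> * 2) (\<lambda>(i, j). \<Psi> $$ (2 * i + j mod 2, j div 2))"
| "apply_step x y BobSends \<Psi> =
     mat (dim_row \<Psi> * 2) (dim_col \<Psi> div 2) (\<lambda>(i, j). \<Psi> $$ (i div 2, 2 * j + i mod 2))"

fun step_dims :: "step \<Rightarrow> nat \<times> nat \<Rightarrow> nat \<times> nat" where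
  "step_dims (AliceAncilla m) (a, b) = (a * m, b)"
| "step_dims (BobAncilla m) (a, b) = (a, b * m)"
| "step_dims (AliceUnitary U) (a, b) = (a, b)"
| "step_dims (BobUnitary V) (a, b) = (a, b)"
| "step_dims AliceSends (a, b) = (a div 2, b * 2)"
| "step_dims BobSends (a, b) = (a * 2, b div 2)"

fun valid_step :: "step \<Rightarrow> nat \<times> nat \<Rightarrow> bool" where
  "valid_step (AliceAncilla m) (a, b) \<longleftrightarrow> 0 < m"
| "valid_step (BobAncilla m) (a, b) \<longleftrightarrow> 0 < m"
| "valid_step (AliceUnitary U) (a, b) \<longleftrightarrow> (\<forall>x. unitary a (U x))"
| "valid_step (BobUnitary V) (a, b) \<longleftrightarrow> (\<forall>y. unitary b (V y))"
| "valid_step AliceSends (a, b) \<longleftrightarrow> even a"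
| "valid_step BobSends (a, b) \<longleftrightarrow> even b"

fun valid_steps :: "step list \<Rightarrow> nat \<times> nat \<Rightarrow> bool" where
  "valid_steps [] d \<longleftrightarrow> True"
| "valid_steps (s # ss) d \<longleftrightarrow> valid_step s d \<and> valid_steps ss (step_dims s d)"

text \<open>The output is obtained by a two-outcome measurement of the register of one party, which may
  depend on that party's input; it is given by its measurement operators (a POVM).\<close>

datatype measurement =
    AliceMeasures "input \<Rightarrow> bool \<Rightarrow> complex mat"
  | BobMeasures "input \<Rightarrow> bool \<Rightarrow> complex mat"

definition povm :: "nat \<Rightarrow> (bool \<Rightarrow> complex mat) \<Rightarrow> bool" where
  "povm n E \<longleftrightarrow> positive_semidefinite n (E False) \<and> positive_semidefinite n (E True) \<and>
     E False + E True = 1\<^sub>m n"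

fun valid_measurement :: "measurement \<Rightarrow> nat \<times> nat \<Rightarrow> bool" where
  "valid_measurement (AliceMeasures E) (a, b) \<longleftrightarrow> (\<forall>x. povm a (E x))"
| "valid_measurement (BobMeasures E) (a, b) \<longleftrightarrow> (\<forall>y. povm b (E y))"

record protocol =
  resource :: bipartite
  steps :: "step list"
  final_measurement :: measurement

definition valid_protocol :: "protocol \<Rightarrow> bool" where
  "valid_protocol P \<longleftrightarrow>
     (let d = (dim_row (resource P), dim_col (resource P)) in
        normalized (resource P) \<and> valid_steps (steps P) d \<and>
        valid_measurement (final_measurement P) (fold step_dims (steps P) d))"

definition final_state :: "protocol \<Rightarrow> input \<Rightarrow> input \<Rightarrow> bipartite" where
  "final_state P x y = fold (apply_step x y) (steps P) (resource P)"

definition output_prob :: "protocol \<Rightarrow> input \<Rightarrow> input \<Rightarrow> bool \<Rightarrow> real" where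
  "output_prob P x y z =
     (let \<Phi> = final_state P x y in
      case final_measurement P of
        AliceMeasures E \<Rightarrow> Re (braket \<Phi> (on_alice (E x z) \<Phi>))
      | BobMeasures E \<Rightarrow> Re (braket \<Phi> (on_bob (E y z) \<Phi>)))"

definition communication_cost :: "protocol \<Rightarrow> nat" where
  "communication_cost P = length (filter (\<lambda>s. s = AliceSends \<or> s = BobSends) (steps P))"

definition simulates :: "protocol \<Rightarrow> protocol \<Rightarrow> real \<Rightarrow> bool" where
  "simulates P' P \<epsilon> \<longleftrightarrow> (\<forall>x y z. \<bar>output_prob P' x y z - output_prob P x y z\<bar> \<le> \<epsilon>)"

text \<open>A partial function is computed if it is computed on its domain, the promised input pairs.\<close>

definition computes :: "protocol \<Rightarrow> (input \<times> input \<rightharpoonup> bool) \<Rightarrow> real \<Rightarrow> bool" where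
  "computes P f \<epsilon> \<longleftrightarrow> (\<forall>x y z. f (x, y) = Some z \<longrightarrow> output_prob P x y z \<ge> 1 - \<epsilon>)"

end

theory Submission
  imports Defs
begin

text \<open>
  Write the shared state as a sum of terms s_i |u_i>|v_i> (Schmidt decomposition). The output
  probability of the protocol is then the value at (s_i) of a real quadratic form, whose coefficients
  are the responses of the protocol to pairs of terms. Since Q qubits of communication change
  operator norms and Schmidt ranks by at most 2^Q each, the terms i, j contribute next to nothing if
  s_i / s_j exceeds 4^Q / \<epsilon>. Put the s_i into bins of this width on a logarithmic scale and cut the scale
  into chunks of about 8 / \<epsilon> bins: dropping all terms between different chunks loses little if the
  cuts are placed well, because only neighbouring bins at a cut matter. Without these terms the state is as
  good as a classical mixture of chunks, and the label of the chunk may be held by both parties.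
  After rounding, s_i^2 is a multiple q_i L of a unit L that depends on the chunk only, where q_i is at
  most 2^w with w of order (Q + log (1 / \<epsilon>)) / \<epsilon>. This is the state that is obtained from a maximally
  entangled one by replacing, for every i, a maximally entangled factor of rank q_i with a fixed
  state, for which it is enough that Alice sends her w-qubit half of that factor to Bob.
\<close>

section \<open>Quadratic forms and the spectrum of Schmidt coefficients\<close>

text \<open>Local isometries do not change Schmidt coefficients, so every spread of coefficients
  that a maximally entangled state lacks must be created by communication, while the given state may
  have unbounded spread. Chunks bound the spread that has to be created coherently: it is (bins per
  chunk) times (bin width), and this product is where Q / \<epsilon> + log (1 / \<epsilon>) /
  \<epsilon> comes from. The weights of whole chunks are free, because a chunk is weighted by the
  number of copies of its label, and orthogonal labels on both sides remove exactly the cross terms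
  between chunks. The resource must not depend on the inputs. Hence the cuts and the rounded
  coefficients are chosen from the spectrum and Q alone, and the estimates are proved for every real
  form that lies between 0 and the identity and satisfies the low-rank bound; each triple of inputs
  and outcome supplies one such form. Distant bins are handled by pairing a bound on the number of
  product terms on one side with an operator norm bound on the other. That pairing gains nothing for
  adjacent bins, which is why averaging over the position of the cuts is needed.\<close>

definition qform :: "nat \<Rightarrow> (nat \<Rightarrow> nat \<Rightarrow> real) \<Rightarrow> (nat \<Rightarrow> real) \<Rightarrow> real" where
  "qform r b h = (\<Sum>i<r. \<Sum>j<r. h i * h j * b i j)"

text \<open>These are the real symmetric matrices between 0 and the identity. The condition is put
  on values of the form, which for a protocol are measurement weights; eigenvalues never
  enter.\<close>

definition subunit_form :: "nat \<Rightarrow> (nat \<Rightarrow> nat \<Rightarrow> real) \<Rightarrow> bool" where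
  "subunit_form r b \<longleftrightarrow> (\<forall>i<r. \<forall>j<r. b i j = b j i) \<and>
     (\<forall>h. 0 \<le> qform r b h \<and> qform r b h \<le> (\<Sum>i<r. (h i)\<^sup>2))"

lemma qform_add_scaled:
  assumes "subunit_form r b"
  shows "qform r b (\<lambda>i. f i + t * h i) =
    qform r b f + 2 * t * (\<Sum>i<r. \<Sum>j<r. f i * h j * b i j) + t\<^sup>2 * qform r b h"
proof -
  have sym: "(\<Sum>i<r. \<Sum>j<r. h i * f j * b i j) = (\<Sum>i<r. \<Sum>j<r. f i * h j * b i j)"
    by (subst sum.swap, intro sum.cong refl)
      (use assms in \<open>auto simp: subunit_form_def mult.commute\<close>)
  have "qform r b (\<lambda>i. f i + t * h i) =
    (\<Sum>i<r. \<Sum>j<r. f i * f j * b i j + t * (f i * h j * b i j) + t * (h i * f j * b i j)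
        + t\<^sup>2 * (h i * h j * b i j))"
    unfolding qform_def by (intro sum.cong refl) (simp add: algebra_simps power2_eq_square)
  also have "\<dots> = qform r b f + t * (\<Sum>i<r. \<Sum>j<r. f i * h j * b i j)
      + t * (\<Sum>i<r. \<Sum>j<r. h i * f j * b i j) + t\<^sup>2 * qform r b h"
    by (simp add: sum.distrib qform_def flip: sum_distrib_left)
  finally show ?thesis using sym by simp
qed

text \<open>Cauchy-Schwarz in arithmetic-mean form, from the nonnegative values of the form at f + h
  / t and f - h / t. The weight \<open>t\<close> stays free to balance vectors of different
  size.\<close>

lemma subunit_form_cross_le:
  assumes b: "subunit_form r b" and t: "t > 0"
  shows "2 * \<bar>\<Sum>i<r. \<Sum>j<r. f i * h j * b i j\<bar> \<le> t * (\<Sum>i<r. (f i)\<^sup>2) + (\<Sum>i<r. (h i)\<^sup>2) / t"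
proof -
  let ?X = "\<Sum>i<r. \<Sum>j<r. f i * h j * b i j"
  have q: "0 \<le> qform r b g" "qform r b g \<le> (\<Sum>i<r. (g i)\<^sup>2)" for g
    using b by (auto simp: subunit_form_def)
  have "0 \<le> qform r b f + 2 * (1/t) * ?X + (1/t)\<^sup>2 * qform r b h"
    "0 \<le> qform r b f + 2 * (- 1/t) * ?X + (- 1/t)\<^sup>2 * qform r b h"
    by (subst qform_add_scaled[OF b, symmetric], rule q(1))+
  then have "2 * (1/t) * \<bar>?X\<bar> \<le> qform r b f + (1/t)\<^sup>2 * qform r b h"
    by (auto simp: abs_if)
  also have "\<dots> \<le> (\<Sum>i<r. (f i)\<^sup>2) + (1/t)\<^sup>2 * (\<Sum>i<r. (h i)\<^sup>2)"
    by (intro add_mono mult_left_mono q) auto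
  finally have "t * (2 * (1/t) * \<bar>?X\<bar>) \<le> t * ((\<Sum>i<r. (f i)\<^sup>2) + (1/t)\<^sup>2 * (\<Sum>i<r. (h i)\<^sup>2))"
    by (rule mult_left_mono) (use t in auto)
  moreover have "t * (2 * (1/t) * \<bar>?X\<bar>) = 2 * \<bar>?X\<bar>" using t by simp
  moreover have "t * (A + (1/t)\<^sup>2 * B) = t * A + B / t" for A B
    using t by (simp add: field_simps power2_eq_square)
  ultimately show ?thesis by simp
qed

text \<open>The error vector has norm at most \<eta> times that of \<sigma>. With weight \<eta> in
  the Cauchy-Schwarz bound the cross term costs 2 \<eta>, and the square of the error at most one
  more \<eta>.\<close>

lemma qform_perturb:
  assumes b: "subunit_form r b" and \<eta>: "0 < \<eta>" "\<eta> \<le> 1"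
    and close: "\<And>i. i < r \<Longrightarrow> \<bar>\<tau> i - \<sigma> i\<bar> \<le> \<eta> * \<sigma> i"
  shows "\<bar>qform r b \<tau> - qform r b \<sigma>\<bar> \<le> 3 * \<eta> * (\<Sum>i<r. (\<sigma> i)\<^sup>2)"
proof -
  define \<delta> where "\<delta> i = \<tau> i - \<sigma> i" for i
  let ?n = "\<Sum>i<r. (\<sigma> i)\<^sup>2"
  have n: "0 \<le> ?n" by (simp add: sum_nonneg)
  have d: "(\<Sum>i<r. (\<delta> i)\<^sup>2) \<le> \<eta>\<^sup>2 * ?n"
    unfolding sum_distrib_left
  proof (intro sum_mono)
    fix i assume "i \<in> {..<r}"
    then have "\<bar>\<delta> i\<bar>\<^sup>2 \<le> (\<eta> * \<sigma> i)\<^sup>2" using close[of i]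
      by (intro power_mono) (auto simp: \<delta>_def)
    then show "(\<delta> i)\<^sup>2 \<le> \<eta>\<^sup>2 * (\<sigma> i)\<^sup>2" by (simp add: power_mult_distrib)
  qed
  have "qform r b \<tau> = qform r b (\<lambda>i. \<sigma> i + 1 * \<delta> i)" by (simp add: \<delta>_def)
  also have "\<dots> = qform r b \<sigma> + 2 * (\<Sum>i<r. \<Sum>j<r. \<sigma> i * \<delta> j * b i j) + qform r b \<delta>"
    by (subst qform_add_scaled[OF b]) simp
  finally have "\<bar>qform r b \<tau> - qform r b \<sigma>\<bar> \<le>
      2 * \<bar>\<Sum>i<r. \<Sum>j<r. \<sigma> i * \<delta> j * b i j\<bar> + \<bar>qform r b \<delta>\<bar>" by linarith
  also have "\<dots> \<le> (\<eta> * ?n + (\<Sum>i<r. (\<delta> i)\<^sup>2) / \<eta>) + (\<Sum>i<r. (\<delta> i)\<^sup>2)"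
  proof (rule add_mono)
    have "0 \<le> qform r b \<delta>" "qform r b \<delta> \<le> (\<Sum>i<r. (\<delta> i)\<^sup>2)"
      using b by (auto simp: subunit_form_def)
    then show "\<bar>qform r b \<delta>\<bar> \<le> (\<Sum>i<r. (\<delta> i)\<^sup>2)" by linarith
  qed (rule subunit_form_cross_le[OF b \<eta>(1)])
  also have "\<dots> \<le> (\<eta> * ?n + \<eta>\<^sup>2 * ?n / \<eta>) + \<eta>\<^sup>2 * ?n"
    using d \<eta> by (intro add_mono divide_right_mono) auto
  also have "\<dots> \<le> (\<eta> * ?n + \<eta> * ?n) + \<eta> * ?n"
  proof -
    have "\<eta>\<^sup>2 \<le> \<eta>" using \<eta> by (simp add: power2_eq_square mult_left_le)
    then show ?thesis using \<eta> n mult_right_mono[of "\<eta>\<^sup>2" \<eta> ?n] by (simp add: power2_eq_square)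
  qed
  finally show ?thesis by simp
qed

text \<open>Pinching: the block-diagonal part evaluates \<open>b\<close> on the restriction of
  \<open>h\<close> to each chunk and adds up the values, and the squared norms of the restrictions
  add up as well.\<close>

lemma subunit_form_blocks:
  assumes b: "subunit_form r b"
  shows "subunit_form r (\<lambda>i j. if chunk i = chunk j then b i j else 0)" (is "subunit_form r ?b")
proof -
  have "0 \<le> qform r ?b h \<and> qform r ?b h \<le> (\<Sum>i<r. (h i)\<^sup>2)" for h
  proof -
    define K where "K = chunk ` {..<r}"
    define H where "H k i = (if chunk i = k then h i else 0)" for k i
    have K: "finite K" by (simp add: K_def)
    have "(\<Sum>k\<in>K. qform r b (H k)) = (\<Sum>i<r. \<Sum>j<r. \<Sum>k\<in>K. H k i * H k j * b i j)"
      unfolding qform_def by (subst sum.swap, intro sum.cong refl, rule sum.swap)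
    also have "\<dots> = qform r ?b h"
      unfolding qform_def
    proof (intro sum.cong refl)
      fix i j assume "i \<in> {..<r}" "j \<in> {..<r}"
      then have "chunk i \<in> K" by (auto simp: K_def)
      have "(\<Sum>k\<in>K. H k i * H k j * b i j) = (\<Sum>k\<in>K. if chunk i = k then H k i * H k j * b i j else 0)"
        by (intro sum.cong refl) (auto simp: H_def)
      also have "\<dots> = H (chunk i) i * H (chunk i) j * b i j"
        using K \<open>chunk i \<in> K\<close> by simp
      finally show "(\<Sum>k\<in>K. H k i * H k j * b i j) = h i * h j * ?b i j" by (auto simp: H_def)
    qed
    finally have 1: "qform r ?b h = (\<Sum>k\<in>K. qform r b (H k))" ..
    have "(\<Sum>k\<in>K. \<Sum>i<r. (H k i)\<^sup>2) = (\<Sum>i<r. \<Sum>k\<in>K. (H k i)\<^sup>2)" by (rule sum.swap)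
    also have "\<dots> = (\<Sum>i<r. (h i)\<^sup>2)"
    proof (intro sum.cong refl)
      fix i assume "i \<in> {..<r}"
      then have "chunk i \<in> K" by (auto simp: K_def)
      have "(\<Sum>k\<in>K. (H k i)\<^sup>2) = (\<Sum>k\<in>K. if chunk i = k then (h i)\<^sup>2 else 0)"
        by (intro sum.cong refl) (auto simp: H_def)
      then show "(\<Sum>k\<in>K. (H k i)\<^sup>2) = (h i)\<^sup>2" using K \<open>chunk i \<in> K\<close> by simp
    qed
    finally have 2: "(\<Sum>k\<in>K. \<Sum>i<r. (H k i)\<^sup>2) = (\<Sum>i<r. (h i)\<^sup>2)" .
    have "0 \<le> (\<Sum>k\<in>K. qform r b (H k))" 
      using b by (intro sum_nonneg) (auto simp: subunit_form_def)
    moreover have "(\<Sum>k\<in>K. qform r b (H k)) \<le> (\<Sum>k\<in>K. \<Sum>i<r. (H k i)\<^sup>2)"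
      using b by (intro sum_mono) (auto simp: subunit_form_def)
    ultimately show ?thesis unfolding 1 2 by simp
  qed
  then show ?thesis using b by (auto simp: subunit_form_def)
qed

text \<open>Every chunk gets a common unit L k, so that the number of units q i needed by a member
  is bounded by the ratio of the coefficients in the chunk.\<close>

lemma chunk_rounding:
  fixes \<sigma> :: "nat \<Rightarrow> real"
  assumes pos: "\<And>i. i < r \<Longrightarrow> 0 < \<sigma> i" and one: "(\<Sum>i<r. (\<sigma> i)\<^sup>2) = 1"
    and ratio: "\<And>i j. i < r \<Longrightarrow> j < r \<Longrightarrow> chunk i = chunk j \<Longrightarrow> \<sigma> i \<le> \<rho> * \<sigma> j"
    and \<eta>: "0 < \<eta>" "\<eta> \<le> 1/2"
  obtains L q :: "nat \<Rightarrow> nat" where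
    "\<And>i. i < r \<Longrightarrow> 0 < L (chunk i)" "\<And>i. i < r \<Longrightarrow> 0 < q i" "\<And>i. i < r \<Longrightarrow> real (q i) \<le> 2 * \<rho>\<^sup>2 / \<eta>"
    "\<And>i. i < r \<Longrightarrow> \<bar>sqrt (q i * L (chunk i) / (\<Sum>j<r. real (q j * L (chunk j)))) - \<sigma> i\<bar> \<le> \<eta> * \<sigma> i"
proof -
  define m where "m k = Min (\<sigma> ` {i. i < r \<and> chunk i = k})" for k
  \<comment> \<open>A common scale so large that the number rounded down in \<open>L\<close> is at
    least 1 in every chunk; each summand alone secures this for one index. The floor is then
    positive and loses at most a factor 2.\<close>
  define D0 where "D0 = (\<Sum>i<r. 1 / ((m (chunk i))\<^sup>2 * \<eta>))"
  \<comment> \<open>The unit is about a fraction \<eta> of the smallest scaled weight in the chunk,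
    so rounding any weight of the chunk down to a multiple of it loses at most a relative
    \<eta>.\<close>
  define L where "L k = nat \<lfloor>D0 * (m k)\<^sup>2 * \<eta>\<rfloor>" for k
  define q where "q i = nat \<lfloor>(\<sigma> i)\<^sup>2 * D0 / L (chunk i)\<rfloor>" for i
  define D where "D = (\<Sum>j<r. real (q j * L (chunk j)))"
  have m_in: "m (chunk i) \<in> \<sigma> ` {j. j < r \<and> chunk j = chunk i}" if "i < r" for i
    unfolding m_def using that by (intro Min_in) auto
  have m_pos: "0 < m (chunk i)" if "i < r" for i using m_in[OF that] pos by auto
  have m_le: "m (chunk i) \<le> \<sigma> i" if "i < r" for i
    unfolding m_def using that by (intro Min_le) auto
  have m_ratio: "\<sigma> i \<le> \<rho> * m (chunk i)" if "i < r" for i using m_in[OF that] ratio that by auto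
  have D0: "1 \<le> D0 * (m (chunk i))\<^sup>2 * \<eta>" if "i < r" for i
  proof -
    have "1 / ((m (chunk i))\<^sup>2 * \<eta>) \<le> D0"
      unfolding D0_def using that \<eta> by (intro member_le_sum) auto
    then show ?thesis using m_pos[OF that] \<eta> by (simp add: field_simps)
  qed
  have "0 < r" using one by (cases r) auto
  have D0_pos: "0 < D0" unfolding D0_def
  proof (rule sum_pos)
    fix i assume "i \<in> {..<r}"
    then show "0 < 1 / ((m (chunk i))\<^sup>2 * \<eta>)" using m_pos[of i] \<eta> by simp
  qed (use \<open>0 < r\<close> in auto)
  have L1: "1 \<le> L (chunk i)" if "i < r" for i
    unfolding L_def using D0[OF that] by linarith
  have Lle: "real (L (chunk i)) \<le> D0 * (m (chunk i))\<^sup>2 * \<eta>" if "i < r" for i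
    unfolding L_def using D0[OF that] by linarith
  have floor_ge: "z \<le> 2 * real (nat \<lfloor>z\<rfloor>)" if "1 \<le> z" for z :: real
  proof -
    have "1 \<le> \<lfloor>z\<rfloor>" using that by simp
    then have "1 \<le> real_of_int \<lfloor>z\<rfloor>" "real (nat \<lfloor>z\<rfloor>) = real_of_int \<lfloor>z\<rfloor>" by auto
    then show ?thesis using floor_correct[of z] by linarith
  qed
  have Lge: "D0 * (m (chunk i))\<^sup>2 * \<eta> \<le> 2 * real (L (chunk i))" if "i < r" for i
    unfolding L_def by (rule floor_ge[OF D0[OF that]])
  have Lle': "real (L (chunk i)) \<le> \<eta> * ((\<sigma> i)\<^sup>2 * D0)" if "i < r" for i
  proof -
    have "D0 * (m (chunk i))\<^sup>2 * \<eta> \<le> D0 * (\<sigma> i)\<^sup>2 * \<eta>"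
      using m_le[OF that] m_pos[OF that] D0_pos \<eta>
      by (intro mult_right_mono mult_left_mono power_mono) auto
    then show ?thesis using Lle[OF that] by (simp add: mult_ac)
  qed
  have arg: "0 \<le> (\<sigma> i)\<^sup>2 * D0 / L (chunk i)" for i using D0_pos by auto
  have qle: "q i * L (chunk i) \<le> (\<sigma> i)\<^sup>2 * D0" if "i < r" for i
  proof -
    have "real (q i) \<le> (\<sigma> i)\<^sup>2 * D0 / L (chunk i)" unfolding q_def using arg[of i] by linarith
    then show ?thesis using L1[OF that] by (simp add: field_simps)
  qed
  have qge: "(1 - \<eta>) * ((\<sigma> i)\<^sup>2 * D0) \<le> q i * L (chunk i)" if "i < r" for i
  proof -
    have "(\<sigma> i)\<^sup>2 * D0 / L (chunk i) \<le> real (q i) + 1" unfolding q_def using arg[of i] by linarith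
    then have "(\<sigma> i)\<^sup>2 * D0 \<le> q i * L (chunk i) + L (chunk i)"
      using L1[OF that] by (simp add: field_simps)
    then show ?thesis using Lle'[OF that] by (simp add: algebra_simps)
  qed
  have qpos: "0 < q i" if "i < r" for i
  proof -
    have "0 < (1 - \<eta>) * ((\<sigma> i)\<^sup>2 * D0)" using \<eta> D0_pos pos[OF that] by auto
    then have "0 < real (q i) * real (L (chunk i))" using qge[OF that] by simp
    then show ?thesis by (auto intro: ccontr)
  qed
  have qbound: "real (q i) \<le> 2 * \<rho>\<^sup>2 / \<eta>" if "i < r" for i
  proof -
    have "(\<sigma> i)\<^sup>2 \<le> (\<rho> * m (chunk i))\<^sup>2" using m_ratio[OF that] pos[OF that] by (intro power_mono) auto
    then have "(\<sigma> i)\<^sup>2 * D0 * \<eta> \<le> \<rho>\<^sup>2 * (D0 * (m (chunk i))\<^sup>2 * \<eta>)"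
      using D0_pos \<eta> by (simp add: power_mult_distrib mult_ac)
    also have "\<dots> \<le> \<rho>\<^sup>2 * (2 * real (L (chunk i)))" by (intro mult_left_mono Lge that) auto
    finally have "real (q i) * L (chunk i) * \<eta> \<le> \<rho>\<^sup>2 * (2 * real (L (chunk i)))"
      using mult_right_mono[OF qle[OF that] less_imp_le[OF \<eta>(1)]] unfolding of_nat_mult by linarith
    then have "real (q i) * \<eta> \<le> 2 * \<rho>\<^sup>2" using L1[OF that]
      by (simp add: mult_ac) 
    then show ?thesis using \<eta> by (simp add: field_simps)
  qed
  \<comment> \<open>Rounding also changes the total by which the new coefficients are normalized; it
    stays between (1 - \<eta>) \<open>D0\<close> and \<open>D0\<close>.\<close>
  have D_le: "D \<le> D0"
  proof -
    have "D \<le> (\<Sum>i<r. (\<sigma> i)\<^sup>2 * D0)" unfolding D_def using qle by (intro sum_mono) auto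
    then show ?thesis using one by (simp flip: sum_distrib_right)
  qed
  have D_ge: "(1 - \<eta>) * D0 \<le> D"
  proof -
    have "(\<Sum>i<r. (1 - \<eta>) * ((\<sigma> i)\<^sup>2 * D0)) \<le> D" unfolding D_def using qge by (intro sum_mono) auto
    then show ?thesis using one by (simp flip: sum_distrib_left sum_distrib_right)
  qed
  have Dpos: "0 < D" using D_ge D0_pos \<eta> mult_pos_pos[of "1 - \<eta>" D0] by linarith
  have close: "\<bar>sqrt (q i * L (chunk i) / D) - \<sigma> i\<bar> \<le> \<eta> * \<sigma> i" if "i < r" for i
  proof -
    let ?x = "q i * L (chunk i) / D"
    have s: "0 < \<sigma> i" by (rule pos[OF that])
    have "((1 - \<eta>) * \<sigma> i)\<^sup>2 \<le> (1 - \<eta>) * (\<sigma> i)\<^sup>2"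
    proof -
      have "(1 - \<eta>)\<^sup>2 \<le> 1 - \<eta>" using \<eta> by (simp add: power2_eq_square mult_left_le)
      then show ?thesis by (simp add: power_mult_distrib mult_right_mono)
    qed
    also have "\<dots> \<le> ?x"
    proof -
      have "(1 - \<eta>) * (\<sigma> i)\<^sup>2 * D \<le> (1 - \<eta>) * (\<sigma> i)\<^sup>2 * D0"
        using \<eta> D_le by (intro mult_left_mono) auto
      then have "(1 - \<eta>) * (\<sigma> i)\<^sup>2 * D \<le> q i * L (chunk i)" using qge[OF that] by simp
      then show ?thesis using Dpos by (simp add: field_simps)
    qed
    finally have 1: "(1 - \<eta>) * \<sigma> i \<le> sqrt ?x" by (rule real_le_rsqrt)
    \<comment> \<open>A smaller total pushes the normalized weight up by at most 1 / (1 - \<eta>),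
      and (1 + \<eta>)^2 absorbs this since \<eta> \<le> 1/2 makes 1 - \<eta> - \<eta>^2
      positive.\<close>
    have "?x \<le> ((1 + \<eta>) * \<sigma> i)\<^sup>2"
    proof -
      have "(1 + \<eta>)\<^sup>2 * (1 - \<eta>) - 1 = \<eta> * (1 - \<eta> - \<eta>\<^sup>2)"
        by (simp add: power2_eq_square algebra_simps)
      moreover have "\<eta>\<^sup>2 \<le> (1/2)\<^sup>2" using \<eta> by (intro power_mono) auto
      then have "0 \<le> 1 - \<eta> - \<eta>\<^sup>2" using \<eta> by (simp add: power2_eq_square)
      ultimately have "1 \<le> (1 + \<eta>)\<^sup>2 * (1 - \<eta>)" using \<eta> by (smt (verit) mult_nonneg_nonneg)
      then have "D0 * 1 \<le> D0 * ((1 + \<eta>)\<^sup>2 * (1 - \<eta>))" using D0_pos by (intro mult_left_mono) auto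
      also have "\<dots> = (1 + \<eta>)\<^sup>2 * ((1 - \<eta>) * D0)" by simp
      also have "\<dots> \<le> (1 + \<eta>)\<^sup>2 * D" by (intro mult_left_mono D_ge) auto
      finally have "D0 \<le> (1 + \<eta>)\<^sup>2 * D" by simp
      then have "(\<sigma> i)\<^sup>2 * D0 \<le> (\<sigma> i)\<^sup>2 * ((1 + \<eta>)\<^sup>2 * D)" by (intro mult_left_mono) auto
      then have "q i * L (chunk i) \<le> ((1 + \<eta>) * \<sigma> i)\<^sup>2 * D" using qle[OF that]
        by (simp add: power_mult_distrib mult_ac)
      then show ?thesis using Dpos by (simp add: field_simps)
    qed
    then have 2: "sqrt ?x \<le> (1 + \<eta>) * \<sigma> i"
      using \<eta> s by (intro real_le_lsqrt) auto
    show ?thesis using 1 2 by (simp add: algebra_simps abs_le_iff)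
  qed
  show ?thesis
    by (rule that[of L q]) (use L1 qpos qbound close in \<open>auto simp: D_def Suc_le_eq\<close>)
qed

text \<open>Averaging over the \<open>N\<close> shifts. For fixed \<open>j\<close> the quotient
  rises at exactly one shift \<rho> < N, which the telescoping sum counts, so the weights cut by all
  shifts together amount to at most \<open>c\<close>.\<close>

lemma exists_offset:
  fixes w :: "nat \<Rightarrow> real"
  assumes N: "0 < N" and w: "(\<Sum>j<J. w j) \<le> c"
  obtains \<rho> where "\<rho> < N" "(\<Sum>j<J. if (j + \<rho>) div N < (j + 1 + \<rho>) div N then w j else 0) \<le> c / N"
proof -
  let ?w = "\<lambda>\<rho> j. if (j + \<rho>) div N < (j + 1 + \<rho>) div N then w j else 0"
  have jump: "?w \<rho> j = (real ((j + Suc \<rho>) div N) - real ((j + \<rho>) div N)) * w j" for \<rho> j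
    using div_Suc[of "j + \<rho>" N] by simp
  have "(\<Sum>\<rho><N. ?w \<rho> j) = w j" for j
  proof -
    have "(\<Sum>\<rho><N. ?w \<rho> j) = (real ((j + N) div N) - real ((j + 0) div N)) * w j"
      unfolding jump sum_distrib_right[symmetric] by (subst sum_lessThan_telescope) (rule refl)
    then show ?thesis using N by simp
  qed
  then have total: "(\<Sum>\<rho><N. \<Sum>j<J. ?w \<rho> j) \<le> c" using w by (subst sum.swap) simp
  have "\<exists>\<rho><N. (\<Sum>j<J. ?w \<rho> j) \<le> c / N"
  proof (rule ccontr)
    assume "\<not> ?thesis"
    then have "(\<Sum>\<rho><N. c / N) < (\<Sum>\<rho><N. \<Sum>j<J. ?w \<rho> j)"
      using N by (intro sum_strict_mono) (auto simp: not_le)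
    then show False using total N by simp
  qed
  then show ?thesis using that by blast
qed

lemma sum_lessThan_restrict:
  "U \<subseteq> {..<r} \<Longrightarrow> (\<Sum>i<r. if i \<in> U then g i else 0) = (\<Sum>i\<in>U. g i)"
  for r :: nat
  by (simp add: sum.If_cases Int_absorb1)

text \<open>Meant for two neighbouring bins, where plain Cauchy-Schwarz charges the lost cross terms
  to the mass of the bins.\<close>

lemma disjoint_cross_le:
  fixes \<sigma> :: "nat \<Rightarrow> real"
  assumes b: "subunit_form r b" and disj: "S \<inter> T = {}" and sub: "S \<subseteq> {..<r}" "T \<subseteq> {..<r}"
  shows "2 * \<bar>\<Sum>i\<in>S. \<Sum>j\<in>T. \<sigma> i * \<sigma> j * b i j\<bar> \<le> (\<Sum>i\<in>S. (\<sigma> i)\<^sup>2) + (\<Sum>i\<in>T. (\<sigma> i)\<^sup>2)"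
proof -
  define f where "f i = (if i \<in> S then \<sigma> i else 0)" for i
  define h where "h i = (if i \<in> T then \<sigma> i else 0)" for i
  note restr = sum_lessThan_restrict
  have "(\<Sum>i<r. \<Sum>j<r. f i * h j * b i j)
      = (\<Sum>i<r. if i \<in> S then (\<Sum>j<r. if j \<in> T then \<sigma> i * \<sigma> j * b i j else 0) else 0)"
    by (intro sum.cong refl) (auto simp: f_def h_def intro!: sum.cong sum.neutral)
  also have "\<dots> = (\<Sum>i\<in>S. \<Sum>j\<in>T. \<sigma> i * \<sigma> j * b i j)" by (simp add: restr sub)
  finally have 1: "(\<Sum>i<r. \<Sum>j<r. f i * h j * b i j) = (\<Sum>i\<in>S. \<Sum>j\<in>T. \<sigma> i * \<sigma> j * b i j)" .
  have sq: "(\<Sum>i<r. (f i)\<^sup>2) = (\<Sum>i\<in>S. (\<sigma> i)\<^sup>2)" "(\<Sum>i<r. (h i)\<^sup>2) = (\<Sum>i\<in>T. (\<sigma> i)\<^sup>2)"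
    by (subst restr[OF sub(1), symmetric] restr[OF sub(2), symmetric],
        intro sum.cong refl, simp add: f_def h_def)+
  show ?thesis using subunit_form_cross_le[OF b, of 1 f h] by (simp add: 1 sq)
qed

text \<open>The bound is deliberately asymmetric: the side \<open>S\<close> enters through the sum
  of its coefficients, one product state at a time, and the side \<open>T\<close> only through its
  largest coefficient, an operator norm. For a protocol with Q qubits of communication
  \<open>C\<close> is 4^Q.\<close>

definition low_rank_form :: "nat \<Rightarrow> real \<Rightarrow> (nat \<Rightarrow> real) \<Rightarrow> (nat \<Rightarrow> nat \<Rightarrow> real) \<Rightarrow> bool" where
  "low_rank_form r C \<sigma> b \<longleftrightarrow> (\<forall>S T \<tau>. S \<subseteq> {..<r} \<longrightarrow> T \<subseteq> {..<r} \<longrightarrow> (\<forall>j\<in>T. \<sigma> j \<le> \<tau>) \<longrightarrow> 0 \<le> \<tau> \<longrightarrow>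
     \<bar>\<Sum>i\<in>S. \<Sum>j\<in>T. \<sigma> i * \<sigma> j * b i j\<bar> \<le> C * (\<Sum>i\<in>S. \<sigma> i) * \<tau>)"

text \<open>Indices are put into bins of logarithmic width g, and N consecutive bins make a chunk.
  Between bins that are not adjacent the form is negligible; the terms between adjacent bins
  that are lost at a chunk boundary are small on average over the position of the boundaries.\<close>

lemma chunking:
  fixes \<sigma> :: "nat \<Rightarrow> real"
  assumes pos: "\<And>i. i < r \<Longrightarrow> 0 < \<sigma> i" and one: "(\<Sum>i<r. (\<sigma> i)\<^sup>2) = 1"
    and g: "0 < g" and N: "0 < N" and C: "0 \<le> C"
  obtains chunk :: "nat \<Rightarrow> nat" where
    "\<And>i j. i < r \<Longrightarrow> j < r \<Longrightarrow> chunk i = chunk j \<Longrightarrow> \<sigma> i \<le> 2 ^ (g * N) * \<sigma> j"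
    "\<And>b. subunit_form r b \<Longrightarrow> low_rank_form r C \<sigma> b \<Longrightarrow>
      \<bar>qform r (\<lambda>i j. if chunk i = chunk j then b i j else 0) \<sigma> - qform r b \<sigma>\<bar> \<le> 2 / N + 2 * C / 2 ^ g"
proof -
  \<comment> \<open>Bin j is the range from 2^-(g (j + 1)), excluded, to 2^-(g j), included.
    Normalization gives \<sigma> i \<le> 1, so the floor is nonnegative and \<open>nat\<close> does
    not truncate.\<close>
  define bin where "bin i = nat \<lfloor>- log 2 (\<sigma> i) / g\<rfloor>" for i
  have le1: "\<sigma> i \<le> 1" if "i < r" for i
  proof -
    have "(\<sigma> i)\<^sup>2 \<le> (\<Sum>i<r. (\<sigma> i)\<^sup>2)" using that by (intro member_le_sum) auto
    then show ?thesis using one pos[OF that] by (simp add: power_le_one_iff abs_square_le_1)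
  qed
  have bins: "2 powr (- (real g * (bin i + 1))) < \<sigma> i" "\<sigma> i \<le> 2 powr (- (real g * bin i))"
    if "i < r" for i
  proof -
    have s: "0 < \<sigma> i" by (rule pos[OF that])
    have "0 \<le> - log 2 (\<sigma> i) / g" using le1[OF that] s g by (simp add: field_simps)
    then have "real (bin i) \<le> - log 2 (\<sigma> i) / g" "- log 2 (\<sigma> i) / g < real (bin i) + 1"
      unfolding bin_def by linarith+
    then have "log 2 (\<sigma> i) \<le> - (real g * bin i)" "- (real g * (bin i + 1)) < log 2 (\<sigma> i)"
      using g by (simp_all add: field_simps)
    then show "2 powr (- (real g * (bin i + 1))) < \<sigma> i" "\<sigma> i \<le> 2 powr (- (real g * bin i))"
      using s by (simp_all add: less_log_iff log_le_iff)
  qed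
  define J where "J = Suc (Max (bin ` {..<r}))"
  have J: "bin i < J" if "i < r" for i using that by (auto simp: J_def less_Suc_eq_le)
  define A where "A j = {i. i < r \<and> bin i = j}" for j
  define p where "p j = (\<Sum>i\<in>A j. (\<sigma> i)\<^sup>2)" for j
  have group: "(\<Sum>j<J. \<Sum>i\<in>A j. f i) = (\<Sum>i<r. f i)" for f :: "nat \<Rightarrow> real"
  proof -
    have "(\<Sum>j\<in>{..<J}. sum f {x. x \<in> {..<r} \<and> bin x = j}) = sum f {..<r}"
      using J by (intro sum.group) auto
    then show ?thesis by (simp add: A_def)
  qed
  have psum: "(\<Sum>j<J. p j) = 1" using group one by (simp add: p_def)
  have psum': "(\<Sum>j<J. p (j + 1)) \<le> 1"
  proof -
    have "(\<Sum>j<J. p (j + 1)) \<le> (\<Sum>j<Suc J. p j)"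
      by (subst sum.lessThan_Suc_shift) (simp add: p_def sum_nonneg)
    moreover have "A J = {}" using J by (auto simp: A_def)
    ultimately show ?thesis using psum by (simp add: p_def)
  qed
  \<comment> \<open>A cut between bins j and j + 1 is charged the mass of both; over all j these
    charges sum to at most 2.\<close>
  obtain \<rho> where \<rho>: "\<rho> < N"
    and cut: "(\<Sum>j<J. if (j + \<rho>) div N < (j + 1 + \<rho>) div N then p j + p (j + 1) else 0) \<le> 2 / N"
    by (rule exists_offset[OF N, of "\<lambda>j. p j + p (j + 1)" J 2])
      (use psum psum' in \<open>auto simp: sum.distrib\<close>)
  define chunk where "chunk i = (bin i + \<rho>) div N" for i
  have ratio: "\<sigma> i \<le> 2 ^ (g * N) * \<sigma> j" if "i < r" "j < r" "chunk i = chunk j" for i j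
  proof -
    have "bin j + \<rho> < N * (chunk j + 1)" unfolding chunk_def using N
      by (simp add: dividend_less_times_div)
    moreover have "N * chunk i \<le> bin i + \<rho>" unfolding chunk_def by simp
    ultimately have "bin j + 1 \<le> bin i + N" using that by simp
    then have "g * (bin j + 1) \<le> g * (bin i + N)" by (rule mult_left_mono) simp
    then have "real (g * (bin j + 1)) \<le> real (g * (bin i + N))" by (simp only: of_nat_le_iff)
    then have "- (real g * bin i) \<le> real (g * N) + - (real g * (bin j + 1))"
      by (simp add: algebra_simps)
    then have "2 powr (- (real g * bin i)) \<le> 2 powr (real (g * N) + - (real g * (bin j + 1)))"
      by (intro powr_mono) auto
    also have "\<dots> = 2 ^ (g * N) * 2 powr (- (real g * (bin j + 1)))"
      by (simp only: powr_add powr_realpow[OF zero_less_numeral])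
    also have "\<dots> \<le> 2 ^ (g * N) * \<sigma> j" using bins(1)[OF that(2)] by (intro mult_left_mono) auto
    finally show ?thesis using bins(2)[OF that(1)] by simp
  qed
  have error: "\<bar>qform r (\<lambda>i j. if chunk i = chunk j then b i j else 0) \<sigma> - qform r b \<sigma>\<bar> \<le> 2 / N + 2 * C / 2 ^ g"
    if b: "subunit_form r b" and low: "low_rank_form r C \<sigma> b" for b
  proof -
    define x where "x i j = \<sigma> i * \<sigma> j * b i j" for i j
    have xsym: "x i j = x j i" if "i < r" "j < r" for i j
      using b that by (auto simp: x_def subunit_form_def)
    \<comment> \<open>Indices in later chunks are either at least two bins away, and collected here,
      or in the very next bin, where they count only if a cut lies in between. These two kinds are
      the summands of \<open>e\<close>.\<close>
    define T where "T j = {i. i < r \<and> j + 2 \<le> bin i \<and> (j + \<rho>) div N < (bin i + \<rho>) div N}" for j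
    let ?cut = "\<lambda>j. (j + \<rho>) div N < (j + 1 + \<rho>) div N"
    define e where "e n = (\<Sum>i\<in>A n. \<Sum>j\<in>T n. x i j) +
      (if ?cut n then \<Sum>i\<in>A n. \<Sum>j\<in>A (n + 1). x i j else 0)" for n
    have "qform r b \<sigma> - qform r (\<lambda>i j. if chunk i = chunk j then b i j else 0) \<sigma>
       = (\<Sum>i<r. \<Sum>j<r. (if chunk i < chunk j then x i j else 0) + (if chunk j < chunk i then x i j else 0))"
      unfolding qform_def x_def sum_subtractf[symmetric] by (intro sum.cong refl) auto
    also have "\<dots> = (\<Sum>i<r. \<Sum>j<r. if chunk i < chunk j then x i j else 0)
        + (\<Sum>i<r. \<Sum>j<r. if chunk j < chunk i then x i j else 0)" by (simp add: sum.distrib)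
    also have "(\<Sum>i<r. \<Sum>j<r. if chunk j < chunk i then x i j else 0)
        = (\<Sum>i<r. \<Sum>j<r. if chunk i < chunk j then x i j else 0)"
      by (subst sum.swap) (intro sum.cong refl, auto intro: xsym)
    also have "(\<Sum>i<r. \<Sum>j<r. if chunk i < chunk j then x i j else 0)
        = (\<Sum>n<J. \<Sum>i\<in>A n. \<Sum>j<r. if chunk i < chunk j then x i j else 0)" by (rule group[symmetric])
    also have "\<dots> = (\<Sum>n<J. e n)"
    proof (rule sum.cong[OF refl])
      fix n
      have "(\<Sum>j<r. if chunk i < chunk j then x i j else 0) =
          (\<Sum>j\<in>T n. x i j) + (if ?cut n then \<Sum>j\<in>A (n + 1). x i j else 0)" if "i \<in> A n" for i
      proof -
        have i: "i < r" "bin i = n" using that by (auto simp: A_def)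
        have split: "chunk i < chunk j \<longleftrightarrow> j \<in> T n \<or> (?cut n \<and> j \<in> A (n + 1))" if "j < r" for j
        proof -
          have "chunk i < chunk j \<Longrightarrow> n < bin j" unfolding chunk_def i
            by (rule ccontr) (simp add: div_le_mono not_less leD)
          then show ?thesis using i that
            by (cases "bin j = n + 1") (auto simp: T_def A_def chunk_def)
        qed
        have "(\<Sum>j<r. if chunk i < chunk j then x i j else 0) =
            (\<Sum>j<r. (if j \<in> T n then x i j else 0) + (if ?cut n then (if j \<in> A (n + 1) then x i j else 0) else 0))"
          by (intro sum.cong refl) (auto simp: split, auto simp: T_def A_def)
        also have "\<dots> = (\<Sum>j\<in>T n. x i j) + (if ?cut n then \<Sum>j\<in>A (n + 1). x i j else 0)"
        proof -
          have "T n \<subseteq> {..<r}" "A (n + 1) \<subseteq> {..<r}" by (auto simp: T_def A_def)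
          then show ?thesis by (cases "?cut n") (simp_all add: sum.distrib sum_lessThan_restrict)
        qed
        finally show ?thesis .
      qed
      then show "(\<Sum>i\<in>A n. \<Sum>j<r. if chunk i < chunk j then x i j else 0) = e n"
        by (auto simp: e_def sum.distrib)
    qed
    finally have eq: "qform r b \<sigma> - qform r (\<lambda>i j. if chunk i = chunk j then b i j else 0) \<sigma> =
       2 * (\<Sum>n<J. e n)" by simp
    have far: "\<bar>\<Sum>i\<in>A n. \<Sum>j\<in>T n. x i j\<bar> \<le> C / 2 ^ g * p n" for n
    proof -
      have "\<bar>\<Sum>i\<in>A n. \<Sum>j\<in>T n. x i j\<bar> \<le> C * (\<Sum>i\<in>A n. \<sigma> i) * 2 powr (- (real g * (n + 2)))"
      proof -
        have "\<sigma> j \<le> 2 powr (- (real g * (n + 2)))" if "j \<in> T n" for j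
        proof -
          have "2 powr (- (real g * bin j)) \<le> 2 powr (- (real g * (n + 2)))"
            using that by (intro powr_mono) (auto simp: T_def intro!: mult_left_mono)
          moreover have "\<sigma> j \<le> 2 powr (- (real g * bin j))"
            using that by (intro bins(2)) (auto simp: T_def)
          ultimately show ?thesis by (rule order_trans[rotated])
        qed
        moreover have "A n \<subseteq> {..<r}" "T n \<subseteq> {..<r}" by (auto simp: A_def T_def)
        ultimately show ?thesis
          using low[unfolded low_rank_form_def, rule_format, of "A n" "T n" "2 powr (- (real g * (n + 2)))"]
          unfolding x_def by simp
      qed
      also have "\<dots> = (\<Sum>i\<in>A n. C * (\<sigma> i * 2 powr (- (real g * (n + 2)))))"
        by (simp add: sum_distrib_left sum_distrib_right mult_ac)
      also have "\<dots> \<le> (\<Sum>i\<in>A n. C * ((\<sigma> i)\<^sup>2 / 2 ^ g))"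
      proof (intro sum_mono mult_left_mono C)
        fix i assume i: "i \<in> A n"
        \<comment> \<open>The exponent g (n + 2) exceeds that of the lower end of the bin of
          \<open>i\<close> by one bin width: the lower end is at most \<sigma> i and turns the sum
          of the \<sigma> i into a sum of squares, and the remaining width is the gain 2^-g.\<close>
        have "2 powr (- (real g * (n + 2))) = 2 powr (- (real g * (bin i + 1))) * 2 powr (- real g)"
        proof -
          have "bin i = n" using i by (simp add: A_def)
          moreover have "- (real g * (n + 2)) = - (real g * (n + 1)) + - real g"
            by (simp add: algebra_simps)
          ultimately show ?thesis by (simp only: powr_add)
        qed
        also have "\<dots> \<le> \<sigma> i * 2 powr (- real g)"
          using bins(1)[of i] i by (intro mult_right_mono) (auto simp: A_def)
        also have "\<dots> = \<sigma> i / 2 ^ g" by (simp add: powr_minus powr_realpow divide_inverse)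
        finally have "\<sigma> i * 2 powr (- (real g * (n + 2))) \<le> \<sigma> i * (\<sigma> i / 2 ^ g)"
          using pos[of i] i by (intro mult_left_mono) (auto simp: A_def)
        then show "\<sigma> i * 2 powr (- (real g * (n + 2))) \<le> (\<sigma> i)\<^sup>2 / 2 ^ g"
          by (simp add: power2_eq_square)
      qed
      also have "\<dots> = C / 2 ^ g * p n" by (simp add: p_def sum_distrib_left)
      finally show ?thesis .
    qed
    have near: "2 * \<bar>\<Sum>i\<in>A n. \<Sum>j\<in>A (n + 1). x i j\<bar> \<le> p n + p (n + 1)" for n
      unfolding p_def x_def by (rule disjoint_cross_le[OF b]) (auto simp: A_def)
    have "\<bar>qform r b \<sigma> - qform r (\<lambda>i j. if chunk i = chunk j then b i j else 0) \<sigma>\<bar> \<le>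
        (\<Sum>n<J. 2 * (C / 2 ^ g) * p n + (if ?cut n then p n + p (n + 1) else 0))"
    proof -
      have "\<bar>2 * (\<Sum>n<J. e n)\<bar> \<le> (\<Sum>n<J. 2 * \<bar>e n\<bar>)"
        unfolding abs_mult sum_distrib_left[symmetric] by (simp add: sum_abs)
      also have "\<dots> \<le> (\<Sum>n<J. 2 * (C / 2 ^ g) * p n + (if ?cut n then p n + p (n + 1) else 0))"
      proof (rule sum_mono)
        fix n
        show "2 * \<bar>e n\<bar> \<le> 2 * (C / 2 ^ g) * p n + (if ?cut n then p n + p (n + 1) else 0)"
          using far[of n] near[of n] by (auto simp: e_def abs_if split: if_splits)
      qed
      finally show ?thesis unfolding eq .
    qed
    also have "\<dots> = 2 * (C / 2 ^ g) * (\<Sum>n<J. p n) + (\<Sum>n<J. if ?cut n then p n + p (n + 1) else 0)"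
      by (simp add: sum.distrib sum_distrib_left)
    also have "\<dots> \<le> 2 * C / 2 ^ g + 2 / N" using cut psum by simp
    finally show ?thesis by (simp add: abs_minus_commute)
  qed
  show ?thesis by (rule that[of chunk]) (use ratio error in blast)+
qed

text \<open>Cuts, units and multiplicities are fixed before the form is given, since one resource
  serves all inputs. The error is at most \<epsilon> / 4 from the cuts (2 / N with N \<ge> 8 /
  \<epsilon>), \<epsilon> / 4 from distant bins and 3 \<epsilon> / 8 from rounding.\<close>

lemma flattened_spectrum:
  fixes \<sigma> :: "nat \<Rightarrow> real"
  assumes pos: "\<And>i. i < r \<Longrightarrow> 0 < \<sigma> i" and one: "(\<Sum>i<r. (\<sigma> i)\<^sup>2) = 1"
    and \<epsilon>: "0 < \<epsilon>" "\<epsilon> < 1" and Q: "5 \<le> Q"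
  obtains chunk L q :: "nat \<Rightarrow> nat" and w :: nat where
    "\<And>i. i < r \<Longrightarrow> 0 < L (chunk i)" "\<And>i. i < r \<Longrightarrow> 0 < q i" "\<And>i. i < r \<Longrightarrow> q i \<le> 2 ^ w"
    "real (w + Q) \<le> 60 * (Q / \<epsilon> + log 2 (1 / \<epsilon>) / \<epsilon>)"
    "\<And>b. subunit_form r b \<Longrightarrow> low_rank_form r (4 ^ Q) \<sigma> b \<Longrightarrow>
      \<bar>qform r (\<lambda>i j. if chunk i = chunk j then b i j else 0)
         (\<lambda>i. sqrt (q i * L (chunk i) / (\<Sum>j<r. real (q j * L (chunk j))))) - qform r b \<sigma>\<bar> \<le> \<epsilon>"
proof -
  define l where "l = log 2 (1 / \<epsilon>)"
  \<comment> \<open>Three spare bits make 2^-t at most \<epsilon> / 8; it is the rounding precision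
    and also governs the loss between distant bins.\<close>
  define t where "t = nat \<lceil>l\<rceil> + 3"
  define N where "N = nat \<lceil>8 / \<epsilon>\<rceil>"
  \<comment> \<open>The 2 Q bits cancel the factor 4^Q of the low-rank bound, so that 2^-t is
    left.\<close>
  define g where "g = 2 * Q + t"
  have l: "0 \<le> l" using \<epsilon> by (simp add: l_def)
  have t: "l + 3 \<le> t" "t \<le> l + 4" unfolding t_def using l by linarith+
  have "0 \<le> 8 / \<epsilon>" using \<epsilon> by simp
  then have N: "8 / \<epsilon> \<le> N" "N \<le> 8 / \<epsilon> + 1" unfolding N_def by linarith+
  have "1 \<le> 1 / \<epsilon>" using \<epsilon> by simp
  with N have N9: "N \<le> 9 / \<epsilon>" by simp
  have "0 < 8 / \<epsilon>" using \<epsilon> by simp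
  with N have N0: "0 < N" by linarith
  have pt: "8 / \<epsilon> \<le> 2 ^ t"
  proof -
    have "8 / \<epsilon> = 2 powr 3 * 2 powr l" using \<epsilon> by (simp add: l_def)
    also have "\<dots> = 2 powr (l + 3)" by (simp add: powr_add)
    also have "\<dots> \<le> 2 powr t" using t by (intro powr_mono) auto
    also have "\<dots> = 2 ^ t" by (simp add: powr_realpow)
    finally show ?thesis .
  qed
  have \<eta>: "1 / 2 ^ t \<le> \<epsilon> / 8" using pt \<epsilon> by (simp add: field_simps)
  have p0: "0 < (1 / 2 ^ t :: real)" by simp
  have \<eta>2: "1 / 2 ^ t \<le> (1 / 2 :: real)" using \<eta> \<epsilon> by linarith
  obtain chunk :: "nat \<Rightarrow> nat" where
    ratio: "\<And>i j. i < r \<Longrightarrow> j < r \<Longrightarrow> chunk i = chunk j \<Longrightarrow> \<sigma> i \<le> 2 ^ (g * N) * \<sigma> j" and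
    cut: "\<And>b. subunit_form r b \<Longrightarrow> low_rank_form r (4 ^ Q) \<sigma> b \<Longrightarrow>
      \<bar>qform r (\<lambda>i j. if chunk i = chunk j then b i j else 0) \<sigma> - qform r b \<sigma>\<bar> \<le> 2 / N + 2 * 4 ^ Q / 2 ^ g"
    by (rule chunking[of r \<sigma> g N "4 ^ Q"]) (use pos one Q N0 in \<open>auto simp: g_def\<close>)
  obtain L q :: "nat \<Rightarrow> nat" where
    L: "\<And>i. i < r \<Longrightarrow> 0 < L (chunk i)" and q: "\<And>i. i < r \<Longrightarrow> 0 < q i"
    and qle: "\<And>i. i < r \<Longrightarrow> real (q i) \<le> 2 * (2 ^ (g * N))\<^sup>2 / (1 / 2 ^ t)"
    and close: "\<And>i. i < r \<Longrightarrow>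
      \<bar>sqrt (q i * L (chunk i) / (\<Sum>j<r. real (q j * L (chunk j)))) - \<sigma> i\<bar> \<le> 1 / 2 ^ t * \<sigma> i"
    by (rule chunk_rounding[of r \<sigma> chunk "2 ^ (g * N)" "1 / 2 ^ t"],
        erule pos, rule one, erule (2) ratio, rule p0, rule \<eta>2, rule that)
  \<comment> \<open>The number of bits of 2 \<rho>^2 / \<eta> for \<rho> = 2^(g N) and \<eta> =
    2^-t.\<close>
  define w where "w = 1 + 2 * (g * N) + t"
  have "q i \<le> 2 ^ w" if "i < r" for i
  proof -
    have "real (q i) \<le> real (2 ^ w)"
      using qle[OF that] by (simp add: w_def power_add power_mult power2_eq_square mult_ac flip: power_mult_distrib)
    then show ?thesis by (simp only: of_nat_le_iff)
  qed
  \<comment> \<open>Twice g N is at most (54 Q + 18 l) / \<epsilon>, as g \<le> 3 Q + l and N \<le>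
    9 / \<epsilon>. The rest, 1 + t + Q, is at most 2 Q + l because Q \<ge> 5. The resulting
    coefficients 56 and 19 are rounded up to 60.\<close>
  moreover have "real (w + Q) \<le> 60 * (Q / \<epsilon> + log 2 (1 / \<epsilon>) / \<epsilon>)"
  proof -
    have "real g \<le> 3 * Q + l" using t Q by (simp add: g_def)
    then have "real g * real N \<le> (3 * Q + l) * (9 / \<epsilon>)"
      using N9 l by (intro mult_mono) auto
    moreover have "real (w + Q) = 1 + 2 * (real g * real N) + t + Q" by (simp add: w_def)
    moreover have "5 \<le> real Q" using Q by simp
    moreover have "\<lbrakk>G \<le> X; W = 1 + 2 * G + T + P; 5 \<le> P; T \<le> l + 4\<rbrakk> \<Longrightarrow> W \<le> 2 * X + (P + P + l) * 1"
      for G X W T P :: real by auto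
    ultimately have "real (w + Q) \<le> 2 * ((3 * Q + l) * (9 / \<epsilon>)) + (real Q + real Q + l) * 1"
      using t by blast
    also have "\<dots> \<le> 2 * ((3 * Q + l) * (9 / \<epsilon>)) + (real Q + real Q + l) * (1 / \<epsilon>)"
      using l \<open>1 \<le> 1 / \<epsilon>\<close> by (intro add_left_mono mult_left_mono) auto
    also have "\<dots> = (56 * Q + 19 * l) / \<epsilon>" by (simp add: add_divide_distrib algebra_simps)
    also have "\<dots> \<le> 60 * (Q + l) / \<epsilon>" using l \<epsilon> by (intro divide_right_mono) auto
    finally show ?thesis by (simp add: l_def distrib_left add_divide_distrib)
  qed
  moreover have "\<bar>qform r (\<lambda>i j. if chunk i = chunk j then b i j else 0)
         (\<lambda>i. sqrt (q i * L (chunk i) / (\<Sum>j<r. real (q j * L (chunk j))))) - qform r b \<sigma>\<bar> \<le> \<epsilon>"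
    (is "\<bar>qform r ?b ?\<tau> - _\<bar> \<le> _")
    if b: "subunit_form r b" and low: "low_rank_form r (4 ^ Q) \<sigma> b" for b
  proof -
    have "0 < real N" using N0 by simp
    then have p: "0 < real N * (8 / \<epsilon>)" using \<open>0 < 8 / \<epsilon>\<close> by (rule mult_pos_pos)
    have "2 / real N \<le> 2 / (8 / \<epsilon>)" by (rule divide_left_mono[OF N(1) _ p]) simp
    moreover have "2 * 4 ^ Q / 2 ^ g = 2 * (1 / 2 ^ t :: real)"
      by (simp add: g_def power_add power_mult)
    ultimately have "\<bar>qform r ?b \<sigma> - qform r b \<sigma>\<bar> \<le> \<epsilon> / 4 + \<epsilon> / 4"
      using cut[OF b low] \<eta> by simp
    moreover have "\<bar>qform r ?b ?\<tau> - qform r ?b \<sigma>\<bar> \<le> 3 * (1 / 2 ^ t)"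
    proof -
      have "1 / 2 ^ t \<le> (1 :: real)" using \<eta>2 by linarith
      have "\<bar>qform r ?b ?\<tau> - qform r ?b \<sigma>\<bar> \<le> 3 * (1 / 2 ^ t) * (\<Sum>i<r. (\<sigma> i)\<^sup>2)"
        by (rule qform_perturb[OF subunit_form_blocks[OF b] p0 \<open>1 / 2 ^ t \<le> 1\<close>]) (rule close)
      then show ?thesis unfolding one by simp
    qed
    ultimately show ?thesis using \<eta> by linarith
  qed
  ultimately show ?thesis using L q that by blast
qed

section \<open>Singular value decomposition\<close>

text \<open>Vectors are functions on the naturals with the dimension as a separate argument, so that
  composite indices can be split by \<open>div\<close> and \<open>mod\<close> without carrier
  conditions. The form is conjugate-linear in its first argument.\<close>

definition inner_fn :: "nat \<Rightarrow> (nat \<Rightarrow> complex) \<Rightarrow> (nat \<Rightarrow> complex) \<Rightarrow> complex" where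
  "inner_fn n x y = (\<Sum>i<n. cnj (x i) * y i)"

definition norm_sq :: "nat \<Rightarrow> (nat \<Rightarrow> complex) \<Rightarrow> real" where
  "norm_sq n x = (\<Sum>i<n. (cmod (x i))\<^sup>2)"

definition orthonormal :: "nat \<Rightarrow> nat \<Rightarrow> (nat \<Rightarrow> nat \<Rightarrow> complex) \<Rightarrow> bool" where
  "orthonormal n r u \<longleftrightarrow> (\<forall>k<r. \<forall>l<r. inner_fn n (u k) (u l) = (if k = l then 1 else 0))"

lemma norm_sq_nonneg [simp]: "0 \<le> norm_sq n x"
  by (simp add: norm_sq_def sum_nonneg)

lemma cnj_mult_self: "cnj z * z = complex_of_real ((cmod z)\<^sup>2)"
  by (subst mult.commute) (rule complex_norm_square[symmetric])

lemma inner_fn_self: "inner_fn n x x = complex_of_real (norm_sq n x)"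
  by (simp add: inner_fn_def norm_sq_def cnj_mult_self del: of_real_power)

lemma inner_fn_commute: "inner_fn n y x = cnj (inner_fn n x y)"
  by (simp add: inner_fn_def mult.commute)

lemma inner_fn_sum_right: "inner_fn n x (\<lambda>i. \<Sum>k\<in>T. c k * u k i) = (\<Sum>k\<in>T. c k * inner_fn n x (u k))"
  unfolding inner_fn_def sum_distrib_left by (subst sum.swap) (simp add: mult_ac)

lemma inner_fn_sum_left: "inner_fn n (\<lambda>i. \<Sum>k\<in>T. c k * u k i) x = (\<Sum>k\<in>T. cnj (c k) * inner_fn n (u k) x)"
  by (subst inner_fn_commute) (simp add: inner_fn_sum_right flip: inner_fn_commute)

lemma inner_fn_diff_right: "inner_fn n x (\<lambda>i. y i - z i) = inner_fn n x y - inner_fn n x z"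
  by (simp add: inner_fn_def algebra_simps sum_subtractf)

lemma inner_fn_diff_left: "inner_fn n (\<lambda>i. y i - z i) x = inner_fn n y x - inner_fn n z x"
  by (simp add: inner_fn_def algebra_simps sum_subtractf)

lemma inner_fn_cong: "(\<And>i. i < n \<Longrightarrow> x i = x' i) \<Longrightarrow> (\<And>i. i < n \<Longrightarrow> y i = y' i) \<Longrightarrow> inner_fn n x y = inner_fn n x' y'"
  by (simp add: inner_fn_def)

lemma orthonormal_sum_sum:
  assumes "orthonormal n r u" "T \<subseteq> {..<r}"
  shows "(\<Sum>k\<in>T. c k * (\<Sum>l\<in>T. d l * inner_fn n (u k) (u l))) = (\<Sum>k\<in>T. c k * d k)"
proof (rule sum.cong[OF refl])
  fix k assume k: "k \<in> T"
  have T: "finite T" using assms(2) finite_subset by blast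
  have "(\<Sum>l\<in>T. d l * inner_fn n (u k) (u l)) = (\<Sum>l\<in>T. if k = l then d l else 0)"
    using assms k by (intro sum.cong refl) (auto simp: orthonormal_def subset_iff)
  then show "c k * (\<Sum>l\<in>T. d l * inner_fn n (u k) (u l)) = c k * d k" using k T by simp
qed

text \<open>What remains of \<open>x\<close> after subtracting its projection has as squared norm
  the difference of the two sides.\<close>

lemma bessel:
  assumes u: "orthonormal n r u" and T: "T \<subseteq> {..<r}"
  shows "(\<Sum>k\<in>T. (cmod (inner_fn n (u k) x))\<^sup>2) \<le> norm_sq n x"
proof -
  define c where "c k = inner_fn n (u k) x" for k
  define s where "s i = (\<Sum>k\<in>T. c k * u k i)" for i
  define S where "S = (\<Sum>k\<in>T. (cmod (c k))\<^sup>2)"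
  have 1: "inner_fn n s x = complex_of_real S"
    unfolding s_def[abs_def] inner_fn_sum_left S_def c_def[symmetric] by (simp add: cnj_mult_self del: of_real_power)
  have 2: "inner_fn n x s = complex_of_real S" by (subst inner_fn_commute) (simp add: 1)
  have "inner_fn n s s = (\<Sum>k\<in>T. cnj (c k) * (\<Sum>l\<in>T. c l * inner_fn n (u k) (u l)))"
    unfolding s_def[abs_def] inner_fn_sum_left inner_fn_sum_right ..
  also have "\<dots> = (\<Sum>k\<in>T. cnj (c k) * c k)" by (rule orthonormal_sum_sum[OF u T])
  finally have 3: "inner_fn n s s = complex_of_real S"
    by (simp add: S_def cnj_mult_self del: of_real_power)
  have "complex_of_real (norm_sq n (\<lambda>i. x i - s i)) = complex_of_real (norm_sq n x - S)"
    unfolding inner_fn_self[symmetric] inner_fn_diff_left inner_fn_diff_right 1 2 3 by (simp add: inner_fn_self)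
  then have "norm_sq n (\<lambda>i. x i - s i) = norm_sq n x - S" by (simp only: of_real_eq_iff)
  then show ?thesis using norm_sq_nonneg[of n "\<lambda>i. x i - s i"] unfolding S_def c_def by linarith
qed

text \<open>Double counting: the squared entries of all vectors sum to \<open>r\<close>, and the
  entries at one coordinate contribute at most 1 by Bessel's inequality for the corresponding basis
  vector.\<close>

lemma orthonormal_le_dim:
  assumes u: "orthonormal n r u"
  shows "r \<le> n"
proof -
  have "real r = (\<Sum>k<r. norm_sq n (u k))"
  proof -
    have "norm_sq n (u k) = 1" if "k < r" for k
    proof -
      have "complex_of_real (norm_sq n (u k)) = 1" using u that by (simp add: orthonormal_def flip: inner_fn_self)
      then show ?thesis by simp
    qed
    then show ?thesis by simp
  qed
  also have "\<dots> = (\<Sum>i<n. \<Sum>k<r. (cmod (u k i))\<^sup>2)" unfolding norm_sq_def by (rule sum.swap)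
  also have "\<dots> \<le> (\<Sum>i<n. 1)"
  proof (rule sum_mono)
    fix i assume i: "i \<in> {..<n}"
    define e :: "nat \<Rightarrow> complex" where "e j = (if j = i then 1 else 0)" for j
    have "norm_sq n e = (\<Sum>j<n. if j = i then 1 else 0)"
      unfolding norm_sq_def e_def by (intro sum.cong) auto
    then have "norm_sq n e = 1" using i by simp
    moreover have "inner_fn n (u k) e = cnj (u k i)" for k
    proof -
      have "inner_fn n (u k) e = (\<Sum>j<n. if j = i then cnj (u k j) else 0)"
        unfolding inner_fn_def e_def by (intro sum.cong) auto
      then show ?thesis using i by simp
    qed
    ultimately show "(\<Sum>k<r. (cmod (u k i))\<^sup>2) \<le> 1" using bessel[OF u, of "{..<r}" e] by simp
  qed
  finally show ?thesis by simp
qed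

section \<open>Nonzero eigenvalues from a nonzero trace\<close>

lemma trace_similar:
  fixes A :: "complex mat"
  assumes "A \<in> carrier_mat n n" "similar_mat_wit A B P Q"
  shows "(\<Sum>i<n. A $$ (i, i)) = (\<Sum>i<n. B $$ (i, i))"
proof -
  note D = similar_mat_witD2[OF assms]
  have QP: "(\<Sum>i<n. Q $$ (k, i) * P $$ (i, j)) = (if k = j then 1 else 0)" if "k < n" "j < n" for k j
  proof -
    have "(Q * P) $$ (k, j) = (\<Sum>i<n. Q $$ (k, i) * P $$ (i, j))"
      using D(6,7) that by (auto simp: scalar_prod_def atLeast0LessThan intro!: sum.cong)
    then show ?thesis using D(2) that by simp
  qed
  have "(\<Sum>i<n. A $$ (i, i)) = (\<Sum>i<n. \<Sum>k<n. \<Sum>j<n. P $$ (i, j) * B $$ (j, k) * Q $$ (k, i))"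
  proof (rule sum.cong[OF refl])
    fix i assume "i \<in> {..<n}"
    then show "A $$ (i, i) = (\<Sum>k<n. \<Sum>j<n. P $$ (i, j) * B $$ (j, k) * Q $$ (k, i))"
      using D(4-7) by (auto simp: D(3) scalar_prod_def atLeast0LessThan sum_distrib_right simp del: assoc_mult_mat intro!: sum.cong)
  qed
  also have "\<dots> = (\<Sum>k<n. \<Sum>j<n. \<Sum>i<n. P $$ (i, j) * B $$ (j, k) * Q $$ (k, i))"
    by (subst sum.swap) (intro sum.cong refl sum.swap)
  also have "\<dots> = (\<Sum>k<n. \<Sum>j<n. B $$ (j, k) * (\<Sum>i<n. Q $$ (k, i) * P $$ (i, j)))"
    by (simp add: sum_distrib_left mult_ac)
  also have "\<dots> = (\<Sum>k<n. \<Sum>j<n. if k = j then B $$ (j, k) else 0)"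
    by (intro sum.cong refl) (simp add: QP)
  finally show ?thesis by simp
qed

text \<open>The trace equals that of a Schur form, whose diagonal entries are the roots of the
  characteristic polynomial; they cannot all vanish. For a Gram matrix this does the work of the
  spectral theorem.\<close>

lemma trace_nonzero_eigenvalue:
  fixes A :: "complex mat"
  assumes A: "A \<in> carrier_mat n n" and tr: "(\<Sum>i<n. A $$ (i, i)) \<noteq> 0"
  obtains k where "eigenvalue A k" "k \<noteq> 0"
proof -
  obtain as where as: "char_poly A = (\<Prod>a\<leftarrow>as. [:- a, 1:])" using char_poly_factorized[OF A] by blast
  obtain B P Q where sd: "schur_decomposition A as = (B, P, Q)" by (cases "schur_decomposition A as")
  from schur_decomposition[OF A as sd] have sim: "similar_mat_wit A B P Q" and dg: "diag_mat B = as" by auto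
  have B: "B \<in> carrier_mat n n" using similar_mat_witD2[OF A sim] by auto
  from tr obtain i where i: "i < n" "B $$ (i, i) \<noteq> 0"
  proof -
    have "\<exists>i<n. B $$ (i, i) \<noteq> 0"
    proof (rule ccontr)
      assume "\<not> ?thesis"
      then have "(\<Sum>i<n. B $$ (i, i)) = 0" by (intro sum.neutral) auto
      then show False using tr trace_similar[OF A sim] by simp
    qed
    then show ?thesis using that by blast
  qed
  have "i \<in> {0..<dim_row B}" using i(1) B by simp
  then have mem: "B $$ (i, i) \<in> set as"
    unfolding dg[symmetric] diag_mat_def set_map set_upt by (rule imageI)
  have "poly (\<Prod>a\<leftarrow>es. [:- a, 1:]) z = 0" if "z \<in> set es" for z :: complex and es
    using that by (induct es) auto
  then have "poly (char_poly A) (B $$ (i, i)) = 0" unfolding as using mem by blast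
  then show ?thesis using that i(2) eigenvalue_root_char_poly[OF A] by blast
qed

text \<open>The Gram matrix \<open>H\<close> has as trace the sum of all squared moduli, which is
  positive, hence it has a nonzero eigenvalue. An eigenvector and its image under the matrix are, up
  to scaling and conjugation, the singular pair.\<close>

lemma singular_pair:
  assumes nz: "i0 < a" "j0 < b" "\<Psi> i0 j0 \<noteq> (0 :: complex)"
  obtains s u v where "0 < s" "norm_sq a u = 1" "norm_sq b v = 1"
    "\<And>i. i < a \<Longrightarrow> (\<Sum>j<b. \<Psi> i j * cnj (v j)) = complex_of_real s * u i"
    "\<And>j. j < b \<Longrightarrow> (\<Sum>i<a. cnj (u i) * \<Psi> i j) = complex_of_real s * v j"
proof -
  define H where "H = mat b b (\<lambda>(j, k). \<Sum>i<a. cnj (\<Psi> i j) * \<Psi> i k)"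
  have H: "H \<in> carrier_mat b b" by (simp add: H_def)
  define tr where "tr = (\<Sum>j<b. \<Sum>i<a. (cmod (\<Psi> i j))\<^sup>2)"
  have "(\<Sum>j<b. H $$ (j, j)) = complex_of_real tr"
    by (simp add: H_def tr_def cnj_mult_self del: of_real_power)
  moreover have "0 < tr"
  proof -
    have "0 < (cmod (\<Psi> i0 j0))\<^sup>2" using nz by simp
    also have "\<dots> \<le> (\<Sum>i<a. (cmod (\<Psi> i j0))\<^sup>2)" using nz by (intro member_le_sum) auto
    also have "\<dots> \<le> tr" unfolding tr_def
      using nz by (intro member_le_sum[of j0 _ "\<lambda>j. \<Sum>i<a. (cmod (\<Psi> i j))\<^sup>2"]) (auto simp: sum_nonneg)
    finally show ?thesis .
  qed
  ultimately obtain k where k: "eigenvalue H k" "k \<noteq> 0"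
    using trace_nonzero_eigenvalue[OF H] by force
  then obtain x where x: "x \<in> carrier_vec b" "x \<noteq> 0\<^sub>v b" "H *\<^sub>v x = k \<cdot>\<^sub>v x"
    unfolding eigenvalue_def eigenvector_def using H by auto
  define y where "y i = (\<Sum>j<b. \<Psi> i j * x $ j)" for i
  have ev: "(\<Sum>i<a. cnj (\<Psi> i j) * y i) = k * x $ j" if "j < b" for j
  proof -
    have "k * x $ j = (H *\<^sub>v x) $ j" using x that by simp
    also have "\<dots> = (\<Sum>l<b. (\<Sum>i<a. cnj (\<Psi> i j) * \<Psi> i l) * x $ l)"
      using x(1) that by (simp add: scalar_prod_def atLeast0LessThan H_def)
    also have "\<dots> = (\<Sum>i<a. cnj (\<Psi> i j) * y i)"
      unfolding y_def sum_distrib_left sum_distrib_right by (subst sum.swap) (simp add: mult_ac)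
    finally show ?thesis ..
  qed
  define X where "X = norm_sq b (vec_index x)"
  define Y where "Y = norm_sq a y"
  have X: "0 < X"
  proof -
    obtain j where j: "j < b" "x $ j \<noteq> 0" using x(1,2) by (metis carrier_vecD eq_vecI index_zero_vec)
    have "0 < (cmod (x $ j))\<^sup>2" using j by simp
    also have "\<dots> \<le> X" unfolding X_def norm_sq_def using j by (intro member_le_sum) auto
    finally show ?thesis .
  qed
  have kX: "k * complex_of_real X = complex_of_real Y"
  proof -
    have ofX: "complex_of_real X = (\<Sum>j<b. cnj (x $ j) * x $ j)"
      unfolding X_def inner_fn_self[symmetric] inner_fn_def ..
    have "complex_of_real Y = (\<Sum>i<a. cnj (y i) * y i)"
      unfolding Y_def inner_fn_self[symmetric] inner_fn_def ..
    also have "\<dots> = (\<Sum>i<a. \<Sum>j<b. cnj (x $ j) * (cnj (\<Psi> i j) * y i))"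
    proof (rule sum.cong[OF refl])
      fix i
      have "cnj (y i) = (\<Sum>j<b. cnj (x $ j) * cnj (\<Psi> i j))" by (simp add: y_def mult_ac)
      then show "cnj (y i) * y i = (\<Sum>j<b. cnj (x $ j) * (cnj (\<Psi> i j) * y i))"
        by (simp only: sum_distrib_right mult.assoc)
    qed
    also have "\<dots> = (\<Sum>j<b. cnj (x $ j) * (k * x $ j))"
      by (subst sum.swap, intro sum.cong refl) (simp add: ev flip: sum_distrib_left)
    also have "\<dots> = k * complex_of_real X"
      unfolding ofX sum_distrib_left by (intro sum.cong refl) simp
    finally show ?thesis ..
  qed
  \<comment> \<open>The eigenvalue turns out to be a quotient of two squared norms; this makes it
    real and positive.\<close>
  define l where "l = Y / X"
  have kl: "k = complex_of_real l" using kX X by (simp add: l_def field_simps)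
  have "0 \<le> l" unfolding l_def using X by (simp add: Y_def)
  then have l: "0 < l" using k(2) kl by (cases "l = 0") auto
  define s where "s = sqrt l"
  have s: "0 < s" "s * s = l" using l by (auto simp: s_def)
  \<comment> \<open>Conjugated, because Schmidt terms are products u i * v j without
    conjugation.\<close>
  define v where "v j = cnj (x $ j) / sqrt X" for j
  define u where "u i = y i / (sqrt X * s)" for i
  show ?thesis
  proof (rule that[of s u v])
    show "0 < s" by (rule s(1))
    have YX: "Y = l * X" using X by (simp add: l_def)
    have "norm_sq a u = (\<Sum>i<a. (cmod (y i))\<^sup>2 / (X * l))"
      unfolding norm_sq_def u_def
      using X l by (intro sum.cong refl) (simp add: norm_divide norm_mult power_divide power_mult_distrib s_def)
    also have "\<dots> = Y / (X * l)"
      unfolding sum_divide_distrib[symmetric] by (simp only: Y_def norm_sq_def)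
    finally show "norm_sq a u = 1" using X l YX by simp
    have "norm_sq b v = (\<Sum>j<b. (cmod (x $ j))\<^sup>2 / X)"
      unfolding norm_sq_def v_def
      using X by (intro sum.cong refl) (simp add: norm_divide power_divide)
    also have "\<dots> = X / X"
      unfolding sum_divide_distrib[symmetric] by (simp only: X_def norm_sq_def)
    finally show "norm_sq b v = 1" using X by simp
    show "(\<Sum>j<b. \<Psi> i j * cnj (v j)) = complex_of_real s * u i" if "i < a" for i
      using s X by (simp add: v_def u_def y_def flip: sum_divide_distrib)
    show "(\<Sum>i<a. cnj (u i) * \<Psi> i j) = complex_of_real s * v j" if "j < b" for j
    proof -
      have "(\<Sum>i<a. cnj (u i) * \<Psi> i j) = cnj (\<Sum>i<a. cnj (\<Psi> i j) * y i) / (sqrt X * s)"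
        by (simp add: u_def sum_divide_distrib mult_ac)
      also have "\<dots> = l * cnj (x $ j) / (sqrt X * s)" by (simp add: ev[OF that] kl)
      also have "\<dots> = complex_of_real s * v j"
      proof -
        have "complex_of_real l = complex_of_real s * complex_of_real s" using s(2) by (metis of_real_mult)
        then show ?thesis using s(1) by (simp add: v_def)
      qed
      finally show ?thesis .
    qed
  qed
qed

lemma orthonormal_extend:
  assumes u: "orthonormal n r u" and x: "norm_sq n x = 1" "\<And>k. k < r \<Longrightarrow> inner_fn n (u k) x = 0"
  shows "orthonormal n (Suc r) (u(r := x))"
proof -
  have "inner_fn n x (u k) = 0" if "k < r" for k
    using x(2)[OF that] inner_fn_commute[of n x "u k"] by simp
  then show ?thesis
    using u x by (auto simp: orthonormal_def less_Suc_eq inner_fn_self)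
qed

lemma inner_fn_matrix_assoc:
  "(\<Sum>i<a. cnj (x i) * (\<Sum>j<b. \<Psi> i j * y j)) = (\<Sum>j<b. (\<Sum>i<a. cnj (x i) * \<Psi> i j) * y j)"
  unfolding sum_distrib_left sum_distrib_right by (subst sum.swap) (simp add: mult_ac)

text \<open>Singular pairs are split off one at a time; since the vectors found so far are orthonormal,
  there are at most as many steps as dimensions.\<close>

lemma singular_value_decomposition:
  fixes \<Psi> :: "nat \<Rightarrow> nat \<Rightarrow> complex"
  obtains r \<sigma> u v where "\<And>k. k < r \<Longrightarrow> 0 < \<sigma> k" "orthonormal a r u" "orthonormal b r v"
    "\<And>i j. i < a \<Longrightarrow> j < b \<Longrightarrow> \<Psi> i j = (\<Sum>k<r. of_real (\<sigma> k) * u k i * v k j)"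
proof -
  define rem where "rem r \<sigma> u v i j = \<Psi> i j - (\<Sum>k<r. of_real (\<sigma> k) * u k i * v k j)"
    for r :: nat and \<sigma> u v i j
  \<comment> \<open>The two annihilation conditions are the invariant that matters: they force any
    singular pair of the remainder to be orthogonal to all vectors found before (\<open>ux\<close>
    and \<open>vy\<close>).\<close>
  define P where "P r \<longleftrightarrow> (\<exists>\<sigma> u v. (\<forall>k<r. 0 < \<sigma> k) \<and> orthonormal a r u \<and> orthonormal b r v \<and>
    (\<forall>k<r. \<forall>i<a. (\<Sum>j<b. rem r \<sigma> u v i j * cnj (v k j)) = 0) \<and>
    (\<forall>k<r. \<forall>j<b. (\<Sum>i<a. cnj (u k i) * rem r \<sigma> u v i j) = 0))" for r
  have "P 0" by (auto simp: P_def orthonormal_def intro: exI[of _ "\<lambda>_. 1"])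
  moreover have bound: "\<forall>r. P r \<longrightarrow> r \<le> a" unfolding P_def using orthonormal_le_dim by blast
  ultimately have Pr: "P (Greatest P)" using GreatestI_nat[of P 0 a] by blast
  define r where "r = Greatest P"
  have not: "\<not> P (Suc r)"
    using Greatest_le_nat[of P "Suc r" a] bound by (auto simp: r_def)
  from Pr obtain \<sigma> u v where \<sigma>: "\<forall>k<r. 0 < \<sigma> k" and u: "orthonormal a r u" and v: "orthonormal b r v"
    and kv: "\<And>k i. k < r \<Longrightarrow> i < a \<Longrightarrow> (\<Sum>j<b. rem r \<sigma> u v i j * cnj (v k j)) = 0"
    and ku: "\<And>k j. k < r \<Longrightarrow> j < b \<Longrightarrow> (\<Sum>i<a. cnj (u k i) * rem r \<sigma> u v i j) = 0"
    unfolding P_def r_def[symmetric] by blast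
  let ?R = "rem r \<sigma> u v"
  \<comment> \<open>A nonzero entry would give a further pair and contradict the maximality of
    \<open>r\<close>.\<close>
  have "?R i j = 0" if ij: "i < a" "j < b" for i j
  proof (rule ccontr)
    assume "?R i j \<noteq> 0"
    then obtain s x y where s: "0 < s" and x: "norm_sq a x = 1" and y: "norm_sq b y = 1"
      and Ry: "\<And>i. i < a \<Longrightarrow> (\<Sum>j<b. ?R i j * cnj (y j)) = complex_of_real s * x i"
      and xR: "\<And>j. j < b \<Longrightarrow> (\<Sum>i<a. cnj (x i) * ?R i j) = complex_of_real s * y j"
      using singular_pair[OF ij, of ?R] by blast
    have ux: "inner_fn a (u k) x = 0" if "k < r" for k
    proof -
      have "complex_of_real s * inner_fn a (u k) x = (\<Sum>i<a. cnj (u k i) * (\<Sum>j<b. ?R i j * cnj (y j)))"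
        unfolding inner_fn_def sum_distrib_left[of "complex_of_real s"]
        by (intro sum.cong refl, subst Ry) simp_all
      also have "\<dots> = 0" unfolding inner_fn_matrix_assoc by (intro sum.neutral ballI) (simp add: ku that)
      finally show ?thesis using s by simp
    qed
    have vy: "inner_fn b (v k) y = 0" if "k < r" for k
    proof -
      have "complex_of_real s * inner_fn b (v k) y = (\<Sum>j<b. (\<Sum>i<a. cnj (x i) * ?R i j) * cnj (v k j))"
        unfolding inner_fn_def sum_distrib_left[of "complex_of_real s"]
        by (intro sum.cong refl, subst xR) simp_all
      also have "\<dots> = 0" unfolding inner_fn_matrix_assoc[symmetric]
        by (intro sum.neutral ballI) (simp add: kv that)
      finally show ?thesis using s by simp
    qed
    define \<sigma>' u' v' where "\<sigma>' = \<sigma>(r := s)" "u' = u(r := x)" "v' = v(r := y)"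
    have R': "rem (Suc r) \<sigma>' u' v' i j = ?R i j - complex_of_real s * x i * y j" for i j
      by (simp add: rem_def \<sigma>'_u'_v'_def)
    have "(\<Sum>j<b. rem (Suc r) \<sigma>' u' v' i j * cnj (v' k j)) = 0" if "k < Suc r" "i < a" for k i
    proof -
      have "(\<Sum>j<b. rem (Suc r) \<sigma>' u' v' i j * cnj (v' k j)) =
          (\<Sum>j<b. ?R i j * cnj (v' k j)) - complex_of_real s * x i * inner_fn b (v' k) y"
        by (simp add: R' inner_fn_def algebra_simps sum_subtractf sum_distrib_left)
      also have "\<dots> = 0"
        using that kv Ry y vy by (cases "k = r") (auto simp: \<sigma>'_u'_v'_def inner_fn_self)
      finally show ?thesis .
    qed
    moreover have "(\<Sum>i<a. cnj (u' k i) * rem (Suc r) \<sigma>' u' v' i j) = 0" if "k < Suc r" "j < b" for k j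
    proof -
      have "(\<Sum>i<a. cnj (u' k i) * rem (Suc r) \<sigma>' u' v' i j) =
          (\<Sum>i<a. cnj (u' k i) * ?R i j) - complex_of_real s * inner_fn a (u' k) x * y j"
        by (simp add: R' inner_fn_def algebra_simps sum_subtractf sum_distrib_left)
      also have "\<dots> = 0"
        using that ku xR x ux by (cases "k = r") (auto simp: \<sigma>'_u'_v'_def inner_fn_self)
      finally show ?thesis .
    qed
    moreover have "\<forall>k<Suc r. 0 < \<sigma>' k" using \<sigma> s by (auto simp: \<sigma>'_u'_v'_def less_Suc_eq)
    moreover have "orthonormal a (Suc r) u'" "orthonormal b (Suc r) v'"
      unfolding \<sigma>'_u'_v'_def by (rule orthonormal_extend[OF u x ux] orthonormal_extend[OF v y vy]; assumption)+
    ultimately have "P (Suc r)" unfolding P_def by blast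
    with not show False ..
  qed
  then show ?thesis using that[of r \<sigma> u v] \<sigma> u v by (simp add: rem_def)
qed

section \<open>Sums over composite indices; unitary matrices as orthonormal families\<close>

lemma sum_lessThan_mult:
  fixes f :: "nat \<Rightarrow> 'a :: comm_monoid_add"
  shows "(\<Sum>i<a * m. f i) = (\<Sum>i<a. \<Sum>s<m. f (i * m + s))"
proof (induct a)
  case (Suc a)
  have "(\<Sum>i<Suc a * m. f i) = (\<Sum>i\<in>{..<a * m} \<union> {a * m..<a * m + m}. f i)"
    by (rule arg_cong[of _ _ "sum f"]) auto
  also have "\<dots> = (\<Sum>i<a * m. f i) + (\<Sum>i\<in>{a * m..<a * m + m}. f i)"
    by (rule sum.union_disjoint) auto
  also have "(\<Sum>i\<in>{a * m..<a * m + m}. f i) = (\<Sum>s<m. f (a * m + s))"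
    using sum.shift_bounds_nat_ivl[of f 0 "a * m" m] by (simp add: atLeast0LessThan add.commute)
  finally show ?case by (simp add: Suc)
qed simp

lemma sum_mod_eq_0:
  fixes f :: "nat \<Rightarrow> 'a :: comm_monoid_add"
  assumes "0 < m"
  shows "(\<Sum>i<a * m. if i mod m = 0 then f (i div m) else 0) = (\<Sum>i<a. f i)"
proof -
  have "(\<Sum>i<a * m. if i mod m = 0 then f (i div m) else 0) = (\<Sum>i<a. \<Sum>s<m. if s = 0 then f i else 0)"
    unfolding sum_lessThan_mult by (intro sum.cong refl) auto
  then show ?thesis using assms by simp
qed

lemma norm_sq_orthonormal_sum:
  assumes "orthonormal n r u" "T \<subseteq> {..<r}"
  shows "norm_sq n (\<lambda>i. \<Sum>k\<in>T. c k * u k i) = (\<Sum>k\<in>T. (cmod (c k))\<^sup>2)"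
proof -
  have "complex_of_real (norm_sq n (\<lambda>i. \<Sum>k\<in>T. c k * u k i)) = (\<Sum>k\<in>T. cnj (c k) * c k)"
    unfolding inner_fn_self[symmetric] inner_fn_sum_left inner_fn_sum_right by (rule orthonormal_sum_sum[OF assms])
  also have "\<dots> = complex_of_real (\<Sum>k\<in>T. (cmod (c k))\<^sup>2)"
    by (simp add: cnj_mult_self del: of_real_power)
  finally show ?thesis by (simp only: of_real_eq_iff)
qed

lemma adjoint_products:
  assumes U: "U \<in> carrier_mat n n" and kl: "k < n" "l < n"
  shows "(mat_adjoint U * U) $$ (k, l) = inner_fn n (\<lambda>i. U $$ (i, k)) (\<lambda>i. U $$ (i, l))"
    "(U * mat_adjoint U) $$ (l, k) = inner_fn n (\<lambda>i. U $$ (k, i)) (\<lambda>i. U $$ (l, i))"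
proof -
  have "mat_adjoint U $$ (i, j) = cnj (U $$ (j, i))" if "i < n" "j < n" for i j
    using U that by (simp add: mat_adjoint_def mat_of_rows_index)
  moreover have "mat_adjoint U \<in> carrier_mat n n" using U by (auto simp: mat_adjoint_def)
  ultimately show "(mat_adjoint U * U) $$ (k, l) = inner_fn n (\<lambda>i. U $$ (i, k)) (\<lambda>i. U $$ (i, l))"
    "(U * mat_adjoint U) $$ (l, k) = inner_fn n (\<lambda>i. U $$ (k, i)) (\<lambda>i. U $$ (l, i))"
    using U kl by (auto simp: scalar_prod_def atLeast0LessThan inner_fn_def intro!: sum.cong)
qed

lemma unitary_orthonormal:
  assumes "unitary n U"
  shows "orthonormal n n (\<lambda>i k. U $$ (i, k))" "orthonormal n n (\<lambda>k i. U $$ (i, k))"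
proof -
  have U: "U \<in> carrier_mat n n" using assms by (simp add: unitary_def)
  show "orthonormal n n (\<lambda>i k. U $$ (i, k))" "orthonormal n n (\<lambda>k i. U $$ (i, k))"
    using assms by (auto simp: orthonormal_def unitary_def simp flip: adjoint_products[OF U])
qed

lemma unitaryI:
  assumes U: "U \<in> carrier_mat n n"
    and "orthonormal n n (\<lambda>i k. U $$ (i, k))" "orthonormal n n (\<lambda>k i. U $$ (i, k))"
  shows "unitary n U"
proof -
  have adj: "mat_adjoint U \<in> carrier_mat n n" using U by (auto simp: mat_adjoint_def)
  have "mat_adjoint U * U = 1\<^sub>m n" "U * mat_adjoint U = 1\<^sub>m n"
    by (rule eq_matI; use assms(2,3) U adj in \<open>simp add: adjoint_products[OF U] orthonormal_def
      del: index_mult_mat(1)\<close>)+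
  then show ?thesis using U by (simp add: unitary_def)
qed

section \<open>Effect of the steps of a protocol\<close>

text \<open>The reindexing behind a sent qubit. Its value \<open>s\<close> is pulled out as the
  outermost sum; for fixed \<open>s\<close> the sender's index is confined to residue
  \<open>s\<close>, and the receiver's new index is j * 2 + s.\<close>

lemma sum_mod_mult2:
  fixes f :: "nat \<Rightarrow> nat \<Rightarrow> 'a :: comm_monoid_add"
  shows "(\<Sum>i<h. \<Sum>j<b * 2. f (2 * i + j mod 2) j) = (\<Sum>s<2. \<Sum>i<h * 2. \<Sum>j<b. if i mod 2 = s then f i (j * 2 + s) else 0)"
proof -
  have "(\<Sum>i<h. \<Sum>j<b * 2. f (2 * i + j mod 2) j) = (\<Sum>i<h. \<Sum>j<b. \<Sum>s<2. f (i * 2 + s) (j * 2 + s))"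
    unfolding sum_lessThan_mult by (intro sum.cong refl) (auto simp: mult.commute)
  also have "\<dots> = (\<Sum>i<h. \<Sum>s<2. \<Sum>j<b. f (i * 2 + s) (j * 2 + s))"
    by (intro sum.cong refl sum.swap)
  also have "\<dots> = (\<Sum>s<2. \<Sum>i<h. \<Sum>j<b. f (i * 2 + s) (j * 2 + s))" by (rule sum.swap)
  also have "\<dots> = (\<Sum>s<2. \<Sum>i<h * 2. \<Sum>j<b. if i mod 2 = s then f i (j * 2 + s) else 0)"
  proof (rule sum.cong[OF refl])
    fix s :: nat assume s: "s \<in> {..<2}"
    have "(\<Sum>i<h * 2. \<Sum>j<b. if i mod 2 = s then f i (j * 2 + s) else 0) =
       (\<Sum>i<h. \<Sum>t<2. if t = s then \<Sum>j<b. f (i * 2 + s) (j * 2 + s) else 0)"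
      unfolding sum_lessThan_mult by (intro sum.cong refl) auto
    then show "(\<Sum>i<h. \<Sum>j<b. f (i * 2 + s) (j * 2 + s)) =
       (\<Sum>i<h * 2. \<Sum>j<b. if i mod 2 = s then f i (j * 2 + s) else 0)" using s by simp
  qed
  finally show ?thesis .
qed

text \<open>Exchanging the two parties transposes the amplitude matrix. Through this symmetry facts
  about single steps need a proof only for the steps of Alice.\<close>

fun flip_step :: "step \<Rightarrow> step" where
  "flip_step (AliceAncilla m) = BobAncilla m"
| "flip_step (BobAncilla m) = AliceAncilla m"
| "flip_step (AliceUnitary U) = BobUnitary U"
| "flip_step (BobUnitary U) = AliceUnitary U"
| "flip_step AliceSends = BobSends"
| "flip_step BobSends = AliceSends"

definition is_send :: "step \<Rightarrow> bool" where
  "is_send s \<longleftrightarrow> s = AliceSends \<or> s = BobSends"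

lemma flip_step [simp]:
  "valid_step (flip_step s) (b, a) = valid_step s (a, b)"
  "step_dims (flip_step s) (b, a) = prod.swap (step_dims s (a, b))"
  "is_send (flip_step s) = is_send s"
  by (cases s; simp add: is_send_def)+

lemma unitary_carrier: "unitary n U \<Longrightarrow> U \<in> carrier_mat n n"
  by (simp add: unitary_def)

lemma apply_step_carrier:
  assumes "valid_step s (a, b)" "\<Psi> \<in> carrier_mat a b" "step_dims s (a, b) = (a', b')"
  shows "apply_step x y s \<Psi> \<in> carrier_mat a' b'"
  using assms by (cases s) (auto simp: on_alice_def on_bob_def unitary_def intro!: mult_carrier_mat[of _ _ _ _] )

lemma apply_flip_step:
  assumes v: "valid_step s (a, b)" and P: "\<Psi> \<in> carrier_mat a b"
  shows "apply_step y x (flip_step s) (transpose_mat \<Psi>) = transpose_mat (apply_step x y s \<Psi>)"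
proof (cases s)
  case (AliceUnitary U)
  then have U: "U x \<in> carrier_mat a a" using v by (simp add: unitary_carrier)
  show ?thesis using transpose_mult[OF U P] by (simp add: AliceUnitary on_alice_def on_bob_def)
next
  case (BobUnitary V)
  then have V: "transpose_mat (V y) \<in> carrier_mat b b" using v by (simp add: unitary_carrier)
  show ?thesis using transpose_mult[OF P V] by (simp add: BobUnitary on_alice_def on_bob_def)
qed (use v P in \<open>auto intro!: eq_matI simp: less_mult_imp_div_less elim!: evenE\<close>)

text \<open>The operator norm as a bound for a bilinear form. Without conjugation on either side it
  is visibly invariant under transposition, hence under exchange of the parties.\<close>

definition norm_bounded :: "nat \<Rightarrow> nat \<Rightarrow> bipartite \<Rightarrow> real \<Rightarrow> bool" where
  "norm_bounded a b \<Psi> \<kappa> \<longleftrightarrow> (\<forall>\<alpha> \<beta>. norm_sq a \<alpha> \<le> 1 \<longrightarrow> norm_sq b \<beta> \<le> 1 \<longrightarrow>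
     cmod (\<Sum>i<a. \<Sum>j<b. \<alpha> i * \<Psi> $$ (i, j) * \<beta> j) \<le> \<kappa>)"

text \<open>A Schmidt rank bound with control of norms. The terms may be neither orthogonal nor
  normalized, so that a sent qubit can simply split each of them in two.\<close>

definition product_sum :: "nat \<Rightarrow> nat \<Rightarrow> nat \<Rightarrow> bipartite \<Rightarrow> bool" where
  "product_sum a b m \<Psi> \<longleftrightarrow> (\<exists>p q. (\<forall>t<m. norm_sq a (p t) \<le> 1 \<and> norm_sq b (q t) \<le> 1) \<and>
     (\<forall>i<a. \<forall>j<b. \<Psi> $$ (i, j) = (\<Sum>t<m. p t i * q t j)))"

text \<open>Linearity as a relation between entries inside the given dimensions; steps change these
  dimensions, and the relation is carried through them.\<close>

definition lincomb_of :: "nat \<Rightarrow> nat \<Rightarrow> nat set \<Rightarrow> (nat \<Rightarrow> complex) \<Rightarrow> (nat \<Rightarrow> bipartite) \<Rightarrow> bipartite \<Rightarrow> bool" where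
  "lincomb_of a b T g \<omega> \<Psi> \<longleftrightarrow> (\<forall>i<a. \<forall>j<b. \<Psi> $$ (i, j) = (\<Sum>k\<in>T. g k * \<omega> k $$ (i, j)))"

lemma norm_bounded_transpose:
  assumes "\<Psi> \<in> carrier_mat a b"
  shows "norm_bounded b a (transpose_mat \<Psi>) \<kappa> \<longleftrightarrow> norm_bounded a b \<Psi> \<kappa>"
proof -
  have eq: "(\<Sum>j<b. \<Sum>i<a. \<beta> j * transpose_mat \<Psi> $$ (j, i) * \<alpha> i) = (\<Sum>i<a. \<Sum>j<b. \<alpha> i * \<Psi> $$ (i, j) * \<beta> j)" for \<alpha> \<beta>
    by (subst sum.swap) (use assms in \<open>auto intro!: sum.cong\<close>)
  show ?thesis unfolding norm_bounded_def eq by blast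
qed

lemma product_sum_transpose:
  assumes "\<Psi> \<in> carrier_mat a b" "product_sum a b m \<Psi>"
  shows "product_sum b a m (transpose_mat \<Psi>)"
proof -
  from assms(2) obtain p q where "\<forall>t<m. norm_sq a (p t) \<le> 1 \<and> norm_sq b (q t) \<le> 1"
    "\<forall>i<a. \<forall>j<b. \<Psi> $$ (i, j) = (\<Sum>t<m. p t i * q t j)" unfolding product_sum_def by blast
  then show ?thesis unfolding product_sum_def
    by (intro exI[of _ q] exI[of _ p]) (use assms(1) in \<open>auto simp: mult.commute\<close>)
qed

lemma braket_carrier:
  "\<Phi> \<in> carrier_mat a b \<Longrightarrow> braket \<Phi> \<Psi> = (\<Sum>i<a. \<Sum>j<b. cnj (\<Phi> $$ (i, j)) * \<Psi> $$ (i, j))"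
  by (auto simp: braket_def)

lemma braket_transpose:
  assumes "\<Phi> \<in> carrier_mat a b" "\<Psi> \<in> carrier_mat a b"
  shows "braket (transpose_mat \<Phi>) (transpose_mat \<Psi>) = braket \<Phi> \<Psi>"
proof -
  have "transpose_mat \<Phi> \<in> carrier_mat b a" using assms by simp
  then show ?thesis unfolding braket_carrier[OF assms(1)] 
    by (subst braket_carrier, assumption, subst sum.swap) (use assms in \<open>auto intro!: sum.cong\<close>)
qed

lemma norm_sq_restrict:
  assumes "0 < m"
  shows "norm_sq a (\<lambda>i. \<alpha> (i * m)) \<le> norm_sq (a * m) \<alpha>"
  unfolding norm_sq_def sum_lessThan_mult
proof (rule sum_mono)
  fix i
  show "(cmod (\<alpha> (i * m)))\<^sup>2 \<le> (\<Sum>s<m. (cmod (\<alpha> (i * m + s)))\<^sup>2)"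
    using member_le_sum[of 0 "{..<m}" "\<lambda>s. (cmod (\<alpha> (i * m + s)))\<^sup>2"] assms by simp
qed

lemma norm_sq_residue:
  assumes "s < 2"
  shows "norm_sq a (\<lambda>i. \<alpha> (i * 2 + s)) \<le> norm_sq (a * 2) \<alpha>"
  unfolding norm_sq_def sum_lessThan_mult
  by (rule sum_mono, rule member_le_sum) (use assms in auto)

lemma norm_sq_insert:
  assumes "s < m"
  shows "norm_sq (a * m) (\<lambda>i. if i mod m = s then \<alpha> (i div m) else 0) = norm_sq a \<alpha>"
proof -
  have "norm_sq (a * m) (\<lambda>i. if i mod m = s then \<alpha> (i div m) else 0) = (\<Sum>i<a. \<Sum>t<m. if t = s then (cmod (\<alpha> i))\<^sup>2 else 0)"
    unfolding norm_sq_def sum_lessThan_mult by (intro sum.cong refl) auto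
  then show ?thesis using assms by (simp add: norm_sq_def)
qed

lemma index_mat_mult_lessThan:
  "U \<in> carrier_mat a n \<Longrightarrow> \<Psi> \<in> carrier_mat n b \<Longrightarrow> i < a \<Longrightarrow> j < b \<Longrightarrow>
    (U * \<Psi>) $$ (i, j) = (\<Sum>k<n. U $$ (i, k) * \<Psi> $$ (k, j))"
  by (auto simp: scalar_prod_def atLeast0LessThan)

definition alice_step :: "step \<Rightarrow> bool" where
  "alice_step s \<longleftrightarrow> (case s of AliceAncilla _ \<Rightarrow> True | AliceUnitary _ \<Rightarrow> True | AliceSends \<Rightarrow> True | _ \<Rightarrow> False)"

lemma alice_step_cases: "alice_step s \<or> alice_step (flip_step s)"
  by (cases s) (auto simp: alice_step_def)

abbreviation send_factor :: "step \<Rightarrow> nat" where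
  "send_factor s \<equiv> if is_send s then 2 else 1"

text \<open>The matrix is moved onto the test vector of Alice. Only contractivity of this action is
  assumed, which covers unitaries as well as measurement operators.\<close>

lemma norm_bounded_left_mult:
  assumes U: "U \<in> carrier_mat a n" and P: "\<Psi> \<in> carrier_mat n b" and N: "norm_bounded n b \<Psi> \<kappa>"
    and contr: "\<And>\<alpha>. norm_sq a \<alpha> \<le> 1 \<Longrightarrow> norm_sq n (\<lambda>k. \<Sum>i<a. \<alpha> i * U $$ (i, k)) \<le> 1"
  shows "norm_bounded a b (U * \<Psi>) \<kappa>"
  unfolding norm_bounded_def
proof (intro allI impI)
  fix \<alpha> \<beta> assume "norm_sq a \<alpha> \<le> 1" "norm_sq b \<beta> \<le> 1"
  have "(\<Sum>i<a. \<Sum>j<b. \<alpha> i * (U * \<Psi>) $$ (i, j) * \<beta> j)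
     = (\<Sum>i<a. \<Sum>j<b. \<Sum>k<n. \<alpha> i * U $$ (i, k) * \<Psi> $$ (k, j) * \<beta> j)"
    by (intro sum.cong refl) (simp add: index_mat_mult_lessThan[OF U P] sum_distrib_left sum_distrib_right mult_ac)
  also have "\<dots> = (\<Sum>j<b. \<Sum>k<n. \<Sum>i<a. \<alpha> i * U $$ (i, k) * \<Psi> $$ (k, j) * \<beta> j)"
    by (subst sum.swap, rule sum.cong[OF refl], rule sum.swap)
  also have "\<dots> = (\<Sum>k<n. \<Sum>j<b. (\<Sum>i<a. \<alpha> i * U $$ (i, k)) * \<Psi> $$ (k, j) * \<beta> j)"
    by (subst sum.swap) (simp only: sum_distrib_right)
  also have "cmod \<dots> \<le> \<kappa>"
    using N contr[OF \<open>norm_sq a \<alpha> \<le> 1\<close>] \<open>norm_sq b \<beta> \<le> 1\<close> unfolding norm_bounded_def by blast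
  finally show "cmod (\<Sum>i<a. \<Sum>j<b. \<alpha> i * (U * \<Psi>) $$ (i, j) * \<beta> j) \<le> \<kappa>" .
qed

text \<open>Ancillas and unitaries transform the test vectors without increasing their norms. For a
  sent qubit the form is the sum of two parts, one for each value of the qubit, and each obeys the
  old bound; hence the factor 2.\<close>

lemma norm_bounded_alice_step:
  fixes \<kappa> :: real
  assumes s: "alice_step s" and v: "valid_step s (a, b)" and P: "\<Psi> \<in> carrier_mat a b"
    and d: "step_dims s (a, b) = (a', b')" and N: "norm_bounded a b \<Psi> \<kappa>"
  shows "norm_bounded a' b' (apply_step x y s \<Psi>) (send_factor s * \<kappa>)"
proof (cases s)
  case (AliceAncilla m)
  then have m: "0 < m" and d': "a' = a * m" "b' = b" using v d by auto
  show ?thesis unfolding norm_bounded_def d'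
  proof (intro allI impI)
    fix \<alpha> \<beta> assume ab: "norm_sq (a * m) \<alpha> \<le> 1" "norm_sq b \<beta> \<le> 1"
    have "(\<Sum>i<a * m. \<Sum>j<b. \<alpha> i * apply_step x y s \<Psi> $$ (i, j) * \<beta> j) =
       (\<Sum>i<a * m. if i mod m = 0 then \<Sum>j<b. \<alpha> (i div m * m) * \<Psi> $$ (i div m, j) * \<beta> j else 0)"
      using AliceAncilla P by (intro sum.cong refl) (auto intro!: sum.cong)
    also have "\<dots> = (\<Sum>i<a. \<Sum>j<b. \<alpha> (i * m) * \<Psi> $$ (i, j) * \<beta> j)" by (rule sum_mod_eq_0[OF m])
    also have "cmod \<dots> \<le> \<kappa>"
      using N ab norm_sq_restrict[OF m, of a \<alpha>] unfolding norm_bounded_def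
      by (elim allE[where x = "\<lambda>i. \<alpha> (i * m)"] allE[where x = \<beta>]) simp
    finally show "cmod (\<Sum>i<a * m. \<Sum>j<b. \<alpha> i * apply_step x y s \<Psi> $$ (i, j) * \<beta> j) \<le> send_factor s * \<kappa>"
      by (simp add: AliceAncilla is_send_def)
  qed
next
  case (AliceUnitary U)
  then have U: "unitary a (U x)" and d': "a' = a" "b' = b" using v d by auto
  have "norm_bounded a b (U x * \<Psi>) \<kappa>"
  proof (rule norm_bounded_left_mult[OF unitary_carrier[OF U] P N])
    fix \<alpha> assume "norm_sq a \<alpha> \<le> 1"
    then show "norm_sq a (\<lambda>k. \<Sum>i<a. \<alpha> i * U x $$ (i, k)) \<le> 1"
      using norm_sq_orthonormal_sum[OF unitary_orthonormal(1)[OF U], of "{..<a}" \<alpha>]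
      by (simp add: norm_sq_def)
  qed
  then show ?thesis by (simp add: d' AliceUnitary is_send_def on_alice_def)
next
  case AliceSends
  then obtain h where a: "a = h * 2" using v by (auto elim: evenE)
  have d': "a' = h" "b' = b * 2" using d a AliceSends by auto
  show ?thesis unfolding norm_bounded_def d'
  proof (intro allI impI)
    fix \<alpha> \<beta> assume ab: "norm_sq h \<alpha> \<le> 1" "norm_sq (b * 2) \<beta> \<le> 1"
    define F where "F i j = \<alpha> (i div 2) * \<Psi> $$ (i, j div 2) * \<beta> j" for i j
    have "(\<Sum>i<h. \<Sum>j<b * 2. \<alpha> i * apply_step x y s \<Psi> $$ (i, j) * \<beta> j) =
       (\<Sum>i<h. \<Sum>j<b * 2. F (2 * i + j mod 2) j)"
      using AliceSends P a by (intro sum.cong refl) (auto simp: F_def)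
    also have "\<dots> = (\<Sum>s<2. \<Sum>i<h * 2. \<Sum>j<b. if i mod 2 = s then F i (j * 2 + s) else 0)"
      by (rule sum_mod_mult2)
    also have "\<dots> = (\<Sum>s<2. \<Sum>i<h * 2. \<Sum>j<b. (if i mod 2 = s then \<alpha> (i div 2) else 0) * \<Psi> $$ (i, j) * \<beta> (j * 2 + s))"
      by (intro sum.cong refl) (auto simp: F_def)
    also have "cmod \<dots> \<le> (\<Sum>s<(2::nat). \<kappa>)"
    proof (rule sum_norm_le)
      fix s :: nat assume "s \<in> {..<2}"
      then have "s < 2" by simp
      then show "cmod (\<Sum>i<h * 2. \<Sum>j<b. (if i mod 2 = s then \<alpha> (i div 2) else 0) * \<Psi> $$ (i, j) * \<beta> (j * 2 + s)) \<le> \<kappa>"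
        using N[unfolded norm_bounded_def a, rule_format,
            of "\<lambda>i. if i mod 2 = s then \<alpha> (i div 2) else 0" "\<lambda>j. \<beta> (j * 2 + s)"]
          ab norm_sq_insert[of s 2 h \<alpha>] norm_sq_residue[of s b \<beta>] by simp
    qed
    finally show "cmod (\<Sum>i<h. \<Sum>j<b * 2. \<alpha> i * apply_step x y s \<Psi> $$ (i, j) * \<beta> j) \<le> send_factor s * \<kappa>"
      by (simp add: AliceSends is_send_def)
  qed
qed (use s in \<open>auto simp: alice_step_def\<close>)

lemma norm_bounded_step:
  fixes \<kappa> :: real
  assumes v: "valid_step s (a, b)" and P: "\<Psi> \<in> carrier_mat a b"
    and d: "step_dims s (a, b) = (a', b')" and N: "norm_bounded a b \<Psi> \<kappa>"
  shows "norm_bounded a' b' (apply_step x y s \<Psi>) (send_factor s * \<kappa>)"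
proof (cases "alice_step s")
  case False
  then have "norm_bounded b' a' (apply_step y x (flip_step s) (transpose_mat \<Psi>)) (send_factor (flip_step s) * \<kappa>)"
    by (intro norm_bounded_alice_step[of _ b a]) (use alice_step_cases v P d N in \<open>auto simp: norm_bounded_transpose\<close>)
  then show ?thesis
    by (simp add: apply_flip_step[OF v P] norm_bounded_transpose[OF apply_step_carrier[OF v P d]])
qed (rule norm_bounded_alice_step[OF _ v P d N])

lemma product_sum_alice_step:
  assumes s: "alice_step s" and v: "valid_step s (a, b)" and P: "\<Psi> \<in> carrier_mat a b"
    and d: "step_dims s (a, b) = (a', b')" and ps: "product_sum a b m \<Psi>"
  shows "product_sum a' b' (m * send_factor s) (apply_step x y s \<Psi>)"
proof -
  from ps obtain p q where pq: "\<And>t. t < m \<Longrightarrow> norm_sq a (p t) \<le> 1" "\<And>t. t < m \<Longrightarrow> norm_sq b (q t) \<le> 1"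
    and eq: "\<And>i j. i < a \<Longrightarrow> j < b \<Longrightarrow> \<Psi> $$ (i, j) = (\<Sum>t<m. p t i * q t j)"
    unfolding product_sum_def by blast
  show ?thesis
  proof (cases s)
    case (AliceAncilla k)
    then have k: "0 < k" and d': "a' = a * k" "b' = b" using v d by auto
    define p' where "p' t i = (if i mod k = 0 then p t (i div k) else 0)" for t i
    have "norm_sq (a * k) (p' t) \<le> 1" if "t < m" for t
      unfolding p'_def[abs_def] using norm_sq_insert[OF k, of a "p t"] pq(1)[OF that] by simp
    moreover have "apply_step x y s \<Psi> $$ (i, j) = (\<Sum>t<m. p' t i * q t j)" if "i < a * k" "j < b" for i j
      using that P by (auto simp: AliceAncilla p'_def eq less_mult_imp_div_less)
    ultimately show ?thesis unfolding product_sum_def d' using pq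
      by (intro exI[of _ p'] exI[of _ q]) (auto simp: AliceAncilla is_send_def)
  next
    case (AliceUnitary U)
    then have U: "unitary a (U x)" and d': "a' = a" "b' = b" using v d by auto
    define p' where "p' t i = (\<Sum>k<a. p t k * U x $$ (i, k))" for t i
    have "norm_sq a (p' t) \<le> 1" if "t < m" for t
      using norm_sq_orthonormal_sum[OF unitary_orthonormal(2)[OF U], of "{..<a}" "p t"] pq(1)[OF that]
      unfolding p'_def[abs_def] by (simp add: norm_sq_def)
    moreover have "apply_step x y s \<Psi> $$ (i, j) = (\<Sum>t<m. p' t i * q t j)" if "i < a" "j < b" for i j
    proof -
      have "apply_step x y s \<Psi> $$ (i, j) = (\<Sum>k<a. U x $$ (i, k) * (\<Sum>t<m. p t k * q t j))"
        using that by (simp add: AliceUnitary on_alice_def index_mat_mult_lessThan[OF unitary_carrier[OF U] P] eq)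
      also have "\<dots> = (\<Sum>t<m. p' t i * q t j)"
        unfolding p'_def sum_distrib_left sum_distrib_right by (subst sum.swap) (simp add: mult_ac)
      finally show ?thesis .
    qed
    ultimately show ?thesis unfolding product_sum_def d' using pq
      by (intro exI[of _ p'] exI[of _ q]) (auto simp: AliceUnitary is_send_def)
  next
    case AliceSends
    then obtain h where a: "a = h * 2" using v by (auto elim: evenE)
    have d': "a' = h" "b' = b * 2" using d a AliceSends by auto
    \<comment> \<open>In the new term number \<open>t\<close> the old term is
      \<open>t div 2\<close>, and \<open>t mod 2\<close> is the value of the qubit that
      moves.\<close>
    define p' where "p' t i = p (t div 2) (i * 2 + t mod 2)" for t i
    define q' where "q' t j = (if j mod 2 = t mod 2 then q (t div 2) (j div 2) else 0)" for t j
    have "norm_sq h (p' t) \<le> 1" if "t < m * 2" for t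
      unfolding p'_def[abs_def] using norm_sq_residue[of "t mod 2" h "p (t div 2)"] pq(1)[of "t div 2"] that a
      by (simp add: less_mult_imp_div_less)
    moreover have "norm_sq (b * 2) (q' t) \<le> 1" if "t < m * 2" for t
      unfolding q'_def[abs_def] using norm_sq_insert[of "t mod 2" 2 b "q (t div 2)"] pq(2)[of "t div 2"] that
      by (simp add: less_mult_imp_div_less)
    moreover have "apply_step x y s \<Psi> $$ (i, j) = (\<Sum>t<m * 2. p' t i * q' t j)" if "i < h" "j < b * 2" for i j
    proof -
      have "(\<Sum>t<m * 2. p' t i * q' t j) = (\<Sum>t<m. \<Sum>s<2. if s = j mod 2 then p t (i * 2 + s) * q t (j div 2) else 0)"
        unfolding sum_lessThan_mult by (intro sum.cong refl) (auto simp: p'_def q'_def)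
      also have "\<dots> = (\<Sum>t<m. p t (2 * i + j mod 2) * q t (j div 2))" by (simp add: mult.commute)
      also have "\<dots> = apply_step x y s \<Psi> $$ (i, j)"
        using that P a by (simp add: AliceSends less_mult_imp_div_less eq)
      finally show ?thesis ..
    qed
    ultimately show ?thesis unfolding product_sum_def d'
      by (intro exI[of _ p'] exI[of _ q']) (auto simp: AliceSends is_send_def)
  qed (use s in \<open>auto simp: alice_step_def\<close>)
qed

lemma product_sum_step:
  assumes v: "valid_step s (a, b)" and P: "\<Psi> \<in> carrier_mat a b"
    and d: "step_dims s (a, b) = (a', b')" and ps: "product_sum a b m \<Psi>"
  shows "product_sum a' b' (m * send_factor s) (apply_step x y s \<Psi>)"
proof (cases "alice_step s")
  case False
  then have ps': "product_sum b' a' (m * send_factor (flip_step s)) (apply_step y x (flip_step s) (transpose_mat \<Psi>))"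
    by (intro product_sum_alice_step[of _ b a])
      (use alice_step_cases v P d product_sum_transpose[OF P ps] in auto)
  have "transpose_mat (apply_step x y s \<Psi>) \<in> carrier_mat b' a'"
    using apply_step_carrier[OF v P d] by simp
  from product_sum_transpose[OF this] ps' show ?thesis
    by (simp add: apply_flip_step[OF v P])
qed (rule product_sum_alice_step[OF _ v P d ps])

lemma braket_alice_step:
  assumes s: "alice_step s" and v: "valid_step s (a, b)" and P: "\<Phi> \<in> carrier_mat a b" "\<Psi> \<in> carrier_mat a b"
    and d: "step_dims s (a, b) = (a', b')"
  shows "braket (apply_step x y s \<Phi>) (apply_step x y s \<Psi>) = braket \<Phi> \<Psi>"
proof (cases s)
  case (AliceAncilla m)
  then have m: "0 < m" and d': "a' = a * m" "b' = b" using v d by auto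
  have "(\<Sum>i<a * m. \<Sum>j<b. cnj (apply_step x y s \<Phi> $$ (i, j)) * apply_step x y s \<Psi> $$ (i, j)) =
     (\<Sum>i<a * m. if i mod m = 0 then \<Sum>j<b. cnj (\<Phi> $$ (i div m, j)) * \<Psi> $$ (i div m, j) else 0)"
    using AliceAncilla P by (intro sum.cong refl) (auto intro!: sum.cong)
  also have "\<dots> = (\<Sum>i<a. \<Sum>j<b. cnj (\<Phi> $$ (i, j)) * \<Psi> $$ (i, j))" by (rule sum_mod_eq_0[OF m])
  finally show ?thesis
    unfolding braket_carrier[OF apply_step_carrier[OF v P(1) d]] braket_carrier[OF P(1)] d' .
next
  case (AliceUnitary U)
  then have U: "unitary a (U x)" and d': "a' = a" "b' = b" using v d by auto
  have "(\<Sum>i<a. cnj ((U x * \<Phi>) $$ (i, j)) * (U x * \<Psi>) $$ (i, j)) = (\<Sum>i<a. cnj (\<Phi> $$ (i, j)) * \<Psi> $$ (i, j))"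
    if "j < b" for j
  proof -
    let ?f = "\<lambda>\<Phi> i. \<Sum>k<a. \<Phi> $$ (k, j) * U x $$ (i, k)"
    have entry: "(U x * \<Phi>) $$ (i, j) = ?f \<Phi> i" if "\<Phi> \<in> carrier_mat a b" "i < a" for \<Phi> i
      using \<open>j < b\<close> that(2)
      by (simp add: index_mat_mult_lessThan[OF unitary_carrier[OF U] that(1)] mult.commute)
    have "(\<Sum>i<a. cnj ((U x * \<Phi>) $$ (i, j)) * (U x * \<Psi>) $$ (i, j)) = inner_fn a (?f \<Phi>) (?f \<Psi>)"
      unfolding inner_fn_def using that by (intro sum.cong refl) (simp only: entry P lessThan_iff)
    also have "\<dots> = (\<Sum>k<a. cnj (\<Phi> $$ (k, j)) * \<Psi> $$ (k, j))"
      unfolding inner_fn_sum_left inner_fn_sum_right by (rule orthonormal_sum_sum[OF unitary_orthonormal(2)[OF U]]) simp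
    finally show ?thesis .
  qed
  then show ?thesis
    unfolding braket_carrier[OF apply_step_carrier[OF v P(1) d]] braket_carrier[OF P(1)] d'
    by (subst (1 2) sum.swap) (simp add: AliceUnitary on_alice_def)
next
  case AliceSends
  then obtain h where a: "a = h * 2" using v by (auto elim: evenE)
  have d': "a' = h" "b' = b * 2" using d a AliceSends by auto
  define F where "F i j = cnj (\<Phi> $$ (i, j div 2)) * \<Psi> $$ (i, j div 2)" for i j
  have "(\<Sum>i<h. \<Sum>j<b * 2. cnj (apply_step x y s \<Phi> $$ (i, j)) * apply_step x y s \<Psi> $$ (i, j)) =
    (\<Sum>i<h. \<Sum>j<b * 2. F (2 * i + j mod 2) j)"
    using AliceSends P a by (intro sum.cong refl) (auto simp: F_def)
  also have "\<dots> = (\<Sum>s<2. \<Sum>i<h * 2. \<Sum>j<b. if i mod 2 = s then F i (j * 2 + s) else 0)"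
    by (rule sum_mod_mult2)
  also have "\<dots> = (\<Sum>s<2. \<Sum>i<h * 2. \<Sum>j<b. if s = i mod 2 then cnj (\<Phi> $$ (i, j)) * \<Psi> $$ (i, j) else 0)"
    by (intro sum.cong refl) (auto simp: F_def)
  also have "\<dots> = (\<Sum>i<h * 2. \<Sum>j<b. \<Sum>s<2. if s = i mod 2 then cnj (\<Phi> $$ (i, j)) * \<Psi> $$ (i, j) else 0)"
    by (subst sum.swap, rule sum.cong[OF refl], rule sum.swap)
  also have "\<dots> = (\<Sum>i<h * 2. \<Sum>j<b. cnj (\<Phi> $$ (i, j)) * \<Psi> $$ (i, j))" by simp
  finally show ?thesis
    unfolding braket_carrier[OF apply_step_carrier[OF v P(1) d]] braket_carrier[OF P(1)] d' a .
qed (use s in \<open>auto simp: alice_step_def\<close>)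

lemma braket_step:
  assumes v: "valid_step s (a, b)" and P: "\<Phi> \<in> carrier_mat a b" "\<Psi> \<in> carrier_mat a b"
  shows "braket (apply_step x y s \<Phi>) (apply_step x y s \<Psi>) = braket \<Phi> \<Psi>"
proof -
  obtain a' b' where d: "step_dims s (a, b) = (a', b')" by fastforce
  show ?thesis
  proof (cases "alice_step s")
    case False
    then have "braket (apply_step y x (flip_step s) (transpose_mat \<Phi>)) (apply_step y x (flip_step s) (transpose_mat \<Psi>))
        = braket (transpose_mat \<Phi>) (transpose_mat \<Psi>)"
      by (intro braket_alice_step[of _ b a _ _ b' a']) (use alice_step_cases v P d in auto)
    then show ?thesis
      by (simp add: apply_flip_step[OF v] P braket_transpose[OF P]
          braket_transpose[OF apply_step_carrier[OF v P(1) d] apply_step_carrier[OF v P(2) d]])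
  qed (rule braket_alice_step[OF _ v P d])
qed

lemma lincomb_of_left_mult:
  assumes M: "M \<in> carrier_mat a a" and P: "\<Psi> \<in> carrier_mat a b" "\<And>k. k \<in> T \<Longrightarrow> \<omega> k \<in> carrier_mat a b"
    and lc: "lincomb_of a b T g \<omega> \<Psi>"
  shows "lincomb_of a b T g (\<lambda>k. M * \<omega> k) (M * \<Psi>)"
  unfolding lincomb_of_def
proof (intro allI impI)
  fix i j assume ij: "i < a" "j < b"
  have "(M * \<Psi>) $$ (i, j) = (\<Sum>l<a. M $$ (i, l) * (\<Sum>k\<in>T. g k * \<omega> k $$ (l, j)))"
    using ij lc by (simp add: index_mat_mult_lessThan[OF M P(1)] lincomb_of_def)
  also have "\<dots> = (\<Sum>k\<in>T. g k * (\<Sum>l<a. M $$ (i, l) * \<omega> k $$ (l, j)))"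
    unfolding sum_distrib_left by (subst sum.swap) (simp add: mult_ac)
  also have "\<dots> = (\<Sum>k\<in>T. g k * (M * \<omega> k) $$ (i, j))"
    using ij by (intro sum.cong refl) (simp add: index_mat_mult_lessThan[OF M P(2)])
  finally show "(M * \<Psi>) $$ (i, j) = (\<Sum>k\<in>T. g k * (M * \<omega> k) $$ (i, j))" .
qed

lemma lincomb_of_right_mult:
  assumes M: "M \<in> carrier_mat b b" and P: "\<Psi> \<in> carrier_mat a b" "\<And>k. k \<in> T \<Longrightarrow> \<omega> k \<in> carrier_mat a b"
    and lc: "lincomb_of a b T g \<omega> \<Psi>"
  shows "lincomb_of a b T g (\<lambda>k. \<omega> k * M) (\<Psi> * M)"
  unfolding lincomb_of_def
proof (intro allI impI)
  fix i j assume ij: "i < a" "j < b"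
  have "(\<Psi> * M) $$ (i, j) = (\<Sum>l<b. (\<Sum>k\<in>T. g k * \<omega> k $$ (i, l)) * M $$ (l, j))"
    using ij lc by (simp add: index_mat_mult_lessThan[OF P(1) M] lincomb_of_def)
  also have "\<dots> = (\<Sum>k\<in>T. g k * (\<Sum>l<b. \<omega> k $$ (i, l) * M $$ (l, j)))"
    unfolding sum_distrib_left sum_distrib_right by (subst sum.swap) (simp add: mult_ac)
  also have "\<dots> = (\<Sum>k\<in>T. g k * (\<omega> k * M) $$ (i, j))"
    using ij by (intro sum.cong refl) (simp add: index_mat_mult_lessThan[OF P(2) M])
  finally show "(\<Psi> * M) $$ (i, j) = (\<Sum>k\<in>T. g k * (\<omega> k * M) $$ (i, j))" .
qed

lemma lincomb_of_step:
  assumes v: "valid_step s (a, b)" and P: "\<Psi> \<in> carrier_mat a b" "\<And>k. k \<in> T \<Longrightarrow> \<omega> k \<in> carrier_mat a b"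
    and d: "step_dims s (a, b) = (a', b')" and lc: "lincomb_of a b T g \<omega> \<Psi>"
  shows "lincomb_of a' b' T g (\<lambda>k. apply_step x y s (\<omega> k)) (apply_step x y s \<Psi>)"
proof -
  have dims: "k \<in> T \<Longrightarrow> dim_row (\<omega> k) = a" "k \<in> T \<Longrightarrow> dim_col (\<omega> k) = b" for k
    using P(2) by auto
  show ?thesis
  proof (cases s)
    case (AliceUnitary U)
    then show ?thesis using v d lincomb_of_left_mult[OF unitary_carrier P lc, of "U x"]
      by (simp add: on_alice_def)
  next
    case (BobUnitary V)
    then have "transpose_mat (V y) \<in> carrier_mat b b" using v by (simp add: unitary_carrier)
    then show ?thesis using d BobUnitary lincomb_of_right_mult[OF _ P lc] by (simp add: on_bob_def)
  qed (use v d P lc in \<open>auto simp: lincomb_of_def dims less_mult_imp_div_less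
      elim!: evenE intro!: sum.cong sum.neutral\<close>)
qed

section \<open>Measurements\<close>

lemma valid_steps_append:
  "valid_steps (ss @ ts) d \<longleftrightarrow> valid_steps ss d \<and> valid_steps ts (fold step_dims ss d)"
  by (induct ss arbitrary: d) auto

lemma fold_carrier:
  assumes "valid_steps ss (a, b)" "fold step_dims ss (a, b) = (a', b')" "\<Psi> \<in> carrier_mat a b"
  shows "fold (apply_step x y) ss \<Psi> \<in> carrier_mat a' b'"
  using assms
proof (induct ss arbitrary: a b \<Psi>)
  case (Cons s ss)
  obtain a1 b1 where d: "step_dims s (a, b) = (a1, b1)" by fastforce
  then have "apply_step x y s \<Psi> \<in> carrier_mat a1 b1" using Cons by (intro apply_step_carrier) auto
  then show ?case using Cons(1)[of a1 b1 "apply_step x y s \<Psi>"] Cons(2,3) d by simp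
qed simp

lemma fold_norm_bounded:
  assumes "valid_steps ss (a, b)" "fold step_dims ss (a, b) = (a', b')" "\<Psi> \<in> carrier_mat a b"
    "norm_bounded a b \<Psi> \<kappa>"
  shows "norm_bounded a' b' (fold (apply_step x y) ss \<Psi>) (2 ^ length (filter is_send ss) * \<kappa>)"
  using assms
proof (induct ss arbitrary: a b \<Psi> \<kappa>)
  case (Cons s ss)
  obtain a1 b1 where d: "step_dims s (a, b) = (a1, b1)" by fastforce
  have v: "valid_step s (a, b)" using Cons by simp
  note step = apply_step_carrier[OF v Cons(4) d, of x y] norm_bounded_step[OF v Cons(4) d Cons(5), of x y]
  have "norm_bounded a' b' (fold (apply_step x y) ss (apply_step x y s \<Psi>))
      (2 ^ length (filter is_send ss) * (real (send_factor s) * \<kappa>))"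
    by (rule Cons(1)[OF _ _ step]) (use Cons d in auto)
  moreover have "2 ^ length (filter is_send ss) * (real (send_factor s) * \<kappa>) =
      2 ^ length (filter is_send (s # ss)) * \<kappa>" by simp
  ultimately show ?case by simp
qed simp

lemma fold_product_sum:
  assumes "valid_steps ss (a, b)" "fold step_dims ss (a, b) = (a', b')" "\<Psi> \<in> carrier_mat a b"
    "product_sum a b m \<Psi>"
  shows "product_sum a' b' (m * 2 ^ length (filter is_send ss)) (fold (apply_step x y) ss \<Psi>)"
  using assms
proof (induct ss arbitrary: a b \<Psi> m)
  case (Cons s ss)
  obtain a1 b1 where d: "step_dims s (a, b) = (a1, b1)" by fastforce
  have v: "valid_step s (a, b)" using Cons by simp
  note step = apply_step_carrier[OF v Cons(4) d, of x y] product_sum_step[OF v Cons(4) d Cons(5), of x y]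
  have "product_sum a' b' ((m * send_factor s) * 2 ^ length (filter is_send ss))
      (fold (apply_step x y) ss (apply_step x y s \<Psi>))"
    by (rule Cons(1)[OF _ _ step]) (use Cons d in auto)
  moreover have "(m * send_factor s) * 2 ^ length (filter is_send ss) =
      m * 2 ^ length (filter is_send (s # ss))" by simp
  ultimately show ?case by simp
qed simp

lemma fold_braket:
  assumes "valid_steps ss (a, b)" "\<Phi> \<in> carrier_mat a b" "\<Psi> \<in> carrier_mat a b"
  shows "braket (fold (apply_step x y) ss \<Phi>) (fold (apply_step x y) ss \<Psi>) = braket \<Phi> \<Psi>"
  using assms
proof (induct ss arbitrary: a b \<Phi> \<Psi>)
  case (Cons s ss)
  obtain a1 b1 where d: "step_dims s (a, b) = (a1, b1)" by fastforce
  have v: "valid_step s (a, b)" using Cons by simp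
  have "braket (fold (apply_step x y) ss (apply_step x y s \<Phi>)) (fold (apply_step x y) ss (apply_step x y s \<Psi>))
      = braket (apply_step x y s \<Phi>) (apply_step x y s \<Psi>)"
    by (rule Cons(1)[of a1 b1]) (use Cons d apply_step_carrier[OF v _ d] in auto)
  then show ?case using braket_step[OF v Cons(3,4)] by simp
qed simp

lemma fold_lincomb_of:
  assumes "valid_steps ss (a, b)" "fold step_dims ss (a, b) = (a', b')" "\<Psi> \<in> carrier_mat a b"
    "\<And>k. k \<in> T \<Longrightarrow> \<omega> k \<in> carrier_mat a b" "lincomb_of a b T g \<omega> \<Psi>"
  shows "lincomb_of a' b' T g (\<lambda>k. fold (apply_step x y) ss (\<omega> k)) (fold (apply_step x y) ss \<Psi>)"
  using assms
proof (induct ss arbitrary: a b \<Psi> \<omega>)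
  case (Cons s ss)
  obtain a1 b1 where d: "step_dims s (a, b) = (a1, b1)" by fastforce
  have v: "valid_step s (a, b)" using Cons by simp
  have "lincomb_of a' b' T g (\<lambda>k. fold (apply_step x y) ss (apply_step x y s (\<omega> k)))
      (fold (apply_step x y) ss (apply_step x y s \<Psi>))"
    by (rule Cons(1)[of a1 b1 "apply_step x y s \<Psi>" "\<lambda>k. apply_step x y s (\<omega> k)"])
      (use Cons d apply_step_carrier[OF v _ d] lincomb_of_step[OF v Cons(4,5) d Cons(6)] in auto)
  then show ?case by simp
qed simp

section \<open>Positive semidefinite matrices and two-outcome measurements\<close>

definition mat_app :: "nat \<Rightarrow> complex mat \<Rightarrow> (nat \<Rightarrow> complex) \<Rightarrow> nat \<Rightarrow> complex" where
  "mat_app n M v i = (\<Sum>j<n. M $$ (i, j) * v j)"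

lemma mat_app_add_scaled: "mat_app n M (\<lambda>k. v k + c * w k) i = mat_app n M v i + c * mat_app n M w i"
  by (simp add: mat_app_def algebra_simps sum.distrib sum_distrib_left)

lemma inner_fn_add_scaled_left: "inner_fn n (\<lambda>k. v k + c * w k) x = inner_fn n v x + cnj c * inner_fn n w x"
  by (simp add: inner_fn_def algebra_simps sum.distrib sum_distrib_left)

lemma psd_quadratic_form:
  assumes "positive_semidefinite n M"
  shows "0 \<le> Re (inner_fn n v (mat_app n M v))" "Im (inner_fn n v (mat_app n M v)) = 0"
proof -
  have M: "M \<in> carrier_mat n n" using assms by (simp add: positive_semidefinite_def)
  have "(M *\<^sub>v vec n v) \<bullet>c vec n v = inner_fn n v (mat_app n M v)"
    using M by (auto simp: scalar_prod_def atLeast0LessThan inner_fn_def mat_app_def mult.commute intro!: sum.cong)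
  moreover have "0 \<le> (M *\<^sub>v vec n v) \<bullet>c vec n v"
    using assms unfolding positive_semidefinite_def by (meson vec_carrier)
  ultimately show "0 \<le> Re (inner_fn n v (mat_app n M v))" "Im (inner_fn n v (mat_app n M v)) = 0"
    by (auto simp: less_eq_complex_def)
qed

text \<open>Polarization: since the form is real, its values at e_i + e_j make the imaginary parts
  of the two entries opposite, and its values at e_i + \<i> e_j make their real parts equal.\<close>

lemma psd_hermitian:
  assumes psd: "positive_semidefinite n M" and ij: "i < n" "j < n"
  shows "M $$ (j, i) = cnj (M $$ (i, j))"
proof -
  define e :: "nat \<Rightarrow> nat \<Rightarrow> complex" where "e i k = (if k = i then 1 else 0)" for i k
  have app: "mat_app n M (e i) k = M $$ (k, i)" if "i < n" for i k
  proof -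
    have "mat_app n M (e i) k = (\<Sum>j<n. if j = i then M $$ (k, j) else 0)"
      unfolding mat_app_def e_def by (intro sum.cong) auto
    then show ?thesis using that by simp
  qed
  have ipe: "inner_fn n (e i) w = w i" if "i < n" for i w
  proof -
    have "inner_fn n (e i) w = (\<Sum>j<n. if j = i then w j else 0)"
      unfolding inner_fn_def e_def by (intro sum.cong) auto
    then show ?thesis using that by simp
  qed
  have q: "inner_fn n (\<lambda>k. e i k + c * e j k) (mat_app n M (\<lambda>k. e i k + c * e j k)) =
      M $$ (i, i) + c * M $$ (i, j) + cnj c * (M $$ (j, i) + c * M $$ (j, j))" for c
    unfolding inner_fn_add_scaled_left using ij by (simp add: ipe mat_app_add_scaled app)
  have diag: "Im (M $$ (k, k)) = 0" if "k < n" for k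
    using psd_quadratic_form(2)[OF psd, of "e k"] that by (simp add: ipe app)
  have "Im (M $$ (i, j)) + Im (M $$ (j, i)) = 0"
    using psd_quadratic_form(2)[OF psd, of "\<lambda>k. e i k + 1 * e j k", unfolded q] diag ij by simp
  moreover have "Re (M $$ (i, j)) - Re (M $$ (j, i)) = 0"
    using psd_quadratic_form(2)[OF psd, of "\<lambda>k. e i k + \<i> * e j k", unfolded q] diag ij by simp
  ultimately show ?thesis by (simp add: complex_eq_iff)
qed

lemma povm_psd: "povm n E \<Longrightarrow> positive_semidefinite n (E z)"
  by (cases z) (auto simp: povm_def)

lemma povm_complement:
  assumes E: "povm n E" and i: "i < n"
  shows "mat_app n (E (\<not> z)) v i = v i - mat_app n (E z) v i"
proof -
  have c: "E False \<in> carrier_mat n n" "E True \<in> carrier_mat n n"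
    using E by (auto simp: povm_def positive_semidefinite_def)
  have eq: "E False $$ (i, j) + E True $$ (i, j) = (if i = j then 1 else 0)" if "j < n" for j
  proof -
    have "(E False + E True) $$ (i, j) = (if i = j then 1 else 0)"
      using E i that by (simp add: povm_def)
    then show ?thesis using c i that by simp
  qed
  have "mat_app n (E False) v i + mat_app n (E True) v i = (\<Sum>j<n. (E False $$ (i, j) + E True $$ (i, j)) * v j)"
    by (simp add: mat_app_def sum.distrib distrib_right)
  also have "\<dots> = (\<Sum>j<n. if i = j then v j else 0)" by (intro sum.cong refl) (simp add: eq)
  also have "\<dots> = v i" using i by simp
  finally show ?thesis by (cases z) (auto simp: algebra_simps)
qed

lemma hermitian_inner_fn:
  assumes "\<And>i j. i < n \<Longrightarrow> j < n \<Longrightarrow> M $$ (j, i) = cnj (M $$ (i, j))"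
  shows "inner_fn n v (mat_app n M w) = inner_fn n (mat_app n M v) w"
proof -
  have herm: "cnj (M $$ (j, i)) = M $$ (i, j)" if "i < n" "j < n" for i j
    using assms[OF that(2,1)] by simp
  have "inner_fn n v (mat_app n M w) = (\<Sum>i<n. \<Sum>j<n. cnj (v i) * M $$ (i, j) * w j)"
    by (simp add: inner_fn_def mat_app_def sum_distrib_left mult_ac)
  also have "\<dots> = (\<Sum>j<n. \<Sum>i<n. cnj (M $$ (j, i) * v i) * w j)"
    by (subst sum.swap, intro sum.cong refl) (simp add: herm)
  also have "\<dots> = inner_fn n (mat_app n M v) w" by (simp add: inner_fn_def mat_app_def sum_distrib_right)
  finally show ?thesis .
qed

text \<open>With M + G = 1 this is M - M^2 = G M G + M G M.\<close>

lemma povm_le_one: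
  assumes E: "povm n E"
  shows "norm_sq n (mat_app n (E z) v) \<le> Re (inner_fn n v (mat_app n (E z) v))"
    "Re (inner_fn n v (mat_app n (E z) v)) \<le> norm_sq n v"
proof -
  let ?M = "mat_app n (E z)" and ?G = "mat_app n (E (\<not> z))"
  have comp: "?G v i = v i - ?M v i" if "i < n" for v i by (rule povm_complement[OF E that])
  have herm: "inner_fn n v (?M w) = inner_fn n (?M v) w" for v w
    by (rule hermitian_inner_fn, rule psd_hermitian[OF povm_psd[OF E]])
  have sub: "?M (\<lambda>i. v i - w i) i = ?M v i - ?M w i" for v w i
    using mat_app_add_scaled[of n "E z" v "-1" w i] by simp
  have cg: "inner_fn n x (?G y) = inner_fn n x (\<lambda>i. y i - ?M y i)" for x y
    by (rule inner_fn_cong) (auto simp: comp)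
  let ?w = "\<lambda>i. v i - ?M v i"
  have "0 \<le> Re (inner_fn n ?w (?M ?w))" "0 \<le> Re (inner_fn n (?M v) (?G (?M v)))"
    by (rule psd_quadratic_form[OF povm_psd[OF E]])+
  moreover have "inner_fn n ?w (?M ?w) + inner_fn n (?M v) (?G (?M v)) = inner_fn n v (?M v) - inner_fn n (?M v) (?M v)"
    unfolding cg sub inner_fn_diff_left inner_fn_diff_right herm[of v "?M v"] by simp
  ultimately have "0 \<le> Re (inner_fn n v (?M v) - inner_fn n (?M v) (?M v))"
    by (metis add_nonneg_nonneg plus_complex.sel(1))
  then show "norm_sq n (?M v) \<le> Re (inner_fn n v (?M v))" by (simp add: inner_fn_self)
  have "0 \<le> Re (inner_fn n v (?G v))" by (rule psd_quadratic_form[OF povm_psd[OF E]])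
  then show "Re (inner_fn n v (?M v)) \<le> norm_sq n v" by (simp add: cg inner_fn_diff_right inner_fn_self)
qed

definition apply_measurement :: "measurement \<Rightarrow> input \<Rightarrow> input \<Rightarrow> bool \<Rightarrow> bipartite \<Rightarrow> bipartite" where
  "apply_measurement me x y z \<Phi> =
    (case me of AliceMeasures E \<Rightarrow> on_alice (E x z) \<Phi> | BobMeasures E \<Rightarrow> on_bob (E y z) \<Phi>)"

lemma output_prob_eq:
  "output_prob P x y z = Re (braket (final_state P x y)
     (apply_measurement (final_measurement P) x y z (final_state P x y)))"
  by (simp add: output_prob_def apply_measurement_def Let_def split: measurement.split)

lemma braket_left_mult:
  assumes "\<Phi> \<in> carrier_mat a b" "\<Psi> \<in> carrier_mat a b" "M \<in> carrier_mat a a"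
  shows "braket \<Phi> (M * \<Psi>) = (\<Sum>j<b. inner_fn a (\<lambda>i. \<Phi> $$ (i, j)) (mat_app a M (\<lambda>i. \<Psi> $$ (i, j))))"
  unfolding braket_carrier[OF assms(1)] inner_fn_def mat_app_def
  by (subst sum.swap, intro sum.cong refl) (simp add: index_mat_mult_lessThan[OF assms(3,2)])

lemma povm_carrier: "povm n E \<Longrightarrow> E z \<in> carrier_mat n n"
  using povm_psd[of n E z] by (simp add: positive_semidefinite_def)

text \<open>A measurement operator behaves like a last step that is a contraction instead of an
  isometry. Gathered in one statement, these properties can be transposed to Bob in one go.\<close>

lemma alice_measurement:
  assumes E: "povm a E" and P: "\<Phi> \<in> carrier_mat a b" "\<Psi> \<in> carrier_mat a b"
  shows "E z * \<Psi> \<in> carrier_mat a b"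
    and "norm_bounded a b \<Psi> \<kappa> \<Longrightarrow> norm_bounded a b (E z * \<Psi>) \<kappa>"
    and "braket \<Psi> (E z * \<Phi>) = cnj (braket \<Phi> (E z * \<Psi>))"
    and "0 \<le> Re (braket \<Psi> (E z * \<Psi>))" "Re (braket \<Psi> (E z * \<Psi>)) \<le> Re (braket \<Psi> \<Psi>)"
    and "(\<And>k. k \<in> T \<Longrightarrow> \<omega> k \<in> carrier_mat a b) \<Longrightarrow> lincomb_of a b T g \<omega> \<Psi> \<Longrightarrow>
      lincomb_of a b T g (\<lambda>k. E z * \<omega> k) (E z * \<Psi>)"
proof -
  have M: "E z \<in> carrier_mat a a" by (rule povm_carrier[OF E])
  note herm = psd_hermitian[OF povm_psd[OF E, of z]]
  have herm': "cnj (E z $$ (k, i)) = E z $$ (i, k)" if "i < a" "k < a" for i k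
    using herm[OF that(2,1)] by simp
  show "E z * \<Psi> \<in> carrier_mat a b" using M P(2) by (rule mult_carrier_mat)
  show "norm_bounded a b (E z * \<Psi>) \<kappa>" if N: "norm_bounded a b \<Psi> \<kappa>"
  proof (rule norm_bounded_left_mult[OF M P(2) N])
    fix \<alpha> assume \<alpha>: "norm_sq a \<alpha> \<le> 1"
    \<comment> \<open>Acting from the left on \<alpha> is, up to conjugation, acting on the
      conjugate of \<alpha>, because \<open>E z\<close> is hermitian; contractivity then follows
      from \<open>povm_le_one\<close>.\<close>
    have "(\<Sum>i<a. \<alpha> i * E z $$ (i, k)) = cnj (mat_app a (E z) (\<lambda>i. cnj (\<alpha> i)) k)" if "k < a" for k
      unfolding mat_app_def cnj_sum using that by (intro sum.cong refl) (simp add: herm' mult.commute)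
    then have "norm_sq a (\<lambda>k. \<Sum>i<a. \<alpha> i * E z $$ (i, k)) = norm_sq a (mat_app a (E z) (\<lambda>i. cnj (\<alpha> i)))"
      by (simp add: norm_sq_def)
    also have "\<dots> \<le> norm_sq a (\<lambda>i. cnj (\<alpha> i))" using povm_le_one[OF E] by (rule order_trans)
    finally show "norm_sq a (\<lambda>k. \<Sum>i<a. \<alpha> i * E z $$ (i, k)) \<le> 1" using \<alpha> by (simp add: norm_sq_def)
  qed
  show "braket \<Psi> (E z * \<Phi>) = cnj (braket \<Phi> (E z * \<Psi>))"
    unfolding braket_left_mult[OF P M] braket_left_mult[OF P(2,1) M] cnj_sum
    by (intro sum.cong refl) (subst hermitian_inner_fn[OF herm], auto intro: inner_fn_commute)
  show "0 \<le> Re (braket \<Psi> (E z * \<Psi>))"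
    unfolding braket_left_mult[OF P(2,2) M] Re_sum
    by (intro sum_nonneg psd_quadratic_form povm_psd[OF E])
  have "braket \<Psi> \<Psi> = (\<Sum>j<b. complex_of_real (norm_sq a (\<lambda>i. \<Psi> $$ (i, j))))"
    unfolding braket_carrier[OF P(2)] inner_fn_self[symmetric] inner_fn_def by (rule sum.swap)
  then show "Re (braket \<Psi> (E z * \<Psi>)) \<le> Re (braket \<Psi> \<Psi>)"
    unfolding braket_left_mult[OF P(2,2) M] by (simp add: sum_mono povm_le_one(2)[OF E])
  show "lincomb_of a b T g (\<lambda>k. E z * \<omega> k) (E z * \<Psi>)"
    if "\<And>k. k \<in> T \<Longrightarrow> \<omega> k \<in> carrier_mat a b" "lincomb_of a b T g \<omega> \<Psi>"
    by (rule lincomb_of_left_mult[OF M P(2) that])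
qed

lemma measurement_props:
  fixes x y :: input and z :: bool
  assumes v: "valid_measurement me (a, b)" and P: "\<Phi> \<in> carrier_mat a b" "\<Psi> \<in> carrier_mat a b"
  defines "A \<equiv> apply_measurement me x y z"
  shows "A \<Psi> \<in> carrier_mat a b"
    and "norm_bounded a b \<Psi> \<kappa> \<Longrightarrow> norm_bounded a b (A \<Psi>) \<kappa>"
    and "braket \<Psi> (A \<Phi>) = cnj (braket \<Phi> (A \<Psi>))"
    and "0 \<le> Re (braket \<Psi> (A \<Psi>))" "Re (braket \<Psi> (A \<Psi>)) \<le> Re (braket \<Psi> \<Psi>)"
    and "(\<And>k. k \<in> T \<Longrightarrow> \<omega> k \<in> carrier_mat a b) \<Longrightarrow> lincomb_of a b T g \<omega> \<Psi> \<Longrightarrow>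
      lincomb_of a b T g (\<lambda>k. A (\<omega> k)) (A \<Psi>)"
proof -
  have "A \<Psi> \<in> carrier_mat a b \<and> (norm_bounded a b \<Psi> \<kappa> \<longrightarrow> norm_bounded a b (A \<Psi>) \<kappa>) \<and>
    braket \<Psi> (A \<Phi>) = cnj (braket \<Phi> (A \<Psi>)) \<and> 0 \<le> Re (braket \<Psi> (A \<Psi>)) \<and>
    Re (braket \<Psi> (A \<Psi>)) \<le> Re (braket \<Psi> \<Psi>) \<and>
    ((\<forall>k\<in>T. \<omega> k \<in> carrier_mat a b) \<longrightarrow> lincomb_of a b T g \<omega> \<Psi> \<longrightarrow> lincomb_of a b T g (\<lambda>k. A (\<omega> k)) (A \<Psi>))"
  proof (cases me)
    case (AliceMeasures E)
    then have E: "povm a (E x)" using v by simp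
    show ?thesis using alice_measurement[OF E P, where z = z]
      by (auto simp: A_def apply_measurement_def AliceMeasures on_alice_def)
  next
    case (BobMeasures E)
    then have E: "povm b (E y)" using v by simp
    have M: "E y z \<in> carrier_mat b b" by (rule povm_carrier[OF E])
    have A: "A \<Xi> = transpose_mat (E y z * transpose_mat \<Xi>)" if "\<Xi> \<in> carrier_mat a b" for \<Xi>
    proof -
      have "transpose_mat \<Xi> \<in> carrier_mat b a" using that by simp
      from transpose_mult[OF M this] show ?thesis
        by (simp add: A_def apply_measurement_def BobMeasures on_bob_def)
    qed
    have Pt: "transpose_mat \<Phi> \<in> carrier_mat b a" "transpose_mat \<Psi> \<in> carrier_mat b a" using P by auto
    note am = alice_measurement[OF E Pt, where z = z]
    have bt: "braket \<Xi> (A \<Theta>) = braket (transpose_mat \<Xi>) (E y z * transpose_mat \<Theta>)"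
      if "\<Xi> \<in> carrier_mat a b" "\<Theta> \<in> carrier_mat a b" for \<Xi> \<Theta>
    proof -
      have "E y z * transpose_mat \<Theta> \<in> carrier_mat b a" using M that by simp
      then show ?thesis unfolding A[OF that(2)]
        by (subst braket_transpose[of "transpose_mat \<Xi>" b a, symmetric]) (use that in auto)
    qed
    have "lincomb_of a b T g (\<lambda>k. A (\<omega> k)) (A \<Psi>)"
      if \<omega>: "\<forall>k\<in>T. \<omega> k \<in> carrier_mat a b" and lc: "lincomb_of a b T g \<omega> \<Psi>"
    proof -
      have "transpose_mat (E y z) \<in> carrier_mat b b" using M by simp
      from lincomb_of_right_mult[OF this P(2) _ lc] \<omega> show ?thesis
        by (simp add: A_def apply_measurement_def BobMeasures on_bob_def)
    qed
    moreover have "norm_bounded a b (A \<Psi>) \<kappa>" if "norm_bounded a b \<Psi> \<kappa>"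
      using am(2)[of \<kappa>] that norm_bounded_transpose[OF P(2)] norm_bounded_transpose[OF am(1)] by (simp add: A[OF P(2)])
    moreover have "A \<Psi> \<in> carrier_mat a b" using am(1) by (simp add: A[OF P(2)])
    moreover have "braket \<Psi> (A \<Phi>) = cnj (braket \<Phi> (A \<Psi>))" unfolding bt[OF P] bt[OF P(2,1)] by (rule am(3))
    moreover have "0 \<le> Re (braket \<Psi> (A \<Psi>))" unfolding bt[OF P(2,2)] by (rule am(4))
    moreover have "Re (braket \<Psi> (A \<Psi>)) \<le> Re (braket \<Psi> \<Psi>)"
      unfolding bt[OF P(2,2)] braket_transpose[OF P(2,2), symmetric] by (rule am(5))
    ultimately show ?thesis by blast
  qed
  then show "A \<Psi> \<in> carrier_mat a b"
    and "norm_bounded a b \<Psi> \<kappa> \<Longrightarrow> norm_bounded a b (A \<Psi>) \<kappa>"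
    and "braket \<Psi> (A \<Phi>) = cnj (braket \<Phi> (A \<Psi>))"
    and "0 \<le> Re (braket \<Psi> (A \<Psi>))" "Re (braket \<Psi> (A \<Psi>)) \<le> Re (braket \<Psi> \<Psi>)"
    and "(\<And>k. k \<in> T \<Longrightarrow> \<omega> k \<in> carrier_mat a b) \<Longrightarrow> lincomb_of a b T g \<omega> \<Psi> \<Longrightarrow>
      lincomb_of a b T g (\<lambda>k. A (\<omega> k)) (A \<Psi>)" by blast+
qed

section \<open>Response to pairs of Schmidt terms\<close>

lemma sum_rotate:
  "(\<Sum>i\<in>A. \<Sum>j\<in>B. \<Sum>k\<in>C. f i j k) = (\<Sum>k\<in>C. \<Sum>i\<in>A. \<Sum>j\<in>B. f i j k)"
proof -
  have "(\<Sum>i\<in>A. \<Sum>j\<in>B. \<Sum>k\<in>C. f i j k) = (\<Sum>i\<in>A. \<Sum>k\<in>C. \<Sum>j\<in>B. f i j k)"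
    by (intro sum.cong refl sum.swap)
  also have "\<dots> = (\<Sum>k\<in>C. \<Sum>i\<in>A. \<Sum>j\<in>B. f i j k)" by (rule sum.swap)
  finally show ?thesis .
qed

lemma braket_lincomb_left:
  assumes "\<Phi> \<in> carrier_mat a b" "\<And>k. k \<in> T \<Longrightarrow> \<omega> k \<in> carrier_mat a b" "lincomb_of a b T g \<omega> \<Phi>"
  shows "braket \<Phi> \<Psi> = (\<Sum>k\<in>T. cnj (g k) * braket (\<omega> k) \<Psi>)"
proof -
  have "braket \<Phi> \<Psi> = (\<Sum>i<a. \<Sum>j<b. \<Sum>k\<in>T. cnj (g k) * (cnj (\<omega> k $$ (i, j)) * \<Psi> $$ (i, j)))"
    unfolding braket_carrier[OF assms(1)] using assms(3)
    by (intro sum.cong refl) (simp add: lincomb_of_def sum_distrib_left sum_distrib_right mult_ac)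
  also have "\<dots> = (\<Sum>k\<in>T. \<Sum>i<a. \<Sum>j<b. cnj (g k) * (cnj (\<omega> k $$ (i, j)) * \<Psi> $$ (i, j)))"
    by (rule sum_rotate)
  also have "\<dots> = (\<Sum>k\<in>T. cnj (g k) * braket (\<omega> k) \<Psi>)"
    by (intro sum.cong refl) (simp add: braket_carrier[OF assms(2)] sum_distrib_left)
  finally show ?thesis .
qed

lemma braket_commute:
  assumes "\<Phi> \<in> carrier_mat a b" "\<Psi> \<in> carrier_mat a b"
  shows "braket \<Phi> \<Psi> = cnj (braket \<Psi> \<Phi>)"
  unfolding braket_carrier[OF assms(1)] braket_carrier[OF assms(2)] by (simp add: mult.commute)

lemma braket_lincomb_right:
  assumes "\<Phi> \<in> carrier_mat a b" "\<Psi> \<in> carrier_mat a b" "\<And>k. k \<in> T \<Longrightarrow> \<omega> k \<in> carrier_mat a b" "lincomb_of a b T g \<omega> \<Psi>"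
  shows "braket \<Phi> \<Psi> = (\<Sum>k\<in>T. g k * braket \<Phi> (\<omega> k))"
proof -
  have "braket \<Phi> \<Psi> = cnj (\<Sum>k\<in>T. cnj (g k) * braket (\<omega> k) \<Phi>)"
    by (subst braket_commute[OF assms(1,2)], subst braket_lincomb_left[OF assms(2-4)]) simp_all
  also have "\<dots> = (\<Sum>k\<in>T. g k * braket \<Phi> (\<omega> k))"
    unfolding cnj_sum using braket_commute[OF assms(1) assms(3)] by (intro sum.cong refl) simp
  finally show ?thesis .
qed

text \<open>Duality of term count and operator norm: each product term is a pair of test vectors for
  \<open>G\<close>.\<close>

lemma braket_product_sum:
  assumes P: "\<Phi> \<in> carrier_mat a b" and ps: "product_sum a b m \<Phi>" and N: "norm_bounded a b G \<kappa>"
  shows "cmod (braket \<Phi> G) \<le> m * \<kappa>"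
proof -
  from ps obtain p q where pq: "\<And>t. t < m \<Longrightarrow> norm_sq a (p t) \<le> 1" "\<And>t. t < m \<Longrightarrow> norm_sq b (q t) \<le> 1"
    and eq: "\<And>i j. i < a \<Longrightarrow> j < b \<Longrightarrow> \<Phi> $$ (i, j) = (\<Sum>t<m. p t i * q t j)"
    unfolding product_sum_def by blast
  have "braket \<Phi> G = (\<Sum>i<a. \<Sum>j<b. \<Sum>t<m. cnj (p t i) * G $$ (i, j) * cnj (q t j))"
    unfolding braket_carrier[OF P] by (intro sum.cong refl) (simp add: eq sum_distrib_left sum_distrib_right mult_ac)
  also have "\<dots> = (\<Sum>t<m. \<Sum>i<a. \<Sum>j<b. cnj (p t i) * G $$ (i, j) * cnj (q t j))"
    by (rule sum_rotate)
  also have "cmod \<dots> \<le> (\<Sum>t<m. \<kappa>)"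
  proof (rule sum_norm_le)
    fix t assume "t \<in> {..<m}"
    then show "cmod (\<Sum>i<a. \<Sum>j<b. cnj (p t i) * G $$ (i, j) * cnj (q t j)) \<le> \<kappa>"
      using N[unfolded norm_bounded_def, rule_format, of "\<lambda>i. cnj (p t i)" "\<lambda>j. cnj (q t j)"] pq[of t]
      by (simp add: norm_sq_def)
  qed
  finally show ?thesis by simp
qed

definition product_state :: "nat \<Rightarrow> nat \<Rightarrow> (nat \<Rightarrow> complex) \<Rightarrow> (nat \<Rightarrow> complex) \<Rightarrow> bipartite" where
  "product_state a b u v = mat a b (\<lambda>(i, j). u i * v j)"

lemma product_state_carrier [simp]: "product_state a b u v \<in> carrier_mat a b"
  by (simp add: product_state_def)

lemma braket_product_state:
  "braket (product_state a b u v) (product_state a b u' v') = inner_fn a u u' * inner_fn b v v'"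
  unfolding braket_carrier[OF product_state_carrier] inner_fn_def
  by (simp add: product_state_def sum_product mult_ac)

text \<open>The sesquilinear form of a whole protocol with its measurement. Schmidt coefficients are
  real, so its real part suffices to express output probabilities.\<close>

definition response :: "step list \<Rightarrow> measurement \<Rightarrow> input \<Rightarrow> input \<Rightarrow> bool \<Rightarrow> bipartite \<Rightarrow> bipartite \<Rightarrow> real" where
  "response ss me x y z \<Phi> \<Psi> =
    Re (braket (fold (apply_step x y) ss \<Phi>) (apply_measurement me x y z (fold (apply_step x y) ss \<Psi>)))"

lemma output_prob_response:
  "output_prob P x y z = response (steps P) (final_measurement P) x y z (resource P) (resource P)"
  by (simp add: output_prob_eq response_def final_state_def)

context
  fixes ss :: "step list" and me :: measurement and x y :: input and z :: bool and a b a' b' :: nat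
  assumes v: "valid_steps ss (a, b)" and d: "fold step_dims ss (a, b) = (a', b')"
    and vm: "valid_measurement me (a', b')"
begin

lemma response_lincomb:
  assumes P: "\<Phi> \<in> carrier_mat a b" "\<Psi> \<in> carrier_mat a b"
    and \<omega>: "\<And>k. k \<in> S \<Longrightarrow> \<omega> k \<in> carrier_mat a b" "\<And>k. k \<in> T \<Longrightarrow> \<chi> k \<in> carrier_mat a b"
    and lc: "lincomb_of a b S (\<lambda>k. of_real (g k)) \<omega> \<Phi>"
      "lincomb_of a b T (\<lambda>k. of_real (h k)) \<chi> \<Psi>"
  shows "response ss me x y z \<Phi> \<Psi> = (\<Sum>i\<in>S. \<Sum>j\<in>T. g i * h j * response ss me x y z (\<omega> i) (\<chi> j))"
proof -
  let ?F = "fold (apply_step x y) ss" and ?A = "apply_measurement me x y z"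
  note c = fold_carrier[OF v d, of _ x y]
  have A: "?A (?F \<Xi>) \<in> carrier_mat a' b'" if "\<Xi> \<in> carrier_mat a b" for \<Xi>
    by (rule measurement_props(1)[OF vm c[OF that] c[OF that]])
  have "braket (?F \<Phi>) (?A (?F \<Psi>)) = (\<Sum>i\<in>S. cnj (of_real (g i)) * braket (?F (\<omega> i)) (?A (?F \<Psi>)))"
    by (rule braket_lincomb_left[OF c[OF P(1)] c[OF \<omega>(1)] fold_lincomb_of[OF v d P(1) \<omega>(1) lc(1)]])
  also have "\<dots> = (\<Sum>i\<in>S. of_real (g i) * (\<Sum>j\<in>T. of_real (h j) * braket (?F (\<omega> i)) (?A (?F (\<chi> j)))))"
  proof (rule sum.cong[OF refl])
    fix i assume i: "i \<in> S"
    have "braket (?F (\<omega> i)) (?A (?F \<Psi>)) = (\<Sum>j\<in>T. of_real (h j) * braket (?F (\<omega> i)) (?A (?F (\<chi> j))))"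
    proof (rule braket_lincomb_right[OF c[OF \<omega>(1)[OF i]] A[OF P(2)] A[OF \<omega>(2)]])
      show "lincomb_of a' b' T (\<lambda>k. of_real (h k)) (\<lambda>k. ?A (?F (\<chi> k))) (?A (?F \<Psi>))"
        by (rule measurement_props(6)[OF vm c[OF P(2)] c[OF P(2)] c[OF \<omega>(2)]
              fold_lincomb_of[OF v d P(2) \<omega>(2) lc(2)]])
    qed
    then show "cnj (of_real (g i)) * braket (?F (\<omega> i)) (?A (?F \<Psi>)) =
        of_real (g i) * (\<Sum>j\<in>T. of_real (h j) * braket (?F (\<omega> i)) (?A (?F (\<chi> j))))" by simp
  qed
  finally show ?thesis
    by (simp add: response_def Re_sum sum_distrib_left mult.assoc)
qed

text \<open>The measurement bounds the value by the squared norm of the state measured, and the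
  steps preserve that norm. Unnormalized states are included, as the blocks of a larger state are of
  this kind.\<close>

lemma response_bounds:
  assumes "\<Phi> \<in> carrier_mat a b"
  shows "0 \<le> response ss me x y z \<Phi> \<Phi>" "response ss me x y z \<Phi> \<Phi> \<le> Re (braket \<Phi> \<Phi>)"
  unfolding response_def fold_braket[OF v assms assms, of x y, symmetric]
  by (rule measurement_props[OF vm fold_carrier[OF v d assms] fold_carrier[OF v d assms]])+

end

section \<open>Superpositions of Schmidt terms\<close>

definition superposition :: "nat \<Rightarrow> nat \<Rightarrow> (nat \<Rightarrow> nat \<Rightarrow> complex) \<Rightarrow> (nat \<Rightarrow> nat \<Rightarrow> complex) \<Rightarrow>
    nat set \<Rightarrow> (nat \<Rightarrow> real) \<Rightarrow> bipartite" where
  "superposition a b u w T h = mat a b (\<lambda>(i, j). \<Sum>k\<in>T. of_real (h k) * u k i * w k j)"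

lemma superposition_carrier [simp]: "superposition a b u w T h \<in> carrier_mat a b"
  by (simp add: superposition_def)

lemma superposition_lincomb:
  "lincomb_of a b T (\<lambda>k. of_real (h k)) (\<lambda>k. product_state a b (u k) (w k)) (superposition a b u w T h)"
  by (simp add: lincomb_of_def superposition_def product_state_def mult_ac)

context
  fixes a b r :: nat and u w :: "nat \<Rightarrow> nat \<Rightarrow> complex"
  assumes on: "orthonormal a r u" "orthonormal b r w"
begin

abbreviation "schmidt_term \<equiv> \<lambda>k. product_state a b (u k) (w k)"

lemma braket_superposition:
  assumes T: "T \<subseteq> {..<r}"
  shows "braket (superposition a b u w T h) (superposition a b u w T h) = complex_of_real (\<Sum>k\<in>T. (h k)\<^sup>2)"
proof -
  have fin: "finite T" using T finite_subset by blast
  have "braket (superposition a b u w T h) (superposition a b u w T h) =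
      (\<Sum>k\<in>T. cnj (of_real (h k)) * (\<Sum>l\<in>T. of_real (h l) * braket (schmidt_term k) (schmidt_term l)))"
    by (subst braket_lincomb_left[OF superposition_carrier product_state_carrier superposition_lincomb],
        subst braket_lincomb_right[OF product_state_carrier superposition_carrier product_state_carrier superposition_lincomb])
      simp_all
  also have "\<dots> = (\<Sum>k\<in>T. complex_of_real ((h k)\<^sup>2))"
  proof (rule sum.cong[OF refl])
    fix k assume k: "k \<in> T"
    have "(\<Sum>l\<in>T. of_real (h l) * braket (schmidt_term k) (schmidt_term l)) =
        (\<Sum>l\<in>T. if k = l then of_real (h l) else 0)"
      using on T k by (intro sum.cong refl) (auto simp: braket_product_state orthonormal_def subset_iff)
    then show "cnj (of_real (h k)) * (\<Sum>l\<in>T. of_real (h l) * braket (schmidt_term k) (schmidt_term l)) =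
        complex_of_real ((h k)\<^sup>2)" using k fin by (simp add: power2_eq_square)
  qed
  finally show ?thesis by simp
qed

text \<open>The operator norm of a Schmidt sum is its largest coefficient: the products of
  components of the test vectors are split by the inequality of means, and each half is summed by
  Bessel's inequality.\<close>

lemma norm_bounded_superposition:
  assumes T: "T \<subseteq> {..<r}" and h: "\<And>k. k \<in> T \<Longrightarrow> \<bar>h k\<bar> \<le> \<tau>" and \<tau>: "0 \<le> \<tau>"
  shows "norm_bounded a b (superposition a b u w T h) \<tau>"
  unfolding norm_bounded_def
proof (intro allI impI)
  fix \<alpha> \<beta> assume ab: "norm_sq a \<alpha> \<le> 1" "norm_sq b \<beta> \<le> 1"
  define A where "A k = inner_fn a (u k) (\<lambda>i. cnj (\<alpha> i))" for k
  define B where "B k = inner_fn b (w k) (\<lambda>j. cnj (\<beta> j))" for k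
  have "(\<Sum>i<a. \<Sum>j<b. \<alpha> i * superposition a b u w T h $$ (i, j) * \<beta> j) =
     (\<Sum>i<a. \<Sum>j<b. \<Sum>k\<in>T. of_real (h k) * ((\<alpha> i * u k i) * (\<beta> j * w k j)))"
    by (intro sum.cong refl) (simp add: superposition_def sum_distrib_left sum_distrib_right mult_ac)
  also have "\<dots> = (\<Sum>k\<in>T. \<Sum>i<a. \<Sum>j<b. of_real (h k) * ((\<alpha> i * u k i) * (\<beta> j * w k j)))"
    by (rule sum_rotate)
  also have "\<dots> = (\<Sum>k\<in>T. of_real (h k) * (cnj (A k) * cnj (B k)))"
  proof (rule sum.cong[OF refl])
    fix k
    have "cnj (A k) = (\<Sum>i<a. \<alpha> i * u k i)" "cnj (B k) = (\<Sum>j<b. \<beta> j * w k j)"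
      by (simp_all add: A_def B_def inner_fn_def mult.commute)
    then have "cnj (A k) * cnj (B k) = (\<Sum>i<a. \<Sum>j<b. (\<alpha> i * u k i) * (\<beta> j * w k j))"
      by (simp only: sum_product)
    then show "(\<Sum>i<a. \<Sum>j<b. of_real (h k) * ((\<alpha> i * u k i) * (\<beta> j * w k j)))
        = of_real (h k) * (cnj (A k) * cnj (B k))"
      by (simp only: sum_distrib_left)
  qed
  also have "cmod \<dots> \<le> (\<Sum>k\<in>T. \<tau> * (((cmod (A k))\<^sup>2 + (cmod (B k))\<^sup>2) / 2))"
  proof (rule sum_norm_le)
    fix k assume k: "k \<in> T"
    have "2 * (cmod (A k) * cmod (B k)) \<le> (cmod (A k))\<^sup>2 + (cmod (B k))\<^sup>2"
      using sum_squares_bound[of "cmod (A k)" "cmod (B k)"] by (simp add: mult.assoc)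
    then have "\<bar>h k\<bar> * (cmod (A k) * cmod (B k)) \<le> \<tau> * (((cmod (A k))\<^sup>2 + (cmod (B k))\<^sup>2) / 2)"
      using h[OF k] \<tau> by (intro mult_mono) auto
    then show "cmod (of_real (h k) * (cnj (A k) * cnj (B k))) \<le> \<tau> * (((cmod (A k))\<^sup>2 + (cmod (B k))\<^sup>2) / 2)"
      by (simp add: norm_mult)
  qed
  also have "\<dots> = \<tau> * (((\<Sum>k\<in>T. (cmod (A k))\<^sup>2) + (\<Sum>k\<in>T. (cmod (B k))\<^sup>2)) / 2)"
    by (simp add: sum.distrib flip: sum_distrib_left sum_divide_distrib)
  also have "\<dots> \<le> \<tau> * ((1 + 1) / 2)"
  proof (intro mult_left_mono divide_right_mono add_mono \<tau>)
    have "norm_sq a (\<lambda>i. cnj (\<alpha> i)) \<le> 1" "norm_sq b (\<lambda>j. cnj (\<beta> j)) \<le> 1" using ab by (simp_all add: norm_sq_def)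
    then show "(\<Sum>k\<in>T. (cmod (A k))\<^sup>2) \<le> 1" "(\<Sum>k\<in>T. (cmod (B k))\<^sup>2) \<le> 1"
      unfolding A_def B_def using bessel[OF on(1) T] bessel[OF on(2) T] order_trans by blast+
  qed simp
  finally show "cmod (\<Sum>i<a. \<Sum>j<b. \<alpha> i * superposition a b u w T h $$ (i, j) * \<beta> j) \<le> \<tau>" by simp
qed

context
  fixes ss :: "step list" and me :: measurement and x y :: input and z :: bool and a' b' :: nat
  assumes v: "valid_steps ss (a, b)" and d: "fold step_dims ss (a, b) = (a', b')"
    and vm: "valid_measurement me (a', b')"
begin

abbreviation "schmidt_response \<equiv> \<lambda>i j. response ss me x y z (schmidt_term i) (schmidt_term j)"

lemma response_superposition:
  "response ss me x y z (superposition a b u w S g) (superposition a b u w T h) =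
     (\<Sum>i\<in>S. \<Sum>j\<in>T. g i * h j * schmidt_response i j)"
  by (rule response_lincomb[OF v d vm superposition_carrier superposition_carrier _ _
        superposition_lincomb superposition_lincomb]) simp_all

text \<open>Symmetry comes from the hermitian measurement operator. A value of the quadratic form is
  the response of a superposition to itself, and the sum of the squared coefficients is the squared
  norm of that superposition.\<close>

lemma subunit_schmidt_response: "subunit_form r schmidt_response"
proof -
  have "schmidt_response i j = schmidt_response j i" for i j
  proof -
    note c = fold_carrier[OF v d product_state_carrier, of x y]
    show ?thesis unfolding response_def
      by (subst measurement_props(3)[OF vm c c]) simp
  qed
  moreover have "qform r schmidt_response h = response ss me x y z (superposition a b u w {..<r} h) (superposition a b u w {..<r} h)" for h
    unfolding qform_def response_superposition ..
  ultimately show ?thesis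
    unfolding subunit_form_def
    using response_bounds[OF v d vm superposition_carrier[of a b u w "{..<r}"]] braket_superposition[of "{..<r}"] by simp
qed

text \<open>A message of n qubits splits a product state into 2^n product terms and increases the operator
  norm of an amplitude matrix at most 2^n-fold; the pairing of the two is thus small when one
  state has large Schmidt coefficients and the other one has small ones.\<close>

lemma low_rank_schmidt_response:
  assumes \<sigma>: "\<And>k. k < r \<Longrightarrow> 0 \<le> \<sigma> k"
  shows "low_rank_form r (4 ^ length (filter is_send ss)) \<sigma> schmidt_response"
  unfolding low_rank_form_def
proof (intro allI impI)
  fix S T \<tau> assume S: "S \<subseteq> {..<r}" and T: "T \<subseteq> {..<r}" and \<sigma>\<tau>: "\<forall>j\<in>T. \<sigma> j \<le> \<tau>" and \<tau>: "(0 :: real) \<le> \<tau>"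
  let ?n = "length (filter is_send ss)"
  let ?F = "fold (apply_step x y) ss" and ?A = "apply_measurement me x y z"
  let ?D = "superposition a b u w T \<sigma>"
  have D: "?F ?D \<in> carrier_mat a' b'" by (rule fold_carrier[OF v d superposition_carrier])
  have "norm_bounded a b ?D \<tau>"
    by (rule norm_bounded_superposition[OF T _ \<tau>]) (use \<sigma> \<sigma>\<tau> T in auto)
  from fold_norm_bounded[OF v d superposition_carrier this]
  have N: "norm_bounded a' b' (?A (?F ?D)) (2 ^ ?n * \<tau>)"
    by (rule measurement_props(2)[OF vm D D])
  \<comment> \<open>The terms of \<open>S\<close> enter singly, as product states, while those of
    \<open>T\<close> enter as one superposition. The factor 4^n is 2^n product terms times a
    2^n-fold growth of the operator norm.\<close>
  have resp: "\<bar>response ss me x y z (schmidt_term i) ?D\<bar> \<le> 4 ^ ?n * \<tau>" if "i \<in> S" for i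
  proof -
    have "complex_of_real (norm_sq a (u i)) = 1" "complex_of_real (norm_sq b (w i)) = 1"
      using on that S by (auto simp: orthonormal_def inner_fn_self[symmetric])
    then have "norm_sq a (u i) = 1" "norm_sq b (w i) = 1" by simp_all
    then have "product_sum a b 1 (schmidt_term i)"
      unfolding product_sum_def product_state_def by (intro exI[of _ "\<lambda>_. u i"] exI[of _ "\<lambda>_. w i"]) simp
    from fold_product_sum[OF v d product_state_carrier this, of x y]
    have "product_sum a' b' (2 ^ ?n) (?F (schmidt_term i))" by simp
    from braket_product_sum[OF fold_carrier[OF v d product_state_carrier] this N]
    have "cmod (braket (?F (schmidt_term i)) (?A (?F ?D))) \<le> (2 ^ ?n * 2 ^ ?n) * \<tau>"
      by (simp add: mult.assoc)
    moreover have "(2 ^ ?n * 2 ^ ?n :: real) = 4 ^ ?n" by (simp flip: power_mult_distrib)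
    ultimately have "cmod (braket (?F (schmidt_term i)) (?A (?F ?D))) \<le> 4 ^ ?n * \<tau>" by simp
    then show ?thesis unfolding response_def using abs_Re_le_cmod order_trans by fastforce
  qed
  have "(\<Sum>i\<in>S. \<Sum>j\<in>T. \<sigma> i * \<sigma> j * schmidt_response i j) = (\<Sum>i\<in>S. \<sigma> i * response ss me x y z (schmidt_term i) ?D)"
  proof (rule sum.cong[OF refl])
    fix i assume "i \<in> S"
    have "response ss me x y z (schmidt_term i) ?D = (\<Sum>k\<in>{i}. \<Sum>j\<in>T. 1 * \<sigma> j * schmidt_response k j)"
      by (rule response_lincomb[OF v d vm product_state_carrier superposition_carrier product_state_carrier
            product_state_carrier _ superposition_lincomb]) (simp add: lincomb_of_def)
    then show "(\<Sum>j\<in>T. \<sigma> i * \<sigma> j * schmidt_response i j) = \<sigma> i * response ss me x y z (schmidt_term i) ?D"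
      by (simp add: sum_distrib_left mult.assoc)
  qed
  also have "\<bar>\<dots>\<bar> \<le> (\<Sum>i\<in>S. \<sigma> i * (4 ^ ?n * \<tau>))"
  proof (rule order_trans[OF sum_abs], rule sum_mono)
    fix i assume i: "i \<in> S"
    then have "0 \<le> \<sigma> i" using \<sigma> S by auto
    then show "\<bar>\<sigma> i * response ss me x y z (schmidt_term i) ?D\<bar> \<le> \<sigma> i * (4 ^ ?n * \<tau>)"
      using resp[OF i] by (simp add: abs_mult mult_left_mono)
  qed
  also have "\<dots> = 4 ^ ?n * (\<Sum>i\<in>S. \<sigma> i) * \<tau>" by (simp add: sum_distrib_left sum_distrib_right mult_ac)
  finally show "\<bar>\<Sum>i\<in>S. \<Sum>j\<in>T. \<sigma> i * \<sigma> j * schmidt_response i j\<bar> \<le> 4 ^ ?n * (\<Sum>i\<in>S. \<sigma> i) * \<tau>" .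
qed

end

end

section \<open>Running a protocol on blocks\<close>

definition tensor :: "nat \<Rightarrow> (nat \<Rightarrow> complex) \<Rightarrow> (nat \<Rightarrow> complex) \<Rightarrow> nat \<Rightarrow> complex" where
  "tensor n x y i = x (i div n) * y (i mod n)"

definition basis_fn :: "nat \<Rightarrow> nat \<Rightarrow> complex" where
  "basis_fn e i = (if i = e then 1 else 0)"

lemma tensor_at [simp]: "j < n \<Longrightarrow> tensor n x y (i * n + j) = x i * y j"
  by (simp add: tensor_def)

lemma inner_fn_tensor: "inner_fn (m * n) (tensor n x y) (tensor n x' y') = inner_fn m x x' * inner_fn n y y'"
proof -
  have "inner_fn (m * n) (tensor n x y) (tensor n x' y') = (\<Sum>i<m. \<Sum>j<n. (cnj (x i) * x' i) * (cnj (y j) * y' j))"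
    unfolding inner_fn_def sum_lessThan_mult by (intro sum.cong refl) (simp add: mult_ac)
  then show ?thesis by (simp add: inner_fn_def sum_product)
qed

lemma inner_fn_basis_fn:
  assumes "e < m"
  shows "inner_fn m (basis_fn e) x = x e"
proof -
  have "inner_fn m (basis_fn e) x = (\<Sum>i<m. if i = e then x i else 0)"
    unfolding inner_fn_def basis_fn_def by (intro sum.cong) auto
  then show ?thesis using assms by simp
qed

lemma orthonormal_basis_fn:
  "(\<And>e. e < p \<Longrightarrow> c + e < m) \<Longrightarrow> orthonormal m p (\<lambda>e. basis_fn (c + e))"
  unfolding orthonormal_def by (auto simp: inner_fn_basis_fn) (auto simp: basis_fn_def)

lemma orthonormal_tensor:
  assumes "orthonormal m p x" "orthonormal n q y"
  shows "orthonormal (m * n) (p * q) (\<lambda>k. tensor n (x (k div q)) (y (k mod q)))"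
  unfolding orthonormal_def
proof (intro allI impI)
  fix k l assume kl: "k < p * q" "l < p * q"
  then have "0 < q" by (cases q) auto
  then have "k div q < p" "l div q < p" "k mod q < q" "l mod q < q"
    using kl by (auto simp: less_mult_imp_div_less)
  moreover have "k = l \<longleftrightarrow> k div q = l div q \<and> k mod q = l mod q"
    by (metis div_mult_mod_eq)
  ultimately show "inner_fn (m * n) (tensor n (x (k div q)) (y (k mod q))) (tensor n (x (l div q)) (y (l mod q))) = (if k = l then 1 else 0)"
    using assms by (auto simp: inner_fn_tensor orthonormal_def)
qed

lemma orthonormal_cong:
  assumes "orthonormal n r u" "\<And>k i. k < r \<Longrightarrow> i < n \<Longrightarrow> u k i = u' k i"
  shows "orthonormal n r u'"
  unfolding orthonormal_def
proof (intro allI impI)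
  fix k l assume "k < r" "l < r"
  then have "inner_fn n (u' k) (u' l) = inner_fn n (u k) (u l)" using assms(2) by (intro inner_fn_cong) auto
  then show "inner_fn n (u' k) (u' l) = (if k = l then 1 else 0)"
    using assms(1) \<open>k < r\<close> \<open>l < r\<close> by (simp add: orthonormal_def)
qed

text \<open>The identity on an m-dimensional label, tensored with \<open>U\<close>. The label is
  most significant, so that ancillas and sent qubits, which concern the last factor, leave it
  alone.\<close>

definition inflate :: "nat \<Rightarrow> nat \<Rightarrow> complex mat \<Rightarrow> complex mat" where
  "inflate m n U = mat (m * n) (m * n) (\<lambda>(i, j). if i div n = j div n then U $$ (i mod n, j mod n) else 0)"

lemma inflate_carrier [simp]: "inflate m n U \<in> carrier_mat (m * n) (m * n)"
  by (simp add: inflate_def)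

lemma block_index_less: "e < m \<Longrightarrow> i < n \<Longrightarrow> e * n + i < m * (n :: nat)"
  by (metis add.commute add_less_cancel_left less_le_trans mult_Suc mult_le_mono1 Suc_leI)

lemma sum_inflate:
  assumes "e < m" "i < n"
  shows "(\<Sum>k<m * n. inflate m n U $$ (e * n + i, k) * g k) = (\<Sum>k<n. U $$ (i, k) * g (e * n + k))"
proof -
  have "(\<Sum>k<m * n. inflate m n U $$ (e * n + i, k) * g k) =
      (\<Sum>e'<m. if e' = e then \<Sum>k<n. U $$ (i, k) * g (e * n + k) else 0)"
    unfolding sum_lessThan_mult
  proof (rule sum.cong[OF refl])
    fix e' assume "e' \<in> {..<m}"
    then have "inflate m n U $$ (e * n + i, e' * n + k) = (if e' = e then U $$ (i, k) else 0)" if "k < n" for k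
      using that assms block_index_less[of e m i n] block_index_less[of e' m k n] by (auto simp: inflate_def)
    then show "(\<Sum>k<n. inflate m n U $$ (e * n + i, e' * n + k) * g (e' * n + k)) =
        (if e' = e then \<Sum>k<n. U $$ (i, k) * g (e * n + k) else 0)" by auto
  qed
  then show ?thesis using assms by simp
qed

lemma unitary_inflate:
  assumes "unitary n U"
  shows "unitary (m * n) (inflate m n U)"
proof (rule unitaryI)
  have b: "orthonormal m m basis_fn" using orthonormal_basis_fn[of m 0 m] by simp
  have n: "0 < n" if "i < m * n" for i using that by (cases n) auto
  show "orthonormal (m * n) (m * n) (\<lambda>i k. inflate m n U $$ (i, k))"
    by (rule orthonormal_cong[OF orthonormal_tensor[OF b unitary_orthonormal(1)[OF assms]]])
      (auto simp: inflate_def tensor_def basis_fn_def)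
  show "orthonormal (m * n) (m * n) (\<lambda>k i. inflate m n U $$ (i, k))"
    by (rule orthonormal_cong[OF orthonormal_tensor[OF b unitary_orthonormal(2)[OF assms]]])
      (auto simp: inflate_def tensor_def basis_fn_def)
qed simp

lemma psdI:
  assumes "M \<in> carrier_mat n n" "\<And>v. 0 \<le> inner_fn n v (mat_app n M v)"
  shows "positive_semidefinite n M"
  unfolding positive_semidefinite_def
proof (intro conjI ballI)
  fix v :: "complex vec" assume v: "v \<in> carrier_vec n"
  have "(M *\<^sub>v v) \<bullet>c v = inner_fn n (vec_index v) (mat_app n M (vec_index v))"
    using assms(1) v by (auto simp: scalar_prod_def atLeast0LessThan inner_fn_def mat_app_def mult.commute intro!: sum.cong)
  then show "0 \<le> (M *\<^sub>v v) \<bullet>c v" using assms(2) by simp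
qed (rule assms(1))

lemma psd_inflate:
  assumes "positive_semidefinite n M"
  shows "positive_semidefinite (m * n) (inflate m n M)"
proof (rule psdI)
  fix v
  have "inner_fn (m * n) v (mat_app (m * n) (inflate m n M) v) =
      (\<Sum>e<m. inner_fn n (\<lambda>k. v (e * n + k)) (mat_app n M (\<lambda>k. v (e * n + k))))"
    unfolding inner_fn_def mat_app_def sum_lessThan_mult[of _ m n]
    by (intro sum.cong refl) (simp add: sum_inflate[unfolded sum_lessThan_mult])
  also have "0 \<le> \<dots>"
    using psd_quadratic_form[OF assms] by (intro sum_nonneg) (simp add: less_eq_complex_def)
  finally show "0 \<le> inner_fn (m * n) v (mat_app (m * n) (inflate m n M) v)" .
qed simp

lemma povm_inflate:
  assumes "povm n E"
  shows "povm (m * n) (\<lambda>z. inflate m n (E z))"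
proof -
  have c: "E z \<in> carrier_mat n n" for z by (rule povm_carrier[OF assms])
  have "inflate m n (E False) + inflate m n (E True) = 1\<^sub>m (m * n)"
  proof (rule eq_matI)
    fix i j assume "i < dim_row (1\<^sub>m (m * n) :: complex mat)" "j < dim_col (1\<^sub>m (m * n) :: complex mat)"
    then have ij: "i < m * n" "j < m * n" by auto
    then have n: "0 < n" by (cases n) auto
    have "(E False + E True) $$ (i mod n, j mod n) = (if i mod n = j mod n then 1 else 0)"
      using assms n by (simp add: povm_def)
    then have "E False $$ (i mod n, j mod n) + E True $$ (i mod n, j mod n) = (if i mod n = j mod n then 1 else 0)"
      using c[of False] c[of True] n by simp
    moreover have "i = j \<longleftrightarrow> i div n = j div n \<and> i mod n = j mod n" by (metis div_mult_mod_eq)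
    ultimately show "(inflate m n (E False) + inflate m n (E True)) $$ (i, j) = 1\<^sub>m (m * n) $$ (i, j)"
      using ij by (auto simp: inflate_def)
  qed (simp_all add: inflate_def)
  then show ?thesis using assms psd_inflate by (simp add: povm_def)
qed

text \<open>The unnormalized state left when the label of Alice is \<open>e\<close> and that of Bob
  is \<open>f\<close>.\<close>

definition block :: "nat \<Rightarrow> nat \<Rightarrow> nat \<Rightarrow> nat \<Rightarrow> bipartite \<Rightarrow> bipartite" where
  "block a b e f \<Psi> = mat a b (\<lambda>(i, j). \<Psi> $$ (e * a + i, f * b + j))"

lemma block_carrier [simp]: "block a b e f \<Psi> \<in> carrier_mat a b"
  by (simp add: block_def)

lemma block_left_mult:
  assumes U: "U \<in> carrier_mat a a" and P: "\<Psi> \<in> carrier_mat (m * a) (n * b)" and ef: "e < m" "f < n"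
  shows "block a b e f (inflate m a U * \<Psi>) = U * block a b e f \<Psi>"
proof (rule eq_matI)
  fix i j assume "i < dim_row (U * block a b e f \<Psi>)" "j < dim_col (U * block a b e f \<Psi>)"
  then have ij: "i < a" "j < b" using U by (auto simp: block_def)
  have "block a b e f (inflate m a U * \<Psi>) $$ (i, j) =
      (\<Sum>k<m * a. inflate m a U $$ (e * a + i, k) * \<Psi> $$ (k, f * b + j))"
    using ij ef block_index_less
    by (simp add: block_def index_mat_mult_lessThan[OF inflate_carrier P])
  also have "\<dots> = (\<Sum>k<a. U $$ (i, k) * \<Psi> $$ (e * a + k, f * b + j))" by (rule sum_inflate[OF ef(1) ij(1)])
  also have "\<dots> = (U * block a b e f \<Psi>) $$ (i, j)"
    using ij by (simp add: index_mat_mult_lessThan[OF U block_carrier]) (simp add: block_def)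
  finally show "block a b e f (inflate m a U * \<Psi>) $$ (i, j) = (U * block a b e f \<Psi>) $$ (i, j)" .
qed (use U in \<open>auto simp: block_def\<close>)

lemma block_transpose:
  assumes "\<Psi> \<in> carrier_mat (m * a) (n * b)" "e < m" "f < n"
  shows "block b a f e (transpose_mat \<Psi>) = transpose_mat (block a b e f \<Psi>)"
  by (rule eq_matI) (use assms block_index_less in \<open>auto simp: block_def\<close>)

lemma block_right_mult:
  assumes V: "V \<in> carrier_mat b b" and P: "\<Psi> \<in> carrier_mat (m * a) (n * b)" and ef: "e < m" "f < n"
  shows "block a b e f (\<Psi> * transpose_mat (inflate n b V)) = block a b e f \<Psi> * transpose_mat V"
proof -
  have Pt: "transpose_mat \<Psi> \<in> carrier_mat (n * b) (m * a)" using P by simp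
  have IP: "inflate n b V * transpose_mat \<Psi> \<in> carrier_mat (n * b) (m * a)"
    by (rule mult_carrier_mat[OF inflate_carrier Pt])
  have "\<Psi> * transpose_mat (inflate n b V) = transpose_mat (inflate n b V * transpose_mat \<Psi>)"
    using transpose_mult[OF inflate_carrier Pt, of V] by simp
  then have "block a b e f (\<Psi> * transpose_mat (inflate n b V)) =
      transpose_mat (block b a f e (inflate n b V * transpose_mat \<Psi>))"
    using block_transpose[OF IP ef(2,1)] by simp
  also have "\<dots> = transpose_mat (V * transpose_mat (block a b e f \<Psi>))"
    by (simp add: block_left_mult[OF V Pt ef(2,1)] block_transpose[OF P ef])
  also have "\<dots> = block a b e f \<Psi> * transpose_mat V"
    using transpose_mult[OF V, of "transpose_mat (block a b e f \<Psi>)" a] by simp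
  finally show ?thesis .
qed

lemma braket_blocks:
  assumes "\<Phi> \<in> carrier_mat (m * a) (n * b)"
  shows "braket \<Phi> \<Psi> = (\<Sum>e<m. \<Sum>f<n. braket (block a b e f \<Phi>) (block a b e f \<Psi>))"
proof -
  have "braket \<Phi> \<Psi> = (\<Sum>e<m. \<Sum>i<a. \<Sum>f<n. \<Sum>j<b. cnj (\<Phi> $$ (e * a + i, f * b + j)) * \<Psi> $$ (e * a + i, f * b + j))"
    unfolding braket_carrier[OF assms] sum_lessThan_mult ..
  also have "\<dots> = (\<Sum>e<m. \<Sum>f<n. \<Sum>i<a. \<Sum>j<b. cnj (\<Phi> $$ (e * a + i, f * b + j)) * \<Psi> $$ (e * a + i, f * b + j))"
    by (intro sum.cong refl sum.swap)
  also have "\<dots> = (\<Sum>e<m. \<Sum>f<n. braket (block a b e f \<Phi>) (block a b e f \<Psi>))"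
    by (intro sum.cong refl) (simp add: braket_carrier[OF block_carrier], simp add: block_def)
  finally show ?thesis .
qed

text \<open>The dimensions of the original registers at this point are passed along because
  \<open>inflate\<close> has to know where the label begins. Ancillas and messages stay as they
  are.\<close>

fun lift_step :: "nat \<Rightarrow> nat \<Rightarrow> nat \<times> nat \<Rightarrow> step \<Rightarrow> step" where
  "lift_step m n (a, b) (AliceUnitary U) = AliceUnitary (\<lambda>x. inflate m a (U x))"
| "lift_step m n (a, b) (BobUnitary V) = BobUnitary (\<lambda>y. inflate n b (V y))"
| "lift_step m n d s = s"

fun lift_steps :: "nat \<Rightarrow> nat \<Rightarrow> nat \<times> nat \<Rightarrow> step list \<Rightarrow> step list" where
  "lift_steps m n d [] = []"
| "lift_steps m n d (s # ss) = lift_step m n d s # lift_steps m n (step_dims s d) ss"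

fun lift_measurement :: "nat \<Rightarrow> nat \<Rightarrow> nat \<times> nat \<Rightarrow> measurement \<Rightarrow> measurement" where
  "lift_measurement m n (a, b) (AliceMeasures E) = AliceMeasures (\<lambda>x z. inflate m a (E x z))"
| "lift_measurement m n (a, b) (BobMeasures E) = BobMeasures (\<lambda>y z. inflate n b (E y z))"

lemma lift_step_valid:
  assumes "valid_step s (a, b)" "step_dims s (a, b) = (a', b')"
  shows "valid_step (lift_step m n (a, b) s) (m * a, n * b)"
    "step_dims (lift_step m n (a, b) s) (m * a, n * b) = (m * a', n * b')"
    "is_send (lift_step m n (a, b) s) = is_send s"
  using assms by (cases s; auto simp: unitary_inflate is_send_def elim!: evenE)+

text \<open>The offset of a block is a multiple of the register dimension and therefore passes
  through the \<open>div\<close> and \<open>mod\<close> by which ancillas and messages are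
  indexed.\<close>

lemma block_apply_alice_step:
  assumes s: "alice_step s" and v: "valid_step s (a, b)" and d: "step_dims s (a, b) = (a', b')"
    and P: "\<Psi> \<in> carrier_mat (m * a) (n * b)" and ef: "e < m" "f < n"
  shows "block a' b' e f (apply_step x y (lift_step m n (a, b) s) \<Psi>) = apply_step x y s (block a b e f \<Psi>)"
proof (cases s)
  case (AliceUnitary U)
  then show ?thesis using v d block_left_mult[OF unitary_carrier P ef] by (simp add: on_alice_def)
next
  case (AliceAncilla k)
  then have k: "0 < k" and d': "a' = a * k" "b' = b" using v d by auto
  show ?thesis
  proof (rule eq_matI)
    fix i j assume "i < dim_row (apply_step x y s (block a b e f \<Psi>))" "j < dim_col (apply_step x y s (block a b e f \<Psi>))"
    then have ij: "i < a * k" "j < b" using AliceAncilla by (auto simp: block_def)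
    have "e * (a * k) + i < m * a * k" using block_index_less[OF ef(1) ij(1)] by (simp add: mult.assoc)
    moreover have "f * b + j < n * b" by (rule block_index_less[OF ef(2) ij(2)])
    moreover have "(e * (a * k) + i) mod k = i mod k" by (simp add: mult.assoc[symmetric])
    moreover have "(e * (a * k) + i) div k = e * a + i div k" using k by (simp add: mult.assoc[symmetric])
    ultimately show "block a' b' e f (apply_step x y (lift_step m n (a, b) s) \<Psi>) $$ (i, j) = apply_step x y s (block a b e f \<Psi>) $$ (i, j)"
      using ij P by (simp add: AliceAncilla block_def d' less_mult_imp_div_less)
  qed (use AliceAncilla d' in \<open>auto simp: block_def\<close>)
next
  case AliceSends
  then obtain h where a: "a = 2 * h" using v by (auto elim: evenE)
  have d': "a' = h" "b' = b * 2" using d a AliceSends by auto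
  show ?thesis
  proof (rule eq_matI)
    fix i j assume "i < dim_row (apply_step x y s (block a b e f \<Psi>))" "j < dim_col (apply_step x y s (block a b e f \<Psi>))"
    then have ij: "i < h" "j < b * 2" using AliceSends a by (auto simp: block_def)
    have "f * (b * 2) + j < n * b * 2" using block_index_less[OF ef(2) ij(2)] by (simp add: mult.assoc)
    moreover have "e * h + i < m * h" by (rule block_index_less[OF ef(1) ij(1)])
    moreover have "(f * (b * 2) + j) mod 2 = j mod 2" by (simp add: mult.assoc[symmetric])
    moreover have "(f * (b * 2) + j) div 2 = f * b + j div 2" by (simp add: mult.assoc[symmetric])
    moreover have "2 * i + j mod 2 < 2 * h" using ij by linarith
    ultimately show "block a' b' e f (apply_step x y (lift_step m n (a, b) s) \<Psi>) $$ (i, j) = apply_step x y s (block a b e f \<Psi>) $$ (i, j)"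
      using ij P by (simp add: AliceSends block_def d' less_mult_imp_div_less a algebra_simps)
  qed (use AliceSends d' a in \<open>auto simp: block_def\<close>)
qed (use s in \<open>auto simp: alice_step_def\<close>)

lemma block_apply_step:
  assumes v: "valid_step s (a, b)" and d: "step_dims s (a, b) = (a', b')"
    and P: "\<Psi> \<in> carrier_mat (m * a) (n * b)" and ef: "e < m" "f < n"
  shows "block a' b' e f (apply_step x y (lift_step m n (a, b) s) \<Psi>) = apply_step x y s (block a b e f \<Psi>)"
proof (cases "alice_step s")
  case False
  note L = lift_step_valid[OF v d, of m n]
  have "lift_step n m (b, a) (flip_step s) = flip_step (lift_step m n (a, b) s)" by (cases s) auto
  moreover have "block b' a' f e (apply_step y x (lift_step n m (b, a) (flip_step s)) (transpose_mat \<Psi>)) =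
      apply_step y x (flip_step s) (block b a f e (transpose_mat \<Psi>))"
    by (rule block_apply_alice_step) (use False alice_step_cases v d P ef in auto)
  ultimately have "transpose_mat (block a' b' e f (apply_step x y (lift_step m n (a, b) s) \<Psi>)) =
      transpose_mat (apply_step x y s (block a b e f \<Psi>))"
    by (simp add: apply_flip_step[OF L(1) P] apply_flip_step[OF v] block_transpose[OF P ef]
        block_transpose[OF apply_step_carrier[OF L(1) P L(2)] ef])
  then show ?thesis by (metis transpose_transpose)
qed (rule block_apply_alice_step[OF _ v d P ef])

lemma lift_steps_valid:
  assumes "valid_steps ss (a, b)" "fold step_dims ss (a, b) = (a', b')"
  shows "valid_steps (lift_steps m n (a, b) ss) (m * a, n * b)"
    "fold step_dims (lift_steps m n (a, b) ss) (m * a, n * b) = (m * a', n * b')"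
    "length (filter is_send (lift_steps m n (a, b) ss)) = length (filter is_send ss)"
proof -
  have "valid_steps (lift_steps m n (a, b) ss) (m * a, n * b) \<and>
    fold step_dims (lift_steps m n (a, b) ss) (m * a, n * b) = (m * a', n * b') \<and>
    length (filter is_send (lift_steps m n (a, b) ss)) = length (filter is_send ss)"
    using assms
  proof (induct ss arbitrary: a b)
    case (Cons s ss)
    obtain a1 b1 where d: "step_dims s (a, b) = (a1, b1)" by fastforce
    have "valid_step s (a, b)" using Cons by simp
    from lift_step_valid[OF this d, of m n] Cons(1)[of a1 b1] Cons(2,3) d show ?case by simp
  qed simp
  then show "valid_steps (lift_steps m n (a, b) ss) (m * a, n * b)"
    "fold step_dims (lift_steps m n (a, b) ss) (m * a, n * b) = (m * a', n * b')"
    "length (filter is_send (lift_steps m n (a, b) ss)) = length (filter is_send ss)" by blast+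
qed

lemma block_fold:
  assumes "valid_steps ss (a, b)" "fold step_dims ss (a, b) = (a', b')"
    and "\<Psi> \<in> carrier_mat (m * a) (n * b)" "e < m" "f < n"
  shows "block a' b' e f (fold (apply_step x y) (lift_steps m n (a, b) ss) \<Psi>) = fold (apply_step x y) ss (block a b e f \<Psi>)"
  using assms
proof (induct ss arbitrary: a b \<Psi>)
  case (Cons s ss)
  obtain a1 b1 where d: "step_dims s (a, b) = (a1, b1)" by fastforce
  have v: "valid_step s (a, b)" using Cons by simp
  have "apply_step x y (lift_step m n (a, b) s) \<Psi> \<in> carrier_mat (m * a1) (n * b1)"
    by (rule apply_step_carrier[OF lift_step_valid(1)[OF v d] Cons(4) lift_step_valid(2)[OF v d]])
  then show ?case using Cons(1)[of a1 b1 "apply_step x y (lift_step m n (a, b) s) \<Psi>"] Cons(2-) d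
      block_apply_step[OF v d Cons(4-6), of x y] by simp
qed simp

lemma lift_measurement_valid:
  "valid_measurement me (a, b) \<Longrightarrow> valid_measurement (lift_measurement m n (a, b) me) (m * a, n * b)"
  by (cases me) (auto simp: povm_inflate)

text \<open>Neither steps nor measurement touch the labels, so different pairs of labels never
  interfere and their responses simply add up.\<close>

lemma response_lift:
  assumes v: "valid_steps ss (a, b)" and d: "fold step_dims ss (a, b) = (a', b')"
    and vm: "valid_measurement me (a', b')" and P: "\<Psi> \<in> carrier_mat (m * a) (n * b)"
  shows "response (lift_steps m n (a, b) ss) (lift_measurement m n (a', b') me) x y z \<Psi> \<Psi> =
    (\<Sum>e<m. \<Sum>f<n. response ss me x y z (block a b e f \<Psi>) (block a b e f \<Psi>))"
proof -
  let ?G = "fold (apply_step x y) (lift_steps m n (a, b) ss) \<Psi>"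
  have G: "?G \<in> carrier_mat (m * a') (n * b')"
    by (rule fold_carrier[OF lift_steps_valid(1)[OF v d] lift_steps_valid(2)[OF v d] P])
  have "block a' b' e f (apply_measurement (lift_measurement m n (a', b') me) x y z ?G) =
      apply_measurement me x y z (block a' b' e f ?G)" if "e < m" "f < n" for e f
  proof (cases me)
    case (AliceMeasures E)
    then show ?thesis using vm block_left_mult[OF povm_carrier G that]
      by (simp add: apply_measurement_def on_alice_def)
  next
    case (BobMeasures E)
    then show ?thesis using vm block_right_mult[OF povm_carrier G that]
      by (simp add: apply_measurement_def on_bob_def)
  qed
  then show ?thesis
    unfolding response_def braket_blocks[OF G] Re_sum
    by (intro sum.cong refl) (simp add: block_fold[OF v d P])
qed

section \<open>Dilution of a maximally entangled state\<close>

text \<open>When the x k are pairwise orthogonal with squared norm 2, this is the product of the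
  Householder reflections along them.\<close>

definition reflector :: "nat \<Rightarrow> nat \<Rightarrow> (nat \<Rightarrow> nat \<Rightarrow> complex) \<Rightarrow> complex mat" where
  "reflector n p x = mat n n (\<lambda>(i, j). (if i = j then 1 else 0) - (\<Sum>k<p. x k i * cnj (x k j)))"

lemma unitary_reflector:
  assumes x: "\<And>k l. k < p \<Longrightarrow> l < p \<Longrightarrow> inner_fn n (x k) (x l) = (if k = l then 2 else 0)"
  shows "unitary n (reflector n p x)"
proof (rule unitaryI)
  define c where "c j i = basis_fn j i - (\<Sum>k<p. cnj (x k j) * x k i)" for j i
  have ce: "reflector n p x $$ (i, j) = c j i" if "i < n" "j < n" for i j
    using that by (simp add: reflector_def c_def basis_fn_def mult.commute)
  have cols: "orthonormal n n c"
    unfolding orthonormal_def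
  proof (intro allI impI)
    fix i j assume ij: "i < n" "j < n"
    have 1: "inner_fn n (basis_fn i) (basis_fn j) = (if i = j then 1 else 0)"
      using ij by (simp add: inner_fn_basis_fn) (simp add: basis_fn_def)
    have 2: "inner_fn n (basis_fn i) (\<lambda>m. \<Sum>k<p. cnj (x k j) * x k m) = (\<Sum>k<p. cnj (x k j) * x k i)"
      using ij by (simp add: inner_fn_basis_fn)
    have 3: "inner_fn n (\<lambda>m. \<Sum>k<p. cnj (x k i) * x k m) (basis_fn j) = (\<Sum>k<p. cnj (x k j) * x k i)"
      by (subst inner_fn_commute) (use ij in \<open>simp add: inner_fn_basis_fn mult.commute\<close>)
    \<comment> \<open>Squared norm 2 makes this quadratic term cancel the two linear ones.\<close>
    have "inner_fn n (\<lambda>m. \<Sum>k<p. cnj (x k i) * x k m) (\<lambda>m. \<Sum>k<p. cnj (x k j) * x k m) =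
        (\<Sum>k<p. x k i * (\<Sum>l<p. cnj (x l j) * inner_fn n (x k) (x l)))"
      unfolding inner_fn_sum_left inner_fn_sum_right by simp
    also have "\<dots> = (\<Sum>k<p. x k i * (\<Sum>l<p. if k = l then 2 * cnj (x l j) else 0))"
      by (intro sum.cong refl arg_cong2[of _ _ _ _ "(*)"]) (simp add: x)
    also have "\<dots> = 2 * (\<Sum>k<p. cnj (x k j) * x k i)" by (simp add: sum_distrib_left mult_ac)
    finally show "inner_fn n (c i) (c j) = (if i = j then 1 else 0)"
      unfolding c_def[abs_def] inner_fn_diff_left inner_fn_diff_right 1 2 3 by simp
  qed
  show "orthonormal n n (\<lambda>k i. reflector n p x $$ (i, k))"
    by (rule orthonormal_cong[OF cols]) (simp add: ce)
  have rows: "reflector n p x $$ (i, k) = cnj (c i k)" if "i < n" "k < n" for i k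
    using that by (simp add: reflector_def c_def basis_fn_def mult.commute)
  have "orthonormal n n (\<lambda>i k. cnj (c i k))"
    unfolding orthonormal_def
  proof (intro allI impI)
    fix i j assume "i < n" "j < n"
    have "inner_fn n (\<lambda>k. cnj (c i k)) (\<lambda>k. cnj (c j k)) = cnj (inner_fn n (c i) (c j))" by (simp add: inner_fn_def)
    then show "inner_fn n (\<lambda>k. cnj (c i k)) (\<lambda>k. cnj (c j k)) = (if i = j then 1 else 0)"
      using cols \<open>i < n\<close> \<open>j < n\<close> by (simp add: orthonormal_def)
  qed
  then show "orthonormal n n (\<lambda>i k. reflector n p x $$ (i, k))"
    by (rule orthonormal_cong) (simp add: rows)
qed (simp add: reflector_def)

lemma mat_app_reflector:
  assumes "i < n"
  shows "mat_app n (reflector n p x) y i = y i - (\<Sum>k<p. x k i * inner_fn n (x k) y)"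
proof -
  have "mat_app n (reflector n p x) y i = (\<Sum>j<n. (if i = j then y j else 0) - (\<Sum>k<p. x k i * (cnj (x k j) * y j)))"
    unfolding mat_app_def reflector_def using assms
    by (intro sum.cong refl) (auto simp: left_diff_distrib sum_distrib_right mult.assoc)
  also have "\<dots> = y i - (\<Sum>j<n. \<Sum>k<p. x k i * (cnj (x k j) * y j))"
    using assms by (simp add: sum_subtractf)
  also have "(\<Sum>j<n. \<Sum>k<p. x k i * (cnj (x k j) * y j)) = (\<Sum>k<p. x k i * inner_fn n (x k) y)"
    by (subst sum.swap) (simp add: inner_fn_def sum_distrib_left)
  finally show ?thesis .
qed

text \<open>Reflecting along the differences f k - g k exchanges f k and g k. Orthogonality between
  the two families makes these differences pairwise orthogonal of squared norm 2, and no completion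
  to a basis is required.\<close>

lemma exists_unitary_swapping:
  assumes f: "orthonormal n p f" and g: "orthonormal n p g"
    and fg: "\<And>k l. k < p \<Longrightarrow> l < p \<Longrightarrow> inner_fn n (f k) (g l) = 0"
  obtains V where "unitary n V" "\<And>k i. k < p \<Longrightarrow> i < n \<Longrightarrow> mat_app n V (f k) i = g k i"
proof
  define x where "x k i = f k i - g k i" for k i
  have gf: "inner_fn n (g k) (f l) = 0" if "k < p" "l < p" for k l
    using fg[OF that(2,1)] inner_fn_commute[of n "g k" "f l"] by simp
  show "unitary n (reflector n p x)"
  proof (rule unitary_reflector)
    fix k l assume kl: "k < p" "l < p"
    have "inner_fn n (x k) (x l) = inner_fn n (f k) (f l) - inner_fn n (g k) (f l) - (inner_fn n (f k) (g l) - inner_fn n (g k) (g l))"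
      unfolding x_def[abs_def] inner_fn_diff_left inner_fn_diff_right by simp
    then show "inner_fn n (x k) (x l) = (if k = l then 2 else 0)"
      using f g kl by (simp add: orthonormal_def fg gf)
  qed
  show "mat_app n (reflector n p x) (f k) i = g k i" if "k < p" "i < n" for k i
  proof -
    have "inner_fn n (x l) (f k) = (if l = k then 1 else 0)" if "l < p" for l
      using f gf[OF that \<open>k < p\<close>] that \<open>k < p\<close> unfolding x_def[abs_def] inner_fn_diff_left
      by (simp add: orthonormal_def)
    then have "(\<Sum>l<p. x l i * inner_fn n (x l) (f k)) = (\<Sum>l<p. if l = k then x l i else 0)"
      by (intro sum.cong refl) auto
    then show ?thesis using that by (simp add: mat_app_reflector x_def)
  qed
qed

text \<open>Every message takes the last qubit of the sender and appends it at the receiver, so a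
  run of \<open>w\<close> messages delivers the qubits in reversed order.\<close>

fun bit_rev :: "nat \<Rightarrow> nat \<Rightarrow> nat" where
  "bit_rev 0 t = 0"
| "bit_rev (Suc w) t = (t mod 2) * 2 ^ w + bit_rev w (t div 2)"

lemma bit_rev_less: "bit_rev w t < 2 ^ w"
proof (induct w arbitrary: t)
  case (Suc w)
  have "t mod 2 = 0 \<or> t mod 2 = 1" by linarith
  then show ?case using Suc[of "t div 2"] by auto
qed simp

lemma inj_on_bit_rev: "inj_on (bit_rev w) {..<2 ^ w}"
proof (induct w)
  case (Suc w)
  show ?case
  proof (rule inj_onI)
    fix s t assume st: "s \<in> {..<2 ^ Suc w}" "t \<in> {..<2 ^ Suc w}" and eq: "bit_rev (Suc w) s = bit_rev (Suc w) t"
    from eq have "(s mod 2 * 2 ^ w + bit_rev w (s div 2)) div 2 ^ w = (t mod 2 * 2 ^ w + bit_rev w (t div 2)) div 2 ^ w"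
      by simp
    then have m: "s mod 2 = t mod 2" using bit_rev_less[of w] by simp
    with eq have "bit_rev w (s div 2) = bit_rev w (t div 2)" by simp
    then have "s div 2 = t div 2" using Suc st by (auto dest!: inj_onD simp: less_mult_imp_div_less mult.commute)
    with m show "s = t" by (metis div_mult_mod_eq)
  qed
qed (simp add: inj_on_def)

lemma bij_betw_bit_rev: "bij_betw (bit_rev w) {..<2 ^ w} {..<2 ^ w}"
  by (simp add: bij_betw_def inj_on_bit_rev endo_inj_surj bit_rev_less image_subset_iff)

lemma fold_AliceSends:
  assumes "\<Psi> \<in> carrier_mat (h * 2 ^ w) b"
  shows "fold (apply_step x y) (replicate w AliceSends) \<Psi> =
    mat h (b * 2 ^ w) (\<lambda>(i, j). \<Psi> $$ (i * 2 ^ w + bit_rev w (j mod 2 ^ w), j div 2 ^ w))"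
  using assms
proof (induct w arbitrary: h)
  case 0
  then show ?case by (auto intro!: eq_matI)
next
  case (Suc w)
  have "\<Psi> \<in> carrier_mat (h * 2 * 2 ^ w) b" using Suc(2) by (simp add: mult.assoc)
  note IH = Suc(1)[OF this]
  \<comment> \<open>The last message is split off, so that the induction hypothesis applies to the
    same state with \<open>h\<close> doubled.\<close>
  have "fold (apply_step x y) (replicate (Suc w) AliceSends) \<Psi> =
      apply_step x y AliceSends (fold (apply_step x y) (replicate w AliceSends) \<Psi>)"
    by (simp only: replicate_Suc replicate_append_same[symmetric] fold_append fold.simps o_apply id_apply)
  also have "\<dots> = mat h (b * 2 ^ Suc w)
      (\<lambda>(i, j). \<Psi> $$ (i * 2 ^ Suc w + bit_rev (Suc w) (j mod 2 ^ Suc w), j div 2 ^ Suc w))"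
    (is "?L = ?R")
  proof (rule eq_matI)
    fix i j assume "i < dim_row ?R" "j < dim_col ?R"
    then have ij: "i < h" "j < b * 2 ^ Suc w" by auto
    have jd: "j div 2 < b * 2 ^ w" using ij by (simp add: less_mult_imp_div_less mult_ac)
    have t: "j mod 2 ^ Suc w = 2 * (j div 2 mod 2 ^ w) + j mod 2"
      using mod_mult2_eq[of j 2 "2 ^ w"] by simp
    have "2 * i + j mod 2 < h * 2" using ij by linarith
    then have "?L $$ (i, j) =
        \<Psi> $$ ((2 * i + j mod 2) * 2 ^ w + bit_rev w (j div 2 mod 2 ^ w), j div 2 div 2 ^ w)"
      unfolding IH using ij jd by (simp add: mult_ac)
    also have "(2 * i + j mod 2) * 2 ^ w + bit_rev w (j div 2 mod 2 ^ w) = i * 2 ^ Suc w + bit_rev (Suc w) (j mod 2 ^ Suc w)"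
      unfolding t by (simp add: algebra_simps)
    also have "j div 2 div 2 ^ w = j div 2 ^ Suc w" by (simp add: div_mult2_eq)
    finally show "?L $$ (i, j) = ?R $$ (i, j)"
      using ij by simp
  qed (simp_all only: apply_step.simps dim_row_mat dim_col_mat IH, simp_all)
  finally show ?case .
qed

lemma replicate_AliceSends_valid:
  "valid_steps (replicate w AliceSends) (h * 2 ^ w, b)"
  "fold step_dims (replicate w AliceSends) (h * 2 ^ w, b) = (h, b * 2 ^ w)"
proof -
  have "valid_steps (replicate w AliceSends) (h * 2 ^ w, b) \<and>
    fold step_dims (replicate w AliceSends) (h * 2 ^ w, b) = (h, b * 2 ^ w)"
  proof (induct w arbitrary: b)
    case (Suc w)
    then show ?case using Suc[of "b * 2"] by (simp add: mult_ac)
  qed simp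
  then show "valid_steps (replicate w AliceSends) (h * 2 ^ w, b)"
    "fold step_dims (replicate w AliceSends) (h * 2 ^ w, b) = (h, b * 2 ^ w)" by blast+
qed

section \<open>Maximally entangled states and their dilution\<close>

lemma orthonormal_family_vec:
  assumes "orthonormal n r u"
  shows "orthonormal_family n r (\<lambda>k. vec n (u k))"
proof -
  have "vec n (u k) \<bullet>c vec n (u l) = inner_fn n (u l) (u k)" for k l
    by (auto simp: scalar_prod_def atLeast0LessThan inner_fn_def mult.commute intro!: sum.cong)
  then show ?thesis using assms by (auto simp: orthonormal_family_def orthonormal_def)
qed

lemma normalized_braket: "normalized \<Psi> \<longleftrightarrow> braket \<Psi> \<Psi> = 1"
proof -
  have "braket \<Psi> \<Psi> = complex_of_real (\<Sum>i<dim_row \<Psi>. \<Sum>j<dim_col \<Psi>. (cmod (\<Psi> $$ (i, j)))\<^sup>2)"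
    by (simp add: braket_def cnj_mult_self del: of_real_power)
  then show ?thesis unfolding normalized_def by (simp only: of_real_eq_1_iff)
qed

lemma maximally_entangled_superposition:
  assumes u: "orthonormal a r u" and v: "orthonormal b r v"
    and s: "\<And>k. k < r \<Longrightarrow> s k = 0 \<or> s k = c" and c: "0 \<le> c" and one: "(\<Sum>k<r. (s k)\<^sup>2) = 1"
  shows "maximally_entangled (superposition a b u v {..<r} s)"
proof -
  let ?S = "superposition a b u v {..<r} s"
  have dims: "dim_row ?S = a" "dim_col ?S = b" by (simp_all add: superposition_def)
  have "normalized ?S" unfolding normalized_braket
    by (subst braket_superposition[OF u v]) (simp_all add: one del: of_real_power of_real_sum)
  moreover have "schmidt_decomposition ?S r s (\<lambda>k. vec a (u k)) (\<lambda>k. vec b (v k))"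
    unfolding schmidt_decomposition_def dims
    using orthonormal_family_vec[OF u] orthonormal_family_vec[OF v] s c
    by (force simp: superposition_def)
  moreover have "\<forall>k<r. \<forall>l<r. s k \<noteq> 0 \<longrightarrow> s l \<noteq> 0 \<longrightarrow> s k = s l" using s by metis
  ultimately show ?thesis unfolding maximally_entangled_def by blast
qed

lemma sum_lessThan_if_less:
  fixes c :: "'a :: semiring_1"
  assumes "n \<le> W"
  shows "(\<Sum>s<W. if s < n then c else 0) = of_nat n * c"
proof -
  have "{..<W} \<inter> {s. s < n} = {..<n}" using assms by auto
  then show ?thesis by (simp add: sum.If_cases)
qed

text \<open>Alice sends her half of the last 2^w-dimensional factor; Bob then holds both halves of a maximally
  entangled state whose rank n p depends on p, and turns it into a fixed state G p.\<close>

lemma dilution: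
  fixes n :: "nat \<Rightarrow> nat" and D :: real
  assumes X: "orthonormal nA P X" and Y: "orthonormal nB P Y" and G: "orthonormal (nB * (2 ^ w * 2 ^ w)) P G"
    and disj: "\<And>p p' j. p < P \<Longrightarrow> p' < P \<Longrightarrow> Y p (j div (2 ^ w * 2 ^ w)) = 0 \<or> G p' j = 0"
    and n: "\<And>p. p < P \<Longrightarrow> n p \<le> 2 ^ w" and D: "D = (\<Sum>p<P. real (n p))" "0 < D"
  obtains \<Psi> pre where "\<Psi> \<in> carrier_mat (nA * 2 ^ w) (nB * 2 ^ w)" "maximally_entangled \<Psi>"
    "valid_steps pre (nA * 2 ^ w, nB * 2 ^ w)"
    "fold step_dims pre (nA * 2 ^ w, nB * 2 ^ w) = (nA, nB * (2 ^ w * 2 ^ w))"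
    "length (filter is_send pre) = w"
    "\<And>x y. fold (apply_step x y) pre \<Psi> =
      superposition nA (nB * (2 ^ w * 2 ^ w)) X G {..<P} (\<lambda>p. sqrt (n p / D))"
proof -
  define W :: nat where "W = 2 ^ w"
  have W: "0 < W" by (simp add: W_def)
  have basis: "orthonormal W W basis_fn" using orthonormal_basis_fn[of W 0 W] by simp
  \<comment> \<open>The index k = p W + s stands for basis state \<open>s\<close> in factor
    \<open>p\<close>; a flat amplitude on the first \<open>n p\<close> of them gives this factor the
    weight n p / D.\<close>
  define S where "S k = (if k mod W < n (k div W) then 1 / sqrt D else 0)" for k
  define U where "U k = tensor W (X (k div W)) (basis_fn (k mod W))" for k
  define V where "V k = tensor W (Y (k div W)) (basis_fn (k mod W))" for k
  have U: "orthonormal (nA * W) (P * W) U" unfolding U_def[abs_def] by (rule orthonormal_tensor[OF X basis])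
  have V: "orthonormal (nB * W) (P * W) V" unfolding V_def[abs_def] by (rule orthonormal_tensor[OF Y basis])
  define \<Psi> where "\<Psi> = superposition (nA * W) (nB * W) U V {..<P * W} S"
  have \<Psi>c: "\<Psi> \<in> carrier_mat (nA * W) (nB * W)" by (simp add: \<Psi>_def)
  have "(\<Sum>k<P * W. (S k)\<^sup>2) = 1"
  proof -
    have "(\<Sum>k<P * W. (S k)\<^sup>2) = (\<Sum>p<P. \<Sum>s<W. if s < n p then 1 / D else 0)"
      unfolding sum_lessThan_mult S_def using D(2) by (intro sum.cong refl) (simp add: power_divide)
    also have "\<dots> = (\<Sum>p<P. real (n p) * (1 / D))"
      using n by (intro sum.cong refl sum_lessThan_if_less) (auto simp: W_def)
    also have "\<dots> = 1" unfolding sum_distrib_right[symmetric] D(1)[symmetric] using D(2) by simp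
    finally show ?thesis .
  qed
  then have me: "maximally_entangled \<Psi>"
    unfolding \<Psi>_def by (intro maximally_entangled_superposition[OF U V, of S "1 / sqrt D"])
      (use D(2) in \<open>auto simp: S_def\<close>)
  \<comment> \<open>For n p = 0 the maximum keeps \<phi> p a unit vector, so that the family
    \<open>f\<close> is orthonormal; its coefficient sqrt (n p / D) is 0 in that case.\<close>
  define m where "m p = max 1 (n p)" for p
  \<comment> \<open>\<open>l div W\<close> is the half that Bob held from the start and
    \<open>l mod W\<close> the half received, with its qubits reversed; the amplitude is nonzero
    only where the two match.\<close>
  define \<phi> where "\<phi> p l = (if l div W < m p \<and> bit_rev w (l mod W) = l div W
    then complex_of_real (1 / sqrt (m p)) else 0)" for p l
  define f where "f p = tensor (W * W) (Y p) (\<phi> p)" for p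
  have mW: "m p \<le> W" if "p < P" for p using n[OF that] by (simp add: m_def W_def)
  have \<phi>: "inner_fn (W * W) (\<phi> p) (\<phi> p) = 1" if "p < P" for p
  proof -
    have m0: "0 < m p" by (simp add: m_def)
    have "inner_fn (W * W) (\<phi> p) (\<phi> p) = (\<Sum>s<W. \<Sum>t<W. if s = bit_rev w t then (if s < m p then 1 / of_nat (m p) else 0) else 0)"
      unfolding inner_fn_def sum_lessThan_mult
    proof (intro sum.cong refl)
      fix s t assume "s \<in> {..<W}" "t \<in> {..<W}"
      have "(1 / sqrt (m p)) * (1 / sqrt (m p)) = 1 / real (m p)" using m0 by simp
      then have "complex_of_real (1 / sqrt (m p)) * complex_of_real (1 / sqrt (m p)) = 1 / of_nat (m p)"
        by (simp only: of_real_mult[symmetric]) simp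
      moreover have "cnj (\<phi> p (s * W + t)) * \<phi> p (s * W + t) =
          (if s = bit_rev w t \<and> s < m p then complex_of_real (1 / sqrt (m p)) * complex_of_real (1 / sqrt (m p)) else 0)"
        using \<open>t \<in> {..<W}\<close> by (simp add: \<phi>_def)
      ultimately show "cnj (\<phi> p (s * W + t)) * \<phi> p (s * W + t) =
          (if s = bit_rev w t then (if s < m p then 1 / of_nat (m p) else 0) else 0)" by simp
    qed
    also have "\<dots> = (\<Sum>t<W. \<Sum>s<W. if s = bit_rev w t then (if s < m p then 1 / of_nat (m p) else 0) else 0)"
      by (rule sum.swap)
    also have "\<dots> = (\<Sum>t<W. if bit_rev w t < m p then 1 / of_nat (m p) else 0)"
      using bit_rev_less by (intro sum.cong refl) (simp add: W_def)
    also have "\<dots> = (\<Sum>t<W. if t < m p then 1 / of_nat (m p) else 0)"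
      using sum.reindex_bij_betw[OF bij_betw_bit_rev[of w], of "\<lambda>t. if t < m p then 1 / of_nat (m p) else (0 :: complex)"]
      by (simp add: W_def)
    also have "\<dots> = of_nat (m p) * (1 / of_nat (m p))" by (rule sum_lessThan_if_less[OF mW[OF that]])
    finally show ?thesis using m0 by simp
  qed
  have f: "orthonormal (nB * (W * W)) P f"
    using Y \<phi> unfolding orthonormal_def f_def inner_fn_tensor by auto
  have fG: "inner_fn (nB * (W * W)) (f k) (G l) = 0" if "k < P" "l < P" for k l
    unfolding inner_fn_def
  proof (intro sum.neutral ballI)
    fix j
    show "cnj (f k j) * G l j = 0" using disj[OF that, of j] by (auto simp: f_def tensor_def W_def)
  qed
  \<comment> \<open>A single unitary treats all p simultaneously, since the orthonormal Y p keep the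
    states f p apart. It depends on no input.\<close>
  obtain B where B: "unitary (nB * (W * W)) B"
    and Bf: "\<And>k i. k < P \<Longrightarrow> i < nB * (W * W) \<Longrightarrow> mat_app (nB * (W * W)) B (f k) i = G k i"
    using exists_unitary_swapping[OF f G[folded W_def] fG] by blast
  have Bc: "B \<in> carrier_mat (nB * (W * W)) (nB * (W * W))" by (rule unitary_carrier[OF B])
  define pre where "pre = replicate w AliceSends @ [BobUnitary (\<lambda>_. B)]"
  let ?T = "\<lambda>Z. superposition nA (nB * (W * W)) X Z {..<P} (\<lambda>p. sqrt (n p / D))"
  have sent: "fold (apply_step x y) (replicate w AliceSends) \<Psi> = ?T f" for x y
    unfolding fold_AliceSends[OF \<Psi>c[unfolded W_def]] W_def[symmetric]
  proof (rule eq_matI)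
    fix i j assume "i < dim_row (?T f)" "j < dim_col (?T f)"
    then have ij: "i < nA" "j < nB * W * W" by (auto simp: superposition_def)
    let ?l = "bit_rev w (j mod W)"
    have l: "?l < W" using bit_rev_less by (simp add: W_def)
    have "\<Psi> $$ (i * W + ?l, j div W) = (\<Sum>k<P * W. of_real (S k) * U k (i * W + ?l) * V k (j div W))"
      using block_index_less[OF ij(1) l] ij(2) by (simp add: \<Psi>_def superposition_def less_mult_imp_div_less)
    also have "\<dots> = (\<Sum>p<P. \<Sum>s<W. if s = ?l then of_real (S (p * W + ?l)) * X p i * V (p * W + ?l) (j div W) else 0)"
      unfolding sum_lessThan_mult using l by (intro sum.cong refl) (auto simp: U_def basis_fn_def)
    also have "\<dots> = (\<Sum>p<P. of_real (S (p * W + ?l)) * X p i * V (p * W + ?l) (j div W))"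
      using l by simp
    also have "\<dots> = (\<Sum>p<P. complex_of_real (sqrt (n p / D)) * X p i * f p j)"
    proof (rule sum.cong[OF refl])
      fix p assume "p \<in> {..<P}"
      have 1: "V (p * W + ?l) (j div W) = Y p (j div (W * W)) * (if j div W mod W = ?l then 1 else 0)"
        using l by (simp add: V_def tensor_def basis_fn_def div_mult2_eq)
      have "j mod (W * W) = W * (j div W mod W) + j mod W" by (rule mod_mult2_eq)
      then have 2: "j mod (W * W) div W = j div W mod W" "j mod (W * W) mod W = j mod W" using W by simp_all
      have 3: "S (p * W + ?l) = (if ?l < n p then 1 / sqrt D else 0)" using l by (simp add: S_def)
      show "of_real (S (p * W + ?l)) * X p i * V (p * W + ?l) (j div W) =
          complex_of_real (sqrt (n p / D)) * X p i * f p j"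
        unfolding 1 3 f_def tensor_def \<phi>_def 2 m_def
        by (cases "n p = 0") (auto simp: real_sqrt_divide max_def)
    qed
    also have "\<dots> = ?T f $$ (i, j)" using ij by (simp add: superposition_def mult.assoc)
    finally show "mat nA (nB * W * W) (\<lambda>(i, j). \<Psi> $$ (i * W + bit_rev w (j mod W), j div W)) $$ (i, j) = ?T f $$ (i, j)"
      using ij by simp
  qed (simp_all add: superposition_def mult.assoc)
  have final: "fold (apply_step x y) pre \<Psi> = ?T G" for x y
  proof -
    have "fold (apply_step x y) pre \<Psi> = ?T f * transpose_mat B"
      unfolding pre_def fold_append o_apply sent by (simp add: on_bob_def)
    also have "\<dots> = ?T G"
    proof (rule eq_matI)
      fix i j assume "i < dim_row (?T G)" "j < dim_col (?T G)"
      then have ij: "i < nA" "j < nB * (W * W)" by (auto simp: superposition_def)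
      have Bt: "transpose_mat B \<in> carrier_mat (nB * (W * W)) (nB * (W * W))" using Bc by simp
      have "(?T f * transpose_mat B) $$ (i, j) = (\<Sum>k<nB * (W * W). \<Sum>p<P. complex_of_real (sqrt (n p / D)) * X p i * (B $$ (j, k) * f p k))"
        unfolding index_mat_mult_lessThan[OF superposition_carrier Bt ij]
        using ij Bc by (intro sum.cong refl) (simp add: superposition_def sum_distrib_left sum_distrib_right mult_ac)
      also have "\<dots> = (\<Sum>p<P. complex_of_real (sqrt (n p / D)) * X p i * mat_app (nB * (W * W)) B (f p) j)"
        unfolding mat_app_def sum_distrib_left by (rule sum.swap)
      also have "\<dots> = ?T G $$ (i, j)" using ij by (simp add: superposition_def Bf)
      finally show "(?T f * transpose_mat B) $$ (i, j) = ?T G $$ (i, j)" .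
    qed (use Bc in \<open>simp_all add: superposition_def\<close>)
    finally show ?thesis .
  qed
  have "valid_steps pre (nA * W, nB * W)" "fold step_dims pre (nA * W, nB * W) = (nA, nB * (W * W))"
    using replicate_AliceSends_valid[of w nA "nB * W"] B
    unfolding pre_def valid_steps_append fold_append o_apply W_def[symmetric] by (simp_all add: mult.assoc)
  moreover have "length (filter is_send pre) = w" by (simp add: pre_def is_send_def)
  ultimately show ?thesis using that[of \<Psi> pre] \<Psi>c me final unfolding W_def by blast
qed

text \<open>The number p = e r + i encodes a label and a Schmidt index. Both parties hold the same
  label, so only diagonal blocks are nonzero.\<close>

lemma block_superposition_tensor:
  assumes ef: "e < M" "f < N" and r: "0 < r"
  shows "block a b e f (superposition (M * a) (N * b)
      (\<lambda>p. tensor a (basis_fn (p div r)) (u (p mod r))) (\<lambda>p. tensor b (basis_fn (p div r)) (v (p mod r))) {..<M * r} c) =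
    superposition a b u v {..<r} (\<lambda>i. if e = f then c (e * r + i) else 0)"
    (is "block a b e f ?S = ?T")
proof (rule eq_matI)
  fix i j assume "i < dim_row ?T" "j < dim_col ?T"
  then have ij: "i < a" "j < b" by (auto simp: superposition_def)
  have "block a b e f ?S $$ (i, j) = (\<Sum>e'<M. \<Sum>k<r. of_real (c (e' * r + k)) *
      (basis_fn e' e * u k i) * (basis_fn e' f * v k j))"
    using ij block_index_less[OF ef(1) ij(1)] block_index_less[OF ef(2) ij(2)] r
    by (simp add: block_def superposition_def sum_lessThan_mult)
  also have "\<dots> = (\<Sum>e'<M. if e' = e then \<Sum>k<r. complex_of_real (if e = f then c (e * r + k) else 0) * u k i * v k j else 0)"
    by (intro sum.cong refl) (auto simp: basis_fn_def)
  also have "\<dots> = ?T $$ (i, j)" using ij ef by (simp add: superposition_def)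
  finally show "block a b e f ?S $$ (i, j) = ?T $$ (i, j)" .
qed (simp_all add: block_def superposition_def)

lemma sum_labelled:
  fixes c :: real
  assumes "k < K" "l \<le> (m :: nat)"
  shows "(\<Sum>e<K * m. if e div m = k \<and> e mod m < l then c else 0) = l * c"
proof -
  have "(\<Sum>e<K * m. if e div m = k \<and> e mod m < l then c else 0) = (\<Sum>e<K. if e = k then \<Sum>s<m. if s < l then c else 0 else 0)"
    unfolding sum_lessThan_mult by (intro sum.cong refl) auto
  then show ?thesis using assms by (simp add: sum_lessThan_if_less)
qed

section \<open>Simulation\<close>

lemma communication_cost_is_send: "communication_cost P = length (filter is_send (steps P))"
  by (simp add: communication_cost_def is_send_def[abs_def])

lemma response_append:
  "response (pre @ ss) me x y z \<Psi> \<Psi> =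
    response ss me x y z (fold (apply_step x y) pre \<Psi>) (fold (apply_step x y) pre \<Psi>)"
  by (simp add: response_def)

text \<open>Term \<open>i\<close> occurs under \<open>L (chunk i)\<close> labels, each time with
  weight \<open>q i\<close> over the total. Terms of different chunks have no label in common and
  cannot interfere, which yields the pinched form. The multiplicities \<open>q i\<close> are at most
  2^w and therefore cost \<open>w\<close> qubits; the units are realized by labels and cost
  none.\<close>

lemma flat_simulation:
  fixes R :: protocol and chunk L q :: "nat \<Rightarrow> nat"
  assumes R: "valid_protocol R" and u: "orthonormal (dim_row (resource R)) r u" and v: "orthonormal (dim_col (resource R)) r v"
    and r: "0 < r" and L: "\<And>i. i < r \<Longrightarrow> 0 < L (chunk i)" and q: "\<And>i. i < r \<Longrightarrow> 0 < q i" "\<And>i. i < r \<Longrightarrow> q i \<le> 2 ^ w"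
  obtains R' where "valid_protocol R'" "maximally_entangled (resource R')"
    "communication_cost R' = w + communication_cost R"
    "\<And>x y z. output_prob R' x y z = qform r (\<lambda>i j. if chunk i = chunk j
        then schmidt_response (dim_row (resource R)) (dim_col (resource R)) u v (steps R) (final_measurement R) x y z i j else 0)
      (\<lambda>i. sqrt (q i * L (chunk i) / (\<Sum>j<r. real (q j * L (chunk j)))))"
proof -
  define a b where "a = dim_row (resource R)" "b = dim_col (resource R)"
  define ss me where "ss = steps R" "me = final_measurement R"
  obtain a' b' where d: "fold step_dims ss (a, b) = (a', b')" by fastforce
  have vs: "valid_steps ss (a, b)" and vm: "valid_measurement me (a', b')"
    using R d by (simp_all add: valid_protocol_def Let_def a_b_def ss_me_def)
  have u: "orthonormal a r u" and v: "orthonormal b r v" using u v by (simp_all add: a_b_def)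
  define W :: nat where "W = 2 ^ w"
  have W: "0 < W" by (simp add: W_def)
  \<comment> \<open>Sums serve as crude bounds for the largest chunk number and the largest
    unit.\<close>
  define K where "K = Suc (\<Sum>i<r. chunk i)"
  define Lm where "Lm = (\<Sum>i<r. L (chunk i))"
  have K: "chunk i < K" if "i < r" for i
    unfolding K_def less_Suc_eq_le using that by (intro member_le_sum) auto
  have Lm: "L (chunk i) \<le> Lm" if "i < r" for i
    unfolding Lm_def using that by (intro member_le_sum) auto
  define M where "M = K * Lm"
  \<comment> \<open>The label of Bob in the simulation comprises twice the M labels and the two
    W-dimensional halves, which become idle once they are in a fixed state. What remains is the
    original register of dimension \<open>b\<close>.\<close>
  define N where "N = 2 * M * (W * W)"
  \<comment> \<open>A label consists of a chunk number, its quotient by \<open>Lm\<close>, and the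
    number of a copy; only the first \<open>L\<close> copies of a chunk are in use.\<close>
  define act where "act e i \<longleftrightarrow> e div Lm = chunk i \<and> e mod Lm < L (chunk i)" for e i
  define n where "n p = (if act (p div r) (p mod r) then q (p mod r) else 0)" for p
  define D where "D = (\<Sum>j<r. real (q j * L (chunk j)))"
  have count: "(\<Sum>e<M. if act e i then c else 0) = real (L (chunk i)) * c" if "i < r" for i and c :: real
    unfolding M_def act_def by (rule sum_labelled[OF K[OF that] Lm[OF that]])
  have D': "D = (\<Sum>p<M * r. real (n p))"
  proof -
    have "(\<Sum>p<M * r. real (n p)) = (\<Sum>e<M. \<Sum>i<r. if act e i then real (q i) else 0)"
      unfolding sum_lessThan_mult n_def by (intro sum.cong refl) simp
    also have "\<dots> = (\<Sum>i<r. \<Sum>e<M. if act e i then real (q i) else 0)" by (rule sum.swap)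
    also have "\<dots> = D" unfolding D_def by (intro sum.cong refl) (simp add: count mult.commute)
    finally show ?thesis ..
  qed
  have D0: "0 < D" unfolding D_def using r q(1) L by (intro sum_pos) auto
  define X where "X p = tensor a (basis_fn (p div r)) (u (p mod r))" for p
  \<comment> \<open>Labels start in the upper half M, ..., 2 M - 1. This keeps the initial states of
    Bob and the targets \<open>G\<close> on disjoint supports, as the swapping unitary
    requires.\<close>
  define Y where "Y p = tensor b (basis_fn (M + p div r)) (v (p mod r))" for p
  \<comment> \<open>The target has the original Schmidt vector in the last factor, where the lifted
    steps of \<open>R\<close> act, and the same label as Alice in front.\<close>
  define G where "G p = tensor b (basis_fn (p div r)) (v (p mod r))" for p
  have MN: "M \<le> N" unfolding N_def using W by (cases W) auto
  have "orthonormal M M basis_fn" using orthonormal_basis_fn[of M 0 M] by simp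
  then have X: "orthonormal (M * a) (M * r) X" unfolding X_def[abs_def] by (rule orthonormal_tensor[OF _ u])
  have "orthonormal (2 * M) M (\<lambda>e. basis_fn (M + e))" by (rule orthonormal_basis_fn) simp
  from orthonormal_tensor[OF this v] have Y: "orthonormal (2 * M * b) (M * r) Y" unfolding Y_def[abs_def] .
  have Nb: "2 * M * b * (W * W) = N * b" by (simp add: N_def mult_ac)
  have "orthonormal N M basis_fn" using orthonormal_basis_fn[of M 0 N] MN by simp
  from orthonormal_tensor[OF this v]
  have G: "orthonormal (2 * M * b * (W * W)) (M * r) G" unfolding G_def[abs_def] Nb .
  have disj: "Y p (j div (W * W)) = 0 \<or> G p' j = 0" if "p < M * r" "p' < M * r" for p p' j
  proof (rule ccontr)
    assume "\<not> ?thesis"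
    then have "j div (W * W) div b = M + p div r" "j div b = p' div r"
      by (auto simp: Y_def G_def tensor_def basis_fn_def split: if_splits)
    moreover have "j div (W * W) div b \<le> j div b"
      by (metis div_le_dividend div_mult2_eq mult.commute)
    moreover have "p' div r < M" using that by (simp add: less_mult_imp_div_less)
    ultimately show False by linarith
  qed
  have nW: "n p \<le> W" if "p < M * r" for p using q(2)[of "p mod r"] r by (simp add: n_def W_def)
  obtain \<Psi> pre where \<Psi>: "\<Psi> \<in> carrier_mat (M * a * W) (2 * M * b * W)" and maxent: "maximally_entangled \<Psi>"
    and pre: "valid_steps pre (M * a * W, 2 * M * b * W)"
      "fold step_dims pre (M * a * W, 2 * M * b * W) = (M * a, N * b)"
      "length (filter is_send pre) = w"
    and state: "\<And>x y. fold (apply_step x y) pre \<Psi> =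
      superposition (M * a) (N * b) X G {..<M * r} (\<lambda>p. sqrt (n p / D))"
    by (rule dilution[OF X Y, of w G n D, folded W_def, OF G disj nW D' D0]) (simp_all only: Nb)
  define R' where "R' = \<lparr>resource = \<Psi>, steps = pre @ lift_steps M N (a, b) ss,
    final_measurement = lift_measurement M N (a', b') me\<rparr>"
  have R'1: "valid_protocol R'"
    using \<Psi> maxent pre lift_steps_valid[OF vs d] lift_measurement_valid[OF vm]
    by (auto simp: valid_protocol_def R'_def maximally_entangled_def valid_steps_append)
  have R'2: "maximally_entangled (resource R')" using maxent by (simp add: R'_def)
  have R'3: "communication_cost R' = w + communication_cost R"
    using lift_steps_valid(3)[OF vs d, of M N] by (simp add: communication_cost_is_send R'_def pre(3) flip: ss_me_def)
  have R'4: "output_prob R' x y z = qform r (\<lambda>i j. if chunk i = chunk j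
        then schmidt_response a b u v ss me x y z i j else 0) (\<lambda>i. sqrt (q i * L (chunk i) / D))" for x y z
  proof -
    let ?b = "schmidt_response a b u v ss me x y z"
    let ?c = "\<lambda>p. sqrt (n p / D)"
    let ?\<Xi> = "superposition (M * a) (N * b) X G {..<M * r} ?c"
    have c: "?c (e * r + i) = (if act e i then sqrt (q i / D) else 0)" if "i < r" for e i
      using that by (simp add: n_def)
    have "output_prob R' x y z = response (lift_steps M N (a, b) ss) (lift_measurement M N (a', b') me) x y z ?\<Xi> ?\<Xi>"
      unfolding output_prob_response R'_def by (simp add: response_append state)
    also have "\<dots> = (\<Sum>e<M. \<Sum>f<N. response ss me x y z (block a b e f ?\<Xi>) (block a b e f ?\<Xi>))"
      by (rule response_lift[OF vs d vm superposition_carrier])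
    also have "\<dots> = (\<Sum>e<M. \<Sum>f<N. if f = e then \<Sum>i<r. \<Sum>j<r. ?c (e * r + i) * ?c (e * r + j) * ?b i j else 0)"
    proof (intro sum.cong refl)
      fix e f assume "e \<in> {..<M}" "f \<in> {..<N}"
      then have block: "block a b e f ?\<Xi> = superposition a b u v {..<r} (\<lambda>i. if e = f then ?c (e * r + i) else 0)"
        unfolding X_def[abs_def] G_def[abs_def] by (intro block_superposition_tensor r) simp_all
      show "response ss me x y z (block a b e f ?\<Xi>) (block a b e f ?\<Xi>) =
          (if f = e then \<Sum>i<r. \<Sum>j<r. ?c (e * r + i) * ?c (e * r + j) * ?b i j else 0)"
        unfolding block response_superposition[OF u v vs d vm] by (cases "e = f") simp_all
    qed
    also have "\<dots> = (\<Sum>e<M. \<Sum>i<r. \<Sum>j<r. ?c (e * r + i) * ?c (e * r + j) * ?b i j)"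
      using MN by (intro sum.cong[OF refl]) simp
    also have "\<dots> = (\<Sum>i<r. \<Sum>j<r. \<Sum>e<M. ?c (e * r + i) * ?c (e * r + j) * ?b i j)"
      by (rule sum_rotate[where f = "\<lambda>i j e. ?c (e * r + i) * ?c (e * r + j) * ?b i j", symmetric])
    also have "\<dots> = (\<Sum>i<r. \<Sum>j<r. sqrt (q i * L (chunk i) / D) * sqrt (q j * L (chunk j) / D) * (if chunk i = chunk j then ?b i j else 0))"
    proof (intro sum.cong refl)
      fix i j assume "i \<in> {..<r}" "j \<in> {..<r}"
      then have ij: "i < r" "j < r" by auto
      \<comment> \<open>A label at which both terms are active belongs to both chunks: it is one of
        the copies of their common chunk, and there is none if the chunks differ.\<close>
      have "(\<Sum>e<M. ?c (e * r + i) * ?c (e * r + j) * ?b i j) =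
          (\<Sum>e<M. if act e i then (if chunk i = chunk j then sqrt (q i / D) * sqrt (q j / D) * ?b i j else 0) else 0)"
        unfolding c[OF ij(1)] c[OF ij(2)] by (intro sum.cong refl) (auto simp: act_def)
      also have "\<dots> = real (L (chunk i)) * (if chunk i = chunk j then sqrt (q i / D) * sqrt (q j / D) * ?b i j else 0)"
        by (rule count[OF ij(1)])
      also have "\<dots> = sqrt (q i * L (chunk i) / D) * sqrt (q j * L (chunk j) / D) * (if chunk i = chunk j then ?b i j else 0)"
      proof (cases "chunk i = chunk j")
        case True
        have s: "sqrt (q k * L (chunk k) / D) = sqrt (q k / D) * sqrt (L (chunk k))" for k
        proof -
          have "q k * L (chunk k) / D = q k / D * L (chunk k)" by simp
          then show ?thesis by (simp only: real_sqrt_mult)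
        qed
        have alg: "l * (A * B * x) = A * t * (B * t) * x" if "l = t * t" for l A B x t :: real
          using that by (simp add: mult_ac)
        have "real (L (chunk j)) = sqrt (L (chunk j)) * sqrt (L (chunk j))" by simp
        from alg[OF this] show ?thesis unfolding s by (simp only: True refl if_True)
      qed simp
      finally show "(\<Sum>e<M. ?c (e * r + i) * ?c (e * r + j) * ?b i j) =
          sqrt (q i * L (chunk i) / D) * sqrt (q j * L (chunk j) / D) * (if chunk i = chunk j then ?b i j else 0)" .
    qed
    finally show ?thesis unfolding qform_def .
  qed
  show ?thesis by (rule that[OF R'1 R'2 R'3 R'4[unfolded D_def a_b_def ss_me_def]])
qed

section \<open>Large errors and the final estimate\<close>

lemma output_prob_bounds:
  assumes "valid_protocol R"
  shows "0 \<le> output_prob R x y z" "output_prob R x y z \<le> 1"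
proof -
  let ?a = "dim_row (resource R)" and ?b = "dim_col (resource R)"
  obtain a' b' where d: "fold step_dims (steps R) (?a, ?b) = (a', b')" by fastforce
  have "valid_steps (steps R) (?a, ?b)" "valid_measurement (final_measurement R) (a', b')" "braket (resource R) (resource R) = 1"
    using assms d by (simp_all add: valid_protocol_def Let_def normalized_braket)
  note p = this
  have c: "resource R \<in> carrier_mat ?a ?b" by simp
  show "0 \<le> output_prob R x y z" "output_prob R x y z \<le> 1"
    using response_bounds[OF p(1) d p(2) c, of x y z] unfolding output_prob_response p(3) by simp_all
qed

lemma simulates_computes:
  assumes "simulates R' R \<epsilon>" "computes R f \<epsilon>'"
  shows "computes R' f (\<epsilon> + \<epsilon>')"
  unfolding computes_def
proof (intro allI impI)
  fix x y z assume "f (x, y) = Some z"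
  then have "1 - \<epsilon>' \<le> output_prob R x y z" using assms(2) by (simp add: computes_def)
  moreover have "\<bar>output_prob R' x y z - output_prob R x y z\<bar> \<le> \<epsilon>" using assms(1) by (simp add: simulates_def)
  ultimately show "1 - (\<epsilon> + \<epsilon>') \<le> output_prob R' x y z" by linarith
qed

text \<open>Meant for \<epsilon> \<ge> 1, where any two output probabilities are within \<epsilon>.
  The logarithm is then at most 0 and the cost bound can vanish, namely at log 2 \<epsilon> = Q, so
  a protocol without any communication is called for.\<close>

lemma trivial_protocol:
  obtains T where "valid_protocol T" "maximally_entangled (resource T)" "communication_cost T = 0"
proof
  define \<Psi> where "\<Psi> = superposition 1 1 (\<lambda>_ _. 1) (\<lambda>_ _. 1) {..<1} (\<lambda>_. 1)"
  define T where "T = \<lparr>resource = \<Psi>, steps = [], final_measurement = AliceMeasures (\<lambda>x z. if z then 1\<^sub>m 1 else 0\<^sub>m 1 1)\<rparr>"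
  have o: "orthonormal 1 1 (\<lambda>_ _. 1)" by (simp add: orthonormal_def inner_fn_def)
  show me: "maximally_entangled (resource T)"
    unfolding T_def \<Psi>_def protocol.select_convs
    by (rule maximally_entangled_superposition[OF o o, of _ 1]) simp_all
  have "positive_semidefinite 1 (1\<^sub>m 1)" "positive_semidefinite 1 (0\<^sub>m 1 1)"
    by (rule psdI; simp add: mat_app_def inner_fn_def less_eq_complex_def cnj_mult_self)+
  then have "povm 1 (\<lambda>z. if z then 1\<^sub>m 1 else 0\<^sub>m 1 1)" by (simp add: povm_def)
  then show "valid_protocol T" using me
    by (simp add: valid_protocol_def T_def maximally_entangled_def \<Psi>_def superposition_def)
  show "communication_cost T = 0" by (simp add: T_def communication_cost_def)
qed

lemma maximally_entangled_simulation:
  fixes R :: protocol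
  assumes R: "valid_protocol R" and Q: "communication_cost R = Q" "5 \<le> Q" and \<epsilon>: "0 < \<epsilon>" "\<epsilon> < 1"
  obtains R' where "valid_protocol R'" "maximally_entangled (resource R')" "simulates R' R \<epsilon>"
    "real (communication_cost R') \<le> 60 * (Q / \<epsilon> + log 2 (1 / \<epsilon>) / \<epsilon>)"
proof -
  define a b where "a = dim_row (resource R)" "b = dim_col (resource R)"
  let ?ss = "steps R" and ?me = "final_measurement R"
  obtain a' b' where d: "fold step_dims ?ss (a, b) = (a', b')" by fastforce
  have vs: "valid_steps ?ss (a, b)" and vm: "valid_measurement ?me (a', b')" and nm: "braket (resource R) (resource R) = 1"
    using R d by (simp_all add: valid_protocol_def Let_def normalized_braket a_b_def)
  \<comment> \<open>Only strictly positive coefficients are kept, because the bins use their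
    logarithms.\<close>
  obtain r \<sigma> u v where \<sigma>: "\<And>k. k < r \<Longrightarrow> 0 < \<sigma> k" and u: "orthonormal a r u" and v: "orthonormal b r v"
    and svd: "\<And>i j. i < a \<Longrightarrow> j < b \<Longrightarrow>
      resource R $$ (i, j) = (\<Sum>k<r. of_real (\<sigma> k) * u k i * v k j)"
    using singular_value_decomposition[of a b "\<lambda>i j. resource R $$ (i, j)"] by blast
  have res: "resource R = superposition a b u v {..<r} \<sigma>"
    by (rule eq_matI) (auto simp: superposition_def svd a_b_def)
  have one: "(\<Sum>i<r. (\<sigma> i)\<^sup>2) = 1"
  proof -
    have "complex_of_real (\<Sum>i<r. (\<sigma> i)\<^sup>2) = 1"
      using nm braket_superposition[OF u v, of "{..<r}" \<sigma>] unfolding res by simp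
    then show ?thesis by (simp only: of_real_eq_1_iff)
  qed
  then have r: "0 < r" by (cases r) auto
  obtain chunk L q :: "nat \<Rightarrow> nat" and w :: nat where L: "\<And>i. i < r \<Longrightarrow> 0 < L (chunk i)" and q: "\<And>i. i < r \<Longrightarrow> 0 < q i" "\<And>i. i < r \<Longrightarrow> q i \<le> 2 ^ w"
    and cost: "real (w + Q) \<le> 60 * (Q / \<epsilon> + log 2 (1 / \<epsilon>) / \<epsilon>)"
    and approx: "\<And>b. subunit_form r b \<Longrightarrow> low_rank_form r (4 ^ Q) \<sigma> b \<Longrightarrow>
      \<bar>qform r (\<lambda>i j. if chunk i = chunk j then b i j else 0)
         (\<lambda>i. sqrt (q i * L (chunk i) / (\<Sum>j<r. real (q j * L (chunk j))))) - qform r b \<sigma>\<bar> \<le> \<epsilon>"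
    by (rule flattened_spectrum[of r \<sigma> \<epsilon> Q], erule \<sigma>, rule one, rule \<epsilon>(1), rule \<epsilon>(2), rule Q(2), rule that)
  obtain R' where R': "valid_protocol R'" "maximally_entangled (resource R')"
    "communication_cost R' = w + communication_cost R"
    and out: "\<And>x y z. output_prob R' x y z = qform r (\<lambda>i j. if chunk i = chunk j
        then schmidt_response a b u v ?ss ?me x y z i j else 0)
      (\<lambda>i. sqrt (q i * L (chunk i) / (\<Sum>j<r. real (q j * L (chunk j)))))"
    by (rule flat_simulation[of R r u v L chunk q w], rule R, fold a_b_def, rule u, rule v, rule r, erule L, erule q(1), erule q(2), rule that)
  have "simulates R' R \<epsilon>"
    unfolding simulates_def
  proof (intro allI)
    fix x y z
    let ?b = "schmidt_response a b u v ?ss ?me x y z"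
    have "output_prob R x y z = qform r ?b \<sigma>"
      unfolding output_prob_response qform_def res by (rule response_superposition[OF u v vs d vm])
    moreover have "low_rank_form r (4 ^ Q) \<sigma> ?b"
      using low_rank_schmidt_response[OF u v vs d vm, of \<sigma> x y z] \<sigma>
      unfolding communication_cost_is_send[symmetric] Q(1) by (simp add: less_imp_le)
    ultimately show "\<bar>output_prob R' x y z - output_prob R x y z\<bar> \<le> \<epsilon>"
      using approx[OF subunit_schmidt_response[OF u v vs d vm]] out by simp
  qed
  with R' cost Q show ?thesis using that[of R'] by simp
qed

theorem theorem1:
  shows "\<exists>C>0. \<forall>(R :: protocol) (f :: input \<times> input \<rightharpoonup> bool) (Q :: nat) (\<epsilon> :: real).
    valid_protocol R \<longrightarrow> communication_cost R = Q \<longrightarrow> Q \<ge> 15 \<longrightarrow> \<epsilon> > 0 \<longrightarrow>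
    (\<exists>R'. valid_protocol R' \<and> maximally_entangled (resource R') \<and>
       simulates R' R \<epsilon> \<and>
       real (communication_cost R') \<le> C * \<bar>real Q / \<epsilon> + log 2 (1 / \<epsilon>) / \<epsilon>\<bar> \<and>
       (\<forall>\<epsilon>'. computes R f \<epsilon>' \<longrightarrow> computes R' f (\<epsilon> + \<epsilon>')))"
proof (intro exI[of _ 60] conjI allI impI)
  fix R :: protocol and f :: "input \<times> input \<rightharpoonup> bool" and Q :: nat and \<epsilon> :: real
  assume R: "valid_protocol R" "communication_cost R = Q" "Q \<ge> 15" "\<epsilon> > 0"
  have "\<exists>R'. valid_protocol R' \<and> maximally_entangled (resource R') \<and> simulates R' R \<epsilon> \<and>
       real (communication_cost R') \<le> 60 * \<bar>real Q / \<epsilon> + log 2 (1 / \<epsilon>) / \<epsilon>\<bar>"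
  proof (cases "\<epsilon> < 1")
    case True
    obtain R' where "valid_protocol R'" "maximally_entangled (resource R')" "simulates R' R \<epsilon>"
      "real (communication_cost R') \<le> 60 * (Q / \<epsilon> + log 2 (1 / \<epsilon>) / \<epsilon>)"
      using maximally_entangled_simulation[OF R(1,2) _ R(4) True] R(3) by auto
    moreover have "60 * (Q / \<epsilon> + log 2 (1 / \<epsilon>) / \<epsilon>) \<le> 60 * \<bar>Q / \<epsilon> + log 2 (1 / \<epsilon>) / \<epsilon>\<bar>"
      by (intro mult_left_mono abs_ge_self) simp
    ultimately show ?thesis by (intro exI[of _ R'] conjI) simp_all
  next
    case False
    obtain T where T: "valid_protocol T" "maximally_entangled (resource T)" "communication_cost T = 0"
      by (rule trivial_protocol)
    have "simulates T R \<epsilon>"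
      unfolding simulates_def
    proof (intro allI)
      fix x y z
      show "\<bar>output_prob T x y z - output_prob R x y z\<bar> \<le> \<epsilon>"
        using output_prob_bounds[OF T(1), of x y z] output_prob_bounds[OF R(1), of x y z] False by linarith
    qed
    with T show ?thesis by (intro exI[of _ T]) simp
  qed
  then obtain R' where R': "valid_protocol R'" "maximally_entangled (resource R')" "simulates R' R \<epsilon>"
    "real (communication_cost R') \<le> 60 * \<bar>real Q / \<epsilon> + log 2 (1 / \<epsilon>) / \<epsilon>\<bar>" by (elim exE conjE)
  show "\<exists>R'. valid_protocol R' \<and> maximally_entangled (resource R') \<and> simulates R' R \<epsilon> \<and>
       real (communication_cost R') \<le> 60 * \<bar>real Q / \<epsilon> + log 2 (1 / \<epsilon>) / \<epsilon>\<bar> \<and>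
       (\<forall>\<epsilon>'. computes R f \<epsilon>' \<longrightarrow> computes R' f (\<epsilon> + \<epsilon>'))"
    by (intro exI[of _ R'] conjI allI impI R' simulates_computes[OF R'(3)])
qed simp

end
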